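(* Let $G$ be a random graph of size $n$ generated by the subgraph generated model with finite set of subgraph types $T$ and probabilities $p(\cdot,\cdot)$, either weighted ($\mathrm{wSUGM}(n,T,p)$) or unweighted ($\mathrm{uSUGM}(n,T,p)$). Let $A$ be the adjacency matrix of $G$, $\Delta:=\|\mathbb{E}[A]\|_\infty$ the maximum expected degree, and $\bar A:=A/\Delta$ the normalized adjacency matrix. Let $c(\cdot)$ be either degree centrality, eigenvector centrality, or Katz centrality (with $\alpha\in(0,1/\lambda^* )$, $\lambda^*$ as in (iii)). Let $\epsilon>0$. Suppose that the following assumptions are satisfied: (i) for every $t\in T$ there are constants $h_t$ with $m_t-2<h_t<m_t-1$ and $0<l_t<u_t$, independent of $n$, such that for every $L\in\mathfrak{S}(n,m_t)$, either $p(t,L)=0$ or $p(t,L)=b_t(L)/n^{h_t}$ with $b_t(L)\in[l_t,u_t]$; (ii) for every $t\in T$ there is $\xi_t\in(0,1)$, independent of $n$, such that $|\{L\in\mathfrak{S}(n,m_t):p(t,L)>0\}|\ge\xi_t\,|\mathfrak{S}(n,m_t)|$ and, for every pair of nodes $i,j$, $|\{L\in\mathfrak{S}(n,m_t): i,j\in L,\ p(t,L)>0\}|\ge \xi_t\,|\{L\in\mathfrak{S}(n,m_t): i,j\in L\}|$; (iii) $\bar A$ corresponds to a connected graph, where $\lambda_1(\mathbb{E}[\bar A])\to\lambda^*$ as $n\to\infty$ and $|\lambda_1(\mathbb{E}[\bar A])-\lambda_2(\mathbb{E}[\bar A])|\in[\kappa_1,\kappa_2]$ for fixed constants $\kappa_1,\kappa_2>0$,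 with $\lambda_i(\mathbb{E}[\bar A])$ the $i$-th largest eigenvalue of $\mathbb{E}[\bar A]$. Then, for $n$ sufficiently large, with probability at least $1-\epsilon$, $$\frac1n\,\|c(\bar A)-c(\mathbb{E}[\bar A])\|_1\le\phi(n),$$ where $\phi(n)\to0$ as $n\to\infty$.
   Context: Subgraph types. $T$ is a finite set of types, fixed independently of $n$. Each type $t\in T$ is a fixed nonempty undirected graph on $m_t\le n$ nodes. $\mathfrak{S}(n,m_t)$ denotes the set of all ordered lists $L=[v_1,\dots,v_{m_t}]$ of $m_t$ distinct nodes out of $n$ nodes, and $g_t(L)$ is the subgraph of type $t$ generated on the ordered list $L$. $A(t,L)\in\{0,1\}^{n\times n}$ is the symmetric adjacency matrix of $g_t(L)$: $A(t,L)_{ij}=A(t,L)_{ji}=1$ if and only if $i,j\in L$ and the edge $(i,j)$ exists in $g_t(L)$. Models. For each $n$, probabilities $p(t,L)\in[0,1]$ are given for all $t\in T$, $L\in\mathfrak{S}(n,m_t)$, and each subgraph $g_t(L)$ is formed independently with probability $p(t,L)$; let $x(t,L)\sim\mathrm{Bernoulli}(p(t,L))$ be the corresponding mutually independent indicators. The weighted model $\mathrm{wSUGM}(n,T,p)$ has adjacency matrix $A_w=\sum_{t\in T}\sum_{L\in\mathfrak{S}(n,m_t)} x(t,L)A(t,L)$, so that $(A_w)_{ij}$ is the total number of times edge $(i,j)$ is generated. The unweighted model $\mathrm{uSUGM}(n,T,p)$ has adjacency matrix $A_u\in\{0,1\}^{n\times n}$ with $(A_u)_{ij}=\min\{(A_w)_{ij},1\}$,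 i.e. $(A_u)_{ij}=1$ if the edge $(i,j)$ is generated by at least one subgraph. Norms. $\|\cdot\|_\infty$ is the maximum absolute row sum of a matrix; $\|\cdot\|_1$ of a vector is the sum of the absolute values of its entries; $\|\cdot\|_2$ of a vector is the Euclidean norm. Centralities of a symmetric nonnegative $n\times n$ matrix $B$, with $\mathbf 1$ the all-ones vector and $\lambda_1(B)$ the largest eigenvalue of $B$: degree centrality is $c^d(B)=B\mathbf 1$; eigenvector centrality is $c^e(B)=\sqrt n\,v_1$, where $v_1$ is the dominant eigenvector of $B$ (the eigenvector for $\lambda_1(B)$, taken entrywise nonnegative) normalized so that $\|v_1\|_2=1$; Katz centrality is $c^k_\alpha(B)=\sum_{i\ge0}(\alpha B)^i\mathbf 1=(I-\alpha B)^{-1}\mathbf 1$ for $\alpha\in(0,1/\lambda_1(B))$. A matrix $B$ corresponds to a connected graph if the graph with edges $\{i,j\}$, $B_{ij}>0$, is connected. *)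

theory Defs
  imports "HOL-Probability.Probability" "Jordan_Normal_Form.Char_Poly"
begin

hide_type (open) Finite_Cartesian_Product.vec
hide_const (open) Finite_Cartesian_Product.vec Finite_Cartesian_Product.vec_nth
  Finite_Cartesian_Product.vec_lambda Finite_Cartesian_Product.mat
unbundle no vec_syntax
unbundle no inner_syntax

section \<open>Subgraph types and the subgraph generated models\<close>

text \<open>
  A type is a pair \<open>(m, E)\<close>: a simple graph with vertices \<open>0, \<dots>, m - 1\<close> and edge set \<open>E\<close>.
  As usual, ``nonempty'' means that there is at least one edge.
\<close>

type_synonym sg_type = "nat \<times> nat set set"

definition nonempty_graph :: "sg_type \<Rightarrow> bool" where
  "nonempty_graph t \<longleftrightarrow>
     snd t \<noteq> {} \<and> snd t \<subseteq> {{a, b} | a b. a < fst t \<and> b < fst t \<and> a \<noteq> b}"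

text \<open>The nodes of a graph of size \<open>n\<close> are \<open>0, \<dots>, n - 1\<close>.\<close>

definition ordered_lists :: "nat \<Rightarrow> nat \<Rightarrow> nat list set" where
  "ordered_lists n m = {L. length L = m \<and> distinct L \<and> set L \<subseteq> {..<n}}"

text \<open>The \<open>a\<close>-th vertex of the type \<open>t\<close> is placed on the node \<open>L ! a\<close>.\<close>

definition subgraph_adj :: "nat \<Rightarrow> sg_type \<Rightarrow> nat list \<Rightarrow> real mat" where
  "subgraph_adj n t L = mat n n (\<lambda>(i, j).
     of_bool (\<exists>a < fst t. \<exists>b < fst t. {a, b} \<in> snd t \<and> L ! a = i \<and> L ! b = j))"

text \<open>
  The models are given as the distributions of their adjacency matrices. The product distribution
  \<open>indicators\<close> is the joint law of the independent Bernoulli variables \<open>x(t, L)\<close>.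
\<close>

definition indicators ::
    "nat \<Rightarrow> sg_type set \<Rightarrow> (sg_type \<Rightarrow> nat list \<Rightarrow> real) \<Rightarrow> (sg_type \<times> nat list \<Rightarrow> bool) pmf" where
  "indicators n T p =
     Pi_pmf (SIGMA t:T. ordered_lists n (fst t)) False (\<lambda>(t, L). bernoulli_pmf (p t L))"

definition wSUGM ::
    "nat \<Rightarrow> sg_type set \<Rightarrow> (sg_type \<Rightarrow> nat list \<Rightarrow> real) \<Rightarrow> real mat pmf" where
  "wSUGM n T p = map_pmf
     (\<lambda>x. mat n n (\<lambda>ij. \<Sum>t\<in>T. \<Sum>L\<in>ordered_lists n (fst t).
        of_bool (x (t, L)) * subgraph_adj n t L $$ ij))
     (indicators n T p)"

definition uSUGM ::
    "nat \<Rightarrow> sg_type set \<Rightarrow> (sg_type \<Rightarrow> nat list \<Rightarrow> real) \<Rightarrow> real mat pmf" where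
  "uSUGM n T p = map_pmf (map_mat (\<lambda>a. min a 1)) (wSUGM n T p)"

section \<open>Norms, expectation and normalization\<close>

definition inf_norm_mat :: "real mat \<Rightarrow> real" where
  "inf_norm_mat B = Max ((\<lambda>i. \<Sum>j<dim_col B. \<bar>B $$ (i, j)\<bar>) ` {..<dim_row B})"

definition norm1_vec :: "real vec \<Rightarrow> real" where
  "norm1_vec v = (\<Sum>i<dim_vec v. \<bar>v $ i\<bar>)"

definition norm2_vec :: "real vec \<Rightarrow> real" where
  "norm2_vec v = sqrt (\<Sum>i<dim_vec v. (v $ i)\<^sup>2)"

definition expected_mat :: "nat \<Rightarrow> real mat pmf \<Rightarrow> real mat" where
  "expected_mat n D = mat n n (\<lambda>ij. measure_pmf.expectation D (\<lambda>A. A $$ ij))"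

definition max_expected_degree :: "nat \<Rightarrow> real mat pmf \<Rightarrow> real" where
  "max_expected_degree n D = inf_norm_mat (expected_mat n D)"

definition normalized :: "nat \<Rightarrow> real mat pmf \<Rightarrow> real mat pmf" where
  "normalized n D = map_pmf (\<lambda>A. (1 / max_expected_degree n D) \<cdot>\<^sub>m A) D"

section \<open>Eigenvalues, connectedness and centralities\<close>

text \<open>
  The \<open>k\<close>-th largest eigenvalue (\<open>k = 1, 2, \<dots>\<close>), counted with multiplicity. For symmetric
  matrices, the only ones it is used for, all roots of the characteristic polynomial are real,
  so that it is meaningful for \<open>k\<close> up to the dimension.
\<close>

definition nth_eigenvalue :: "nat \<Rightarrow> real mat \<Rightarrow> real" where
  "nth_eigenvalue k B = rev (sorted_list_of_multiset (proots (char_poly B))) ! (k - 1)"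

definition connected_graph :: "real mat \<Rightarrow> bool" where
  "connected_graph B \<longleftrightarrow>
     (\<forall>i < dim_row B. \<forall>j < dim_row B.
        (i, j) \<in> {(a, b). a < dim_row B \<and> b < dim_row B \<and> B $$ (a, b) > 0}\<^sup>*)"

definition ones :: "nat \<Rightarrow> real vec" where
  "ones n = vec n (\<lambda>_. 1)"

definition degree_centrality :: "real mat \<Rightarrow> real vec" where
  "degree_centrality B = B *\<^sub>v ones (dim_row B)"

definition is_dominant_eigenvector :: "real mat \<Rightarrow> real vec \<Rightarrow> bool" where
  "is_dominant_eigenvector B v \<longleftrightarrow>
     eigenvector B v (nth_eigenvalue 1 B) \<and> (\<forall>i < dim_row B. v $ i \<ge> 0) \<and> norm2_vec v = 1"

definition eigenvector_centrality :: "real mat \<Rightarrow> real vec" where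
  "eigenvector_centrality B =
     sqrt (real (dim_row B)) \<cdot>\<^sub>v (THE v. is_dominant_eigenvector B v)"

text \<open>The \<open>k\<close>-th entry of the series \<open>\<Sum>i. (\<alpha> B)\<^sup>i 1\<close>.\<close>

definition katz_centrality :: "real \<Rightarrow> real mat \<Rightarrow> real vec" where
  "katz_centrality \<alpha> B =
     vec (dim_row B) (\<lambda>k. \<Sum>i. (((\<alpha> \<cdot>\<^sub>m B) ^\<^sub>m i) *\<^sub>v ones (dim_row B)) $ k)"

datatype centrality_kind = Degree | Eigenvector | Katz real

fun centrality :: "centrality_kind \<Rightarrow> real mat \<Rightarrow> real vec" where
  "centrality Degree B = degree_centrality B"
| "centrality Eigenvector B = eigenvector_centrality B"
| "centrality (Katz \<alpha>) B = katz_centrality \<alpha> B"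

text \<open>
  Whether the centrality is defined at \<open>B\<close>, i.e. \<open>centrality\<close> does not return a junk value.
  In the Katz case the product form of \<open>\<alpha> < 1/\<lambda>\<^sub>1(B)\<close> also covers \<open>\<lambda>\<^sub>1(B) = 0\<close>, where \<open>1/\<lambda>\<^sub>1(B)\<close>
  stands for infinity.
\<close>

fun centrality_defined :: "centrality_kind \<Rightarrow> real mat \<Rightarrow> bool" where
  "centrality_defined Degree B \<longleftrightarrow> True"
| "centrality_defined Eigenvector B \<longleftrightarrow> (\<exists>!v. is_dominant_eigenvector B v)"
| "centrality_defined (Katz \<alpha>) B \<longleftrightarrow> 0 < \<alpha> \<and> \<alpha> * nth_eigenvalue 1 B < 1"

end

theory Submission
  imports Defs "Jordan_Normal_Form.Schur_Decomposition" "HOL-Real_Asymp.Real_Asymp"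
begin

text \<open>
  Write \<open>A\<close> for the normalized adjacency matrix, \<open>M\<close> for its expectation. For a fixed weight matrix
  \<open>W \<ge> 0\<close>, the sum \<open>\<Sum> A i j * W i j\<close> is dominated by a linear combination of the independent
  indicators, which gives a Chernoff bound for its upper tail; the unweighted model lies below the
  weighted one, and its mean is smaller by a negligible amount. Lower tails are needed only on
  average, and follow since the deviations have mean zero.

  No bound on the operator norm of \<open>A - M\<close> is used. For Katz centrality, the Katz vector \<open>z\<close> of \<open>M\<close> is
  bounded, so \<open>(A - M) z\<close> is small from above in every coordinate; then \<open>z\<close> is a positive test vector
  showing that \<open>\<alpha> A\<close> has spectral radius below 1, and it bounds the resolvent of \<open>A\<close> in the 1-norm.
  For eigenvector centrality, the quadratic form of \<open>A\<close> at the dominant eigenvector of \<open>M\<close> is close to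
  \<open>\<lambda>\<^sub>1(M)\<close>. Conversely the dominant eigenvector of \<open>A\<close> has no mass on large coordinates because small
  vertex sets span few edges, and its bounded part sees \<open>A\<close> like \<open>M\<close> by a discrepancy bound over all
  pairs of vertex sets; the spectral gap of \<open>M\<close> then forces the two eigenvectors to be close.
\<close>

section \<open>Rayleigh quotients and eigenvalues of symmetric matrices\<close>

text \<open>The edges of one subgraph appear together, so the entries of \<open>A\<close> are
  dependent; only the indicators are independent. Hence exponential moments are computed for linear
  functionals of the entries, regrouped by subgraphs. Truncation at 1 breaks linearity, but only
  downwards, which is why all exponential bounds are one-sided. The two bounds on \<open>h t\<close>
  enter at separate places. The upper one makes the expected degrees grow at least like a positive
  power of n; this pays for a union over n rows, and the exponent, multiplied by the size of a
  vertex set or by n, pays for unions over vertex sets. The lower one makes the expected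
  multiplicity of each pair tend to 0, so that multiple edges are rare. For every fixed tolerance
  the failure probability is shown to tend to 0; a diagonal choice of tolerances then produces the
  null sequence. For eigenvector centrality, closeness also yields definedness: uniqueness of the
  dominant eigenvector of the random matrix is deduced from the closeness of all its candidates to
  one vector.\<close>

definition dot :: "nat \<Rightarrow> (nat \<Rightarrow> real) \<Rightarrow> (nat \<Rightarrow> real) \<Rightarrow> real" where
  "dot n f g = (\<Sum>i<n. f i * g i)"

text \<open>Vectors and matrices are functions on \<open>nat\<close> of which only the values below
  \<open>n\<close> matter. This keeps dimension conditions out of the algebra; \<open>ent\<close>
  and \<open>vec n\<close> translate from and to the matrix types.\<close>

definition app :: "nat \<Rightarrow> (nat \<Rightarrow> nat \<Rightarrow> real) \<Rightarrow> (nat \<Rightarrow> real) \<Rightarrow> nat \<Rightarrow> real" where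
  "app n B f i = (\<Sum>j<n. B i j * f j)"

definition sym_on :: "nat \<Rightarrow> (nat \<Rightarrow> nat \<Rightarrow> real) \<Rightarrow> bool" where
  "sym_on n B \<longleftrightarrow> (\<forall>i<n. \<forall>j<n. B i j = B j i)"

definition nonneg_on :: "nat \<Rightarrow> (nat \<Rightarrow> nat \<Rightarrow> real) \<Rightarrow> bool" where
  "nonneg_on n B \<longleftrightarrow> (\<forall>i<n. \<forall>j<n. 0 \<le> B i j)"

lemma dot_commute: "dot n f g = dot n g f"
  by (simp add: dot_def mult.commute)

lemma dot_add_left: "dot n (\<lambda>i. f i + g i) h = dot n f h + dot n g h"
  by (simp add: dot_def algebra_simps sum.distrib)

lemma dot_add_right: "dot n h (\<lambda>i. f i + g i) = dot n h f + dot n h g"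
  by (simp add: dot_def algebra_simps sum.distrib)

lemma dot_diff_left: "dot n (\<lambda>i. f i - g i) h = dot n f h - dot n g h"
  by (simp add: dot_def algebra_simps sum_subtractf)

lemma dot_diff_right: "dot n h (\<lambda>i. f i - g i) = dot n h f - dot n h g"
  by (simp add: dot_def algebra_simps sum_subtractf)

lemma dot_scale_left: "dot n (\<lambda>i. a * f i) h = a * dot n f h"
  by (simp add: dot_def sum_distrib_left mult.assoc)

lemma dot_scale_right: "dot n h (\<lambda>i. a * f i) = a * dot n h f"
  by (simp add: dot_def sum_distrib_left algebra_simps)

lemmas dot_linear = dot_add_left dot_add_right dot_diff_left dot_diff_right
  dot_scale_left dot_scale_right

lemma dot_cong: "(\<And>i. i < n \<Longrightarrow> f i = f' i) \<Longrightarrow> (\<And>i. i < n \<Longrightarrow> g i = g' i) \<Longrightarrow> dot n f g = dot n f' g'"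
  by (simp add: dot_def)

lemma dot_mono: 
  "(\<And>i. i < n \<Longrightarrow> 0 \<le> f i) \<Longrightarrow> (\<And>i. i < n \<Longrightarrow> g i \<le> g' i) \<Longrightarrow> dot n f g \<le> dot n f g'"
  by (auto simp: dot_def intro!: sum_mono mult_left_mono)

lemma dot_self_nonneg: "0 \<le> dot n f f"
  by (simp add: dot_def sum_nonneg)

lemma dot_self_eq_0: "dot n f f = 0 \<longleftrightarrow> (\<forall>i<n. f i = 0)"
  by (auto simp: dot_def sum_nonneg_eq_0_iff)

lemma dot_nonneg: "(\<And>i. i < n \<Longrightarrow> 0 \<le> f i) \<Longrightarrow> (\<And>i. i < n \<Longrightarrow> 0 \<le> g i) \<Longrightarrow> 0 \<le> dot n f g"
  by (auto simp: dot_def intro!: sum_nonneg)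

lemma dot_Cauchy_Schwarz: "(dot n f g)\<^sup>2 \<le> dot n f f * dot n g g"
  using Cauchy_Schwarz_ineq_sum[of f g "{..<n}"] by (simp add: dot_def power2_eq_square)

lemma app_add: "app n B (\<lambda>i. f i + g i) = (\<lambda>i. app n B f i + app n B g i)"
  by (simp add: app_def algebra_simps sum.distrib fun_eq_iff)

lemma app_diff: "app n B (\<lambda>i. f i - g i) = (\<lambda>i. app n B f i - app n B g i)"
  by (simp add: app_def algebra_simps sum_subtractf fun_eq_iff)

lemma app_scale: "app n B (\<lambda>i. a * f i) = (\<lambda>i. a * app n B f i)"
  by (simp add: app_def sum_distrib_left fun_eq_iff algebra_simps)

lemma app_cong: "(\<And>j. j < n \<Longrightarrow> f j = g j) \<Longrightarrow> app n B f = app n B g"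
  by (simp add: app_def fun_eq_iff)

lemma app_nonneg: 
  "nonneg_on n B \<Longrightarrow> (\<And>j. j < n \<Longrightarrow> 0 \<le> f j) \<Longrightarrow> i < n \<Longrightarrow> 0 \<le> app n B f i"
  by (auto simp: app_def nonneg_on_def intro!: sum_nonneg)

lemma dot_app: "dot n f (app n B g) = (\<Sum>i<n. \<Sum>j<n. B i j * (f i * g j))"
  by (simp add: dot_def app_def sum_distrib_left algebra_simps)

lemma dot_app_sym:
  assumes "sym_on n B"
  shows "dot n (app n B f) g = dot n f (app n B g)"
proof -
  have "dot n (app n B f) g = (\<Sum>i<n. \<Sum>j<n. B i j * (g i * f j))"
    by (subst dot_commute) (rule dot_app)
  also have "\<dots> = (\<Sum>i<n. \<Sum>j<n. B j i * (f j * g i))"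
    using assms by (intro sum.cong refl) (auto simp: sym_on_def)
  also have "\<dots> = (\<Sum>j<n. \<Sum>i<n. B j i * (f j * g i))" by (rule sum.swap)
  finally show ?thesis by (simp add: dot_app)
qed

text \<open>Tychonoff's theorem in the product topology on functions. The coordinates from
  \<open>n\<close> on are frozen at 0, since a full real line as a factor would not be
  compact.\<close>

lemma compact_box: "compact {f::nat \<Rightarrow> real. \<forall>i. f i \<in> (if i < n then {-1..1} else {0})}"
proof -
  have "compactin (product_topology (\<lambda>_::nat. euclidean :: real topology) UNIV)
     (Pi\<^sub>E UNIV (\<lambda>i. if i < n then {-1..1} else {0}))"
    by (auto simp: compactin_PiE)
  moreover have "Pi\<^sub>E UNIV (\<lambda>i. if i < n then {-1..1} else {0::real}) =
     {f::nat \<Rightarrow> real. \<forall>i. f i \<in> (if i < n then {-1..1} else {0})}"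
    by (auto simp: PiE_UNIV_domain Pi_def)
  ultimately show ?thesis
    by (metis euclidean_product_topology compactin_euclidean_iff)
qed

lemma dot_continuous:
  "continuous_on UNIV (\<lambda>f. dot n f g)" "continuous_on UNIV (\<lambda>f. dot n f f)"
  "continuous_on UNIV (\<lambda>f. dot n f (app n B f))"
  unfolding dot_def app_def
  by (intro continuous_intros continuous_on_product_coordinates)+

text \<open>Near 0 the linear term outweighs the quadratic one: \<open>s\<close> gets the sign of
  \<open>a\<close> and is so small that the quadratic term is at most half of
  \<open>s * a\<close>.\<close>

lemma quadratic_nonpos_imp_linear_zero:
  fixes a b :: real
  assumes "\<And>s. s * a + s\<^sup>2 * b \<le> 0"
  shows "a = 0"
proof (rule ccontr)
  assume "a \<noteq> 0"
  define c where "c = \<bar>b\<bar> + 1"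
  have "c > 0" by (simp add: c_def)
  define s where "s = a / (2 * c)"
  have "s * a = a\<^sup>2 / (2 * c)" by (simp add: s_def power2_eq_square)
  have "s\<^sup>2 * \<bar>b\<bar> \<le> s\<^sup>2 * c" by (simp add: c_def mult_left_mono)
  also have "\<dots> = a\<^sup>2 / (4 * c)" 
    using \<open>c > 0\<close> by (simp add: s_def power_divide power_mult_distrib) (simp add: power2_eq_square)
  also have "\<dots> < a\<^sup>2 / (2 * c)"
    using \<open>a \<noteq> 0\<close> \<open>c > 0\<close> by (intro divide_strict_left_mono) auto
  also have "\<dots> = s * a" by (simp add: \<open>s * a = _\<close>)
  finally have "s\<^sup>2 * \<bar>b\<bar> < s * a" .
  moreover have "- (s\<^sup>2 * b) \<le> s\<^sup>2 * \<bar>b\<bar>"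
    by (metis abs_ge_minus_self abs_mult abs_power2)
  ultimately show False using assms[of s] by linarith
qed

text \<open>First variation in the direction of the residual \<open>g\<close>. As \<open>v\<close>
  is an eigenvector of a symmetric matrix, \<open>g\<close> is again orthogonal to \<open>v\<close>,
  so \<open>\<lambda>i. u i + s * g i\<close> is an admissible competitor for every
  \<open>s\<close>. The coefficient that is linear in \<open>s\<close> is
  \<open>2 * dot n g g\<close> and has to vanish.\<close>

lemma Rayleigh_maximizer:
  assumes sym: "sym_on n B" and ev: "\<And>i. i < n \<Longrightarrow> app n B v i = l * v i"
    and uv: "dot n u v = 0"
    and bound: "\<And>g. dot n g v = 0 \<Longrightarrow> dot n g (app n B g) \<le> \<mu> * dot n g g"
    and max: "dot n u (app n B u) = \<mu> * dot n u u" and i: "i < n"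
  shows "app n B u i = \<mu> * u i"
proof -
  define g where "g = (\<lambda>i. app n B u i - \<mu> * u i)"
  have gv: "dot n g v = 0"
  proof -
    have "dot n (app n B u) v = dot n u (app n B v)" by (rule dot_app_sym[OF sym])
    also have "\<dots> = dot n u (\<lambda>i. l * v i)" using ev by (intro dot_cong) auto
    finally show ?thesis using uv by (simp add: g_def dot_linear)
  qed
  have "s * (2 * dot n g g) + s\<^sup>2 * (dot n g (app n B g) - \<mu> * dot n g g) \<le> 0" for s
  proof -
    define f where "f = (\<lambda>i. u i + s * g i)"
    have "dot n f v = 0" using uv gv by (simp add: f_def dot_linear)
    then have "dot n f (app n B f) - \<mu> * dot n f f \<le> 0" using bound[of f] by linarith
    also have "app n B f = (\<lambda>i. app n B u i + s * app n B g i)"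
      by (simp add: f_def app_add app_scale)
    also have "dot n f (\<lambda>i. app n B u i + s * app n B g i) =
      \<mu> * dot n u u + s * dot n g (app n B u) + s * dot n u (app n B g) + s\<^sup>2 * dot n g (app n B g)"
      by (simp add: f_def dot_linear algebra_simps power2_eq_square max)
    also have "dot n u (app n B g) = dot n g (app n B u)"
      using dot_app_sym[OF sym, of u g] by (simp add: dot_commute)
    also have "dot n f f = dot n u u + 2 * s * dot n u g + s\<^sup>2 * dot n g g"
      using dot_commute[of n g u] by (simp add: f_def dot_linear algebra_simps power2_eq_square)
    finally have 1: "2 * s * dot n g (app n B u) + s\<^sup>2 * dot n g (app n B g)
        - \<mu> * (2 * s * dot n u g + s\<^sup>2 * dot n g g) \<le> 0"
      by (simp add: algebra_simps)
    have "dot n g g = dot n g (app n B u) - \<mu> * dot n u g"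
      by (subst (2) g_def) (simp add: dot_linear dot_commute)
    then have 2: "dot n g (app n B u) = dot n g g + \<mu> * dot n u g" by simp
    show ?thesis using 1 unfolding 2 by (simp add: algebra_simps)
  qed
  then have "2 * dot n g g = 0" by (rule quadratic_nonpos_imp_linear_zero)
  then have "dot n g g = 0" by simp
  then show ?thesis using i by (simp add: dot_self_eq_0 g_def)
qed

text \<open>A maximizer exists by compactness and is an eigenvector by
  \<open>Rayleigh_maximizer\<close>. The constraint has two uses: the zero vector as
  \<open>v\<close> yields the largest eigenvalue, a top eigenvector as \<open>v\<close> leads to the
  second one.\<close>

lemma Rayleigh_max:
  assumes sym: "sym_on n B" and ev: "\<And>i. i < n \<Longrightarrow> app n B v i = l * v i"
    and ex: "dot n u0 u0 = 1" "dot n u0 v = 0"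
  obtains u \<mu> where "dot n u u = 1" "dot n u v = 0" "\<And>i. i < n \<Longrightarrow> app n B u i = \<mu> * u i"
    "\<And>g. dot n g v = 0 \<Longrightarrow> dot n g (app n B g) \<le> \<mu> * dot n g g"
proof -
  define Box where "Box = {f::nat \<Rightarrow> real. \<forall>i. f i \<in> (if i < n then {-1..1} else {0})}"
  define K where "K = Box \<inter> {f. dot n f f \<in> {1}} \<inter> {f. dot n f v \<in> {0}}"
  have "closed {f. dot n f f \<in> {1}}" "closed {f. dot n f v \<in> {0}}"
    by (intro closed_vimage[of "{_}", unfolded vimage_def] dot_continuous; simp)+
  then have cK: "compact K"
    unfolding K_def Box_def by (intro compact_Int_closed compact_box)
  \<comment> \<open>The compact set contains only functions that vanish from \<open>n\<close> on;
    \<open>dot\<close> and \<open>app\<close> do not see the difference.\<close>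
  define trunc where "trunc f = (\<lambda>i. if i < n then f i else (0::real))" for f
  have dt: "dot n (trunc f) g = dot n f g" "dot n g (trunc f) = dot n g f" 
    "app n B (trunc f) = app n B f" for f g
    by (auto simp: trunc_def dot_def app_def)
  have memK: "trunc f \<in> K" if f: "dot n f f = 1" "dot n f v = 0" for f
  proof -
    have "\<bar>f i\<bar> \<le> 1" if "i < n" for i
    proof -
      have "(f i)\<^sup>2 \<le> dot n f f"
        unfolding dot_def power2_eq_square using that by (intro member_le_sum) auto
      then show ?thesis using f by (simp add: abs_square_le_1)
    qed
    then have "trunc f \<in> Box" by (auto simp: Box_def trunc_def abs_le_iff)
    then show ?thesis using f by (simp add: K_def dt)
  qed
  then have "K \<noteq> {}" using ex by blast
  then obtain u where u: "u \<in> K" "\<And>f. f \<in> K \<Longrightarrow> dot n f (app n B f) \<le> dot n u (app n B u)"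
    using continuous_attains_sup[OF cK _ continuous_on_subset[OF dot_continuous(3)[of n B]]] by blast
  define \<mu> where "\<mu> = dot n u (app n B u)"
  have u1: "dot n u u = 1" "dot n u v = 0" using u by (auto simp: K_def)
  have bound: "dot n g (app n B g) \<le> \<mu> * dot n g g" if g: "dot n g v = 0" for g
  proof (cases "dot n g g = 0")
    case True
    then have "\<forall>i<n. g i = 0" by (simp add: dot_self_eq_0)
    then have "dot n g (app n B g) = 0" by (simp add: dot_def)
    then show ?thesis using True by simp
  next
    case False
    define r where "r = sqrt (dot n g g)"
    have r: "r > 0" "r * r = dot n g g"
      using False dot_self_nonneg[of n g] by (auto simp: r_def)
    define f where "f = (\<lambda>i. (1/r) * g i)"
    have "dot n f f = 1" "dot n f v = 0"
      unfolding f_def using r g by (simp_all only: dot_linear) (simp_all flip: r(2))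
    from u(2)[OF memK[OF this]] have "dot n f (app n B f) \<le> \<mu>"
      by (simp add: dt \<mu>_def)
    moreover have "dot n f (app n B f) = dot n g (app n B g) / (r * r)"
      unfolding f_def app_scale dot_linear by simp
    ultimately show ?thesis using r(1) unfolding r(2)[symmetric] by (simp add: pos_divide_le_eq)
  qed
  have "app n B u i = \<mu> * u i" if "i < n" for i
    using Rayleigh_maximizer[OF sym ev u1(2) bound _ that] u1 by (simp add: \<mu>_def)
  then show ?thesis using that u1 bound by blast
qed

section \<open>Eigenvalues of matrices as sorted roots of the characteristic polynomial\<close>

abbreviation ent :: "real mat \<Rightarrow> nat \<Rightarrow> nat \<Rightarrow> real" where
  "ent B \<equiv> (\<lambda>i j. B $$ (i, j))"

lemma mult_mat_vec_index:
  assumes "B \<in> carrier_mat n n" "v \<in> carrier_vec n" "i < n"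
  shows "(B *\<^sub>v v) $ i = app n (ent B) (($) v) i"
  using assms by (auto simp: app_def scalar_prod_def atLeast0LessThan row_def)

lemma eigenvector_iff_app:
  assumes B: "B \<in> carrier_mat n n"
  shows "eigenvector B v l \<longleftrightarrow> v \<in> carrier_vec n \<and> (\<exists>i<n. v $ i \<noteq> 0) \<and>
     (\<forall>i<n. app n (ent B) (($) v) i = l * v $ i)"
proof (cases "v \<in> carrier_vec n")
  case v: True
  have *: "B *\<^sub>v v = l \<cdot>\<^sub>v v \<longleftrightarrow> (\<forall>i<n. app n (ent B) (($) v) i = l * v $ i)"
  proof
    assume "B *\<^sub>v v = l \<cdot>\<^sub>v v"
    then show "\<forall>i<n. app n (ent B) (($) v) i = l * v $ i"
      using v by (simp add: mult_mat_vec_index[OF B v, symmetric] del: index_mult_mat_vec)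
  next
    assume "\<forall>i<n. app n (ent B) (($) v) i = l * v $ i"
    then show "B *\<^sub>v v = l \<cdot>\<^sub>v v"
      using v B by (intro eq_vecI)
        (auto simp: mult_mat_vec_index[OF B v] simp del: index_mult_mat_vec)
  qed
  have "v \<noteq> 0\<^sub>v n \<longleftrightarrow> (\<exists>i<n. v $ i \<noteq> 0)" using v by (auto intro!: eq_vecI)
  then show ?thesis using * v B by (auto simp: eigenvector_def)
qed (use B in \<open>auto simp: eigenvector_def\<close>)

lemma eigenvector_of_fun:
  assumes "B \<in> carrier_mat n n" "dot n u u = 1" "\<And>i. i < n \<Longrightarrow> app n (ent B) u i = l * u i"
  shows "eigenvector B (vec n u) l"
proof -
  have "\<exists>i<n. u i \<noteq> 0" using assms(2) dot_self_eq_0[of n u] by auto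
  moreover have "app n (ent B) (($) (vec n u)) = app n (ent B) u" by (rule app_cong) auto
  ultimately show ?thesis using assms by (auto simp: eigenvector_iff_app[of B n])
qed

lemma char_poly_nonzero: "B \<in> carrier_mat n n \<Longrightarrow> char_poly (B :: real mat) \<noteq> 0"
  using degree_monic_char_poly[of B n] by auto

lemma eigenvector_proots:
  assumes B: "(B :: real mat) \<in> carrier_mat n n"
  shows "l \<in># proots (char_poly B) \<longleftrightarrow> (\<exists>v. eigenvector B v l)"
  using eigenvalue_root_char_poly[OF B, of l] char_poly_nonzero[OF B]
  by (simp add: eigenvalue_def)

definition dec_list :: "real multiset \<Rightarrow> real list" where
  "dec_list M = rev (sorted_list_of_multiset M)"

lemma dec_list_add_mset_Max:
  assumes "\<And>y. y \<in># M \<Longrightarrow> y \<le> x"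
  shows "dec_list (add_mset x M) = x # dec_list M"
proof -
  have "sorted_list_of_multiset (add_mset x M) = sorted_list_of_multiset M @ [x]"
    using assms by (simp add: sorted_insort_is_snoc)
  then show ?thesis by (simp add: dec_list_def)
qed

lemma dec_list_nth_0_ge:
  assumes "y \<in># M"
  shows "y \<le> dec_list M ! 0"
proof -
  define xs where "xs = sorted_list_of_multiset M"
  have xs: "sorted xs" "y \<in> set xs" using assms by (auto simp: xs_def)
  then obtain i where i: "i < length xs" "xs ! i = y" by (auto simp: in_set_conv_nth)
  then have "xs ! i \<le> xs ! (length xs - 1)" using xs by (intro sorted_nth_mono) auto
  then show ?thesis using i by (cases xs rule: rev_cases) (auto simp: dec_list_def xs_def[symmetric])
qed

lemma nth_eigenvalue_1_eqI:
  assumes B: "B \<in> carrier_mat n n" and ev: "eigenvector B u \<mu>"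
    and le: "\<And>v l. eigenvector B v l \<Longrightarrow> l \<le> \<mu>"
  shows "nth_eigenvalue 1 B = \<mu>"
proof -
  have "\<mu> \<in># proots (char_poly B)" using ev eigenvector_proots[OF B] by blast
  then obtain M where M: "proots (char_poly B) = add_mset \<mu> M" by (metis insert_DiffM)
  have "y \<le> \<mu>" if "y \<in># M" for y
    using that eigenvector_proots[OF B, of y] le by (auto simp: M)
  then show ?thesis
    unfolding nth_eigenvalue_def dec_list_def[symmetric] M by (simp add: dec_list_add_mset_Max)
qed

lemma Rayleigh_nth_eigenvalue_1:
  assumes B: "B \<in> carrier_mat n n" and sym: "sym_on n (ent B)" and n: "n > 0"
  obtains u where "dot n u u = 1" "\<And>i. i < n \<Longrightarrow> app n (ent B) u i = nth_eigenvalue 1 B * u i"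
    "\<And>g. dot n g (app n (ent B) g) \<le> nth_eigenvalue 1 B * dot n g g"
proof -
  let ?u0 = "\<lambda>i. if i = 0 then 1 else (0::real)"
  have "dot n ?u0 ?u0 = (\<Sum>i<n. if i = 0 then 1 else 0)"
    unfolding dot_def by (intro sum.cong) auto
  then have "dot n ?u0 ?u0 = 1" using n by simp
  \<comment> \<open>The zero vector satisfies the eigenvalue equation with eigenvalue 0 and imposes
    no orthogonality constraint.\<close>
  then obtain u \<mu> where u: "dot n u u = 1" "\<And>i. i < n \<Longrightarrow> app n (ent B) u i = \<mu> * u i"
    and max: "\<And>g. dot n g (app n (ent B) g) \<le> \<mu> * dot n g g"
    using Rayleigh_max[OF sym, of "\<lambda>_. 0" 0 ?u0] by (auto simp: dot_def app_def)
  have "nth_eigenvalue 1 B = \<mu>"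
  proof (rule nth_eigenvalue_1_eqI[OF B eigenvector_of_fun[OF B u]])
    fix v l assume "eigenvector B v l"
    then have v: "\<exists>i<n. v $ i \<noteq> 0" "\<And>i. i < n \<Longrightarrow> app n (ent B) (($) v) i = l * v $ i"
      using eigenvector_iff_app[OF B] by auto
    then have "dot n (($) v) (($) v) \<noteq> 0" using dot_self_eq_0[of n "($) v"] by auto
    then have pos: "dot n (($) v) (($) v) > 0" using dot_self_nonneg[of n "($) v"] by linarith
    have "dot n (($) v) (app n (ent B) (($) v)) = dot n (($) v) (\<lambda>i. l * v $ i)"
      using v by (intro dot_cong) auto
    then show "l \<le> \<mu>" using max[of "($) v"] pos by (simp add: dot_linear)
  qed
  then show ?thesis using that u max by simp
qed

text \<open>\<open>nth_eigenvalue\<close> counts algebraic multiplicities, while Rayleigh quotients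
  produce eigenvectors; this bridges the two, including the case \<open>\<mu> = l\<close>. In an
  orthogonal basis starting with \<open>v\<close> the first column of the matrix is \<open>l\<close>
  times the first unit vector, so the characteristic polynomial splits off the factor for
  \<open>l\<close>. The remaining block keeps the eigenvalue \<open>\<mu>\<close>, with the tail of
  the coordinates of \<open>u\<close> as eigenvector; a vanishing tail would make \<open>u\<close> a
  multiple of \<open>v\<close>.\<close>

lemma proots_char_poly_deflate:
  assumes B: "(B :: real mat) \<in> carrier_mat n n"
    and v: "eigenvector B v l" and u: "eigenvector B u \<mu>"
    and indep: "\<And>c. u \<noteq> c \<cdot>\<^sub>v v"
  obtains M where "proots (char_poly B) = add_mset l M" "\<mu> \<in># M"
proof -
  have vc: "v \<in> carrier_vec n" "v \<noteq> 0\<^sub>v n" "B *\<^sub>v v = l \<cdot>\<^sub>v v"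
    and uc: "u \<in> carrier_vec n" "B *\<^sub>v u = \<mu> \<cdot>\<^sub>v u"
    using u v B by (auto simp: eigenvector_def)
  have n: "n \<noteq> 0" using vc by (intro notI) (auto intro: eq_vecI)
  interpret cof_vec_space n "TYPE(real)" .
  define b where "b = basis_completion v"
  note bc = basis_completion[OF vc(1,2), folded b_def]
  then obtain vs where bv: "b = v # vs" using n by (cases b) auto
  define ws where "ws = gram_schmidt n b"
  have ws: "set ws \<subseteq> carrier_vec n" "corthogonal ws" "length ws = n"
    using gram_schmidt_result[OF bc(2,4,5) ws_def] bc by auto
  have hdws: "hd ws = v" using gram_schmidt_hd[OF vc(1), of vs] by (simp add: ws_def bv)
  define W where "W = mat_of_cols n ws"
  define W' where "W' = corthogonal_inv W"
  have W: "W \<in> carrier_mat n n" using ws mat_of_cols_carrier(1)[of n ws] by (simp add: W_def)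
  have orth: "corthogonal_mat W" using orthogonal_mat_of_cols ws by (simp add: W_def)
  have W': "W' \<in> carrier_mat n n"
    using W by (auto simp: W'_def corthogonal_inv_def mat_of_rows_def)
  have WW: "W' * W = 1\<^sub>m n"
    using corthogonal_inv_result[OF orth] W W' by (simp add: W'_def inverts_mat_def)
  then have WW': "W * W' = 1\<^sub>m n" by (rule mat_mult_left_right_inverse[OF W' W])
  define C where "C = W' * B * W"
  have C: "C \<in> carrier_mat n n" using W W' B by (simp add: C_def)
  have sim: "similar_mat C B"
    unfolding similar_mat_def
    by (intro exI, rule similar_mat_witI[OF WW WW' C_def C B W' W])
  have col0: "col C 0 = vec n (\<lambda>i. if i = 0 then l else 0)"
    unfolding C_def W'_def W_def using corthogonal_col_ev_0[OF B vc(1,2,3) n hdws ws] .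
  obtain C1 C2 C0 C3 where split: "split_block C 1 1 = (C1, C2, C0, C3)"
    by (cases "split_block C 1 1") auto
  have dims: "dim_row C = 1 + (n - 1)" "dim_col C = 1 + (n - 1)" using C n by auto
  note sb = split_block[OF split dims]
  have C1: "C1 = mat 1 1 (\<lambda>_. l)"
    using split[unfolded split_block_def Let_def] arg_cong[OF col0, of "\<lambda>v. v $ 0"] C n
    by (auto simp: col_def)
  have "C $$ (Suc i, 0) = 0" if "i < n - 1" for i
    using that arg_cong[OF col0, of "\<lambda>v. v $ Suc i"] C by auto
  then have C0: "C0 = 0\<^sub>m (n - 1) 1"
    using split[unfolded split_block_def Let_def] C by auto
  have "char_poly C1 = [:- l, 1:]" by (simp add: C1 char_poly_defs det_def sign_def)
  then have cp: "char_poly B = [:- l, 1:] * char_poly C3"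
    using char_poly_similar[OF sim] char_poly_four_block_zeros_col[OF sb(1,2,4)] sb(5) C0 by simp
  have cp3: "char_poly C3 \<noteq> 0" using char_poly_nonzero sb(4) by blast
  have "proots (char_poly B) = add_mset l (proots (char_poly C3))"
    unfolding cp using cp3 by (subst proots_mult) auto
  moreover have "\<mu> \<in># proots (char_poly C3)"
  proof -
    define z where "z = W' *\<^sub>v u"
    have z: "z \<in> carrier_vec n" using W' uc by (simp add: z_def)
    have Wz: "W *\<^sub>v z = u" 
      unfolding z_def using assoc_mult_mat_vec[OF W W' uc(1)] uc WW' by simp
    have "C *\<^sub>v z = (W' * B) *\<^sub>v (W *\<^sub>v z)"
      unfolding C_def using W W' B z by (intro assoc_mult_mat_vec[of _ n n _ n]) auto
    also have "\<dots> = W' *\<^sub>v (B *\<^sub>v (W *\<^sub>v z))"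
      using W W' B z by (intro assoc_mult_mat_vec[of _ n n _ n]) auto
    finally have "C *\<^sub>v z = W' *\<^sub>v (B *\<^sub>v (W *\<^sub>v z))" .
    then have Cz: "C *\<^sub>v z = \<mu> \<cdot>\<^sub>v z"
      using Wz uc W' by (simp add: z_def mult_mat_vec)
    define y where "y = vec (n - 1) (\<lambda>i. z $ (Suc i))"
    have y0: "y \<noteq> 0\<^sub>v (n - 1)"
    proof
      assume y: "y = 0\<^sub>v (n - 1)"
      have z0: "z $ i = 0" if "i < n" "i \<noteq> 0" for i
        using arg_cong[OF y, of "\<lambda>w. w $ (i - 1)"] that by (simp add: y_def)
      have "col W 0 = v" 
      proof -
        have "ws ! 0 = v" using hdws ws n by (metis hd_conv_nth length_0_conv)
        then show ?thesis using ws n vc by (simp add: W_def)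
      qed
      have "u = (z $ 0) \<cdot>\<^sub>v v"
      proof (rule eq_vecI)
        fix i assume "i < dim_vec (z $ 0 \<cdot>\<^sub>v v)"
        then have i: "i < n" using vc by auto
        have "u $ i = (\<Sum>j<n. W $$ (i, j) * z $ j)"
          unfolding Wz[symmetric] using mult_mat_vec_index[OF W z i] by (simp add: app_def)
        also have "\<dots> = W $$ (i, 0) * z $ 0"
          using n z0 by (subst sum.remove[of _ 0]) (auto intro!: sum.neutral)
        also have "W $$ (i, 0) = v $ i"
          using W i n by (simp add: \<open>col W 0 = v\<close>[symmetric])
        finally show "u $ i = (z $ 0 \<cdot>\<^sub>v v) $ i" using i vc by simp
      qed (use uc vc in auto)
      then show False using indep by blast
    qed
    have "eigenvector C3 y \<mu>"
    proof -
      have yc: "y \<in> carrier_vec (n - 1)" by (simp add: y_def)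
      have "C3 *\<^sub>v y = \<mu> \<cdot>\<^sub>v y"
      proof (rule eq_vecI)
        fix i assume "i < dim_vec (\<mu> \<cdot>\<^sub>v y)"
        then have i: "i < n - 1" by (simp add: y_def)
        have C3e: "C3 $$ (i, j) = C $$ (Suc i, Suc j)" if "j < n - 1" for j
          using sb i that C by (simp add: sb(5))
        have "(C3 *\<^sub>v y) $ i = (\<Sum>j<n-1. C $$ (Suc i, Suc j) * z $ Suc j)"
          using mult_mat_vec_index[OF sb(4) yc i] C3e by (simp add: app_def y_def)
        \<comment> \<open>Row \<open>Suc i\<close> of \<open>C\<close> starts with 0, so the sum may
          be extended to the index 0 and becomes a coordinate of
          \<open>C *\<^sub>v z\<close>.\<close>
        also have "\<dots> = (\<Sum>j<Suc (n-1). C $$ (Suc i, j) * z $ j)"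
          using \<open>\<And>i. i < n - 1 \<Longrightarrow> C $$ (Suc i, 0) = 0\<close> i
          by (subst sum.lessThan_Suc_shift) simp
        also have "\<dots> = (C *\<^sub>v z) $ Suc i"
          using mult_mat_vec_index[OF C z, of "Suc i"] i n by (simp add: app_def)
        finally show "(C3 *\<^sub>v y) $ i = (\<mu> \<cdot>\<^sub>v y) $ i" using Cz z i by (simp add: y_def)
      qed (use sb yc in auto)
      then show ?thesis using y0 yc sb by (simp add: eigenvector_def)
    qed
    then show ?thesis using eigenvector_proots[OF sb(4)] by blast
  qed
  ultimately show ?thesis by (rule that)
qed

lemma exists_unit_orthogonal:
  assumes "n \<ge> 2"
  obtains u where "dot n u u = 1" "dot n u v = 0"
proof -
  obtain w where w: "dot n w w > 0" "dot n w v = 0"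
  proof -
    have two: "dot n (\<lambda>i. if i = 0 then a else if i = 1 then b else 0) g = a * g 0 + b * g 1" for a b g
    proof -
      have "dot n (\<lambda>i. if i = 0 then a else if i = 1 then b else 0) g =
          (\<Sum>i\<in>{0, 1}. (if i = 0 then a else if i = 1 then b else 0) * g i)"
        unfolding dot_def using assms by (intro sum.mono_neutral_right) auto
      then show ?thesis by simp
    qed
    show ?thesis
    proof (cases "v 0 = 0 \<and> v 1 = 0")
      case True
      show ?thesis by (rule that[of "\<lambda>i. if i = 0 then 1 else if i = 1 then 0 else 0"]; subst two)
          (use True in auto)
    next
      case False
      show ?thesis 
        by (rule that[of "\<lambda>i. if i = 0 then v 1 else if i = 1 then - v 0 else 0"]; subst two)
          (use False in \<open>auto simp: sum_squares_gt_zero_iff\<close>)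
    qed
  qed
  define r where "r = 1 / sqrt (dot n w w)"
  have "r * r * dot n w w = 1" using w by (simp add: r_def)
  then show ?thesis using w that[of "\<lambda>i. r * w i"] by (simp add: dot_linear)
qed

text \<open>The maximizer \<open>u\<close> on the complement of \<open>v\<close> is independent of
  \<open>v\<close>, so by deflation its eigenvalue stays in the multiset after one copy of the
  largest eigenvalue is taken out. The second entry of the sorted list is the head of the rest,
  hence at least \<open>\<mu>\<close>; this is the direction that the gap arguments use.\<close>

lemma Rayleigh_nth_eigenvalue_2:
  assumes B: "B \<in> carrier_mat n n" and sym: "sym_on n (ent B)" and n: "n \<ge> 2"
    and v: "dot n v v = 1" "\<And>i. i < n \<Longrightarrow> app n (ent B) v i = nth_eigenvalue 1 B * v i"
  shows "nth_eigenvalue 2 B \<le> nth_eigenvalue 1 B"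
    and "dot n g v = 0 \<Longrightarrow> dot n g (app n (ent B) g) \<le> nth_eigenvalue 2 B * dot n g g"
proof -
  obtain u0 where "dot n u0 u0 = 1" "dot n u0 v = 0" using exists_unit_orthogonal[OF n] .
  then obtain u \<mu> where u: "dot n u u = 1" "dot n u v = 0"
      "\<And>i. i < n \<Longrightarrow> app n (ent B) u i = \<mu> * u i"
    and max: "\<And>g. dot n g v = 0 \<Longrightarrow> dot n g (app n (ent B) g) \<le> \<mu> * dot n g g"
    using Rayleigh_max[OF sym v(2)] by blast
  have "vec n u \<noteq> c \<cdot>\<^sub>v vec n v" for c
  proof
    assume "vec n u = c \<cdot>\<^sub>v vec n v"
    then have "u i = c * v i" if "i < n" for i
      using that by (auto dest: arg_cong[of _ _ "\<lambda>w. w $ i"])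
    then have "dot n u v = dot n (\<lambda>i. c * v i) v" "dot n u u = dot n (\<lambda>i. c * v i) (\<lambda>i. c * v i)"
      by (auto intro!: dot_cong)
    then have "dot n u v = c" "dot n u u = c * c" unfolding dot_scale_left dot_scale_right v(1) by auto
    then show False using u by simp
  qed
  then obtain M where M: "proots (char_poly B) = add_mset (nth_eigenvalue 1 B) M" "\<mu> \<in># M"
    using proots_char_poly_deflate[OF B eigenvector_of_fun[OF B v] eigenvector_of_fun[OF B u(1,3)]]
    by blast
  have le: "y \<le> nth_eigenvalue 1 B" if "y \<in># M" for y
  proof -
    have "nth_eigenvalue 1 B = dec_list (proots (char_poly B)) ! 0"
      by (simp add: nth_eigenvalue_def dec_list_def)
    then show ?thesis using dec_list_nth_0_ge[of y "proots (char_poly B)"] that M(1) by simp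
  qed
  have "nth_eigenvalue 2 B = dec_list (proots (char_poly B)) ! 1"
    by (simp add: nth_eigenvalue_def dec_list_def)
  also have "\<dots> = dec_list M ! 0"
    unfolding M(1) using le by (subst dec_list_add_mset_Max) auto
  finally have 2: "nth_eigenvalue 2 B = dec_list M ! 0" .
  have "\<mu> \<in> set (dec_list M)" using M(2) by (simp add: dec_list_def)
  then have "dec_list M ! 0 \<in> set (dec_list M)" by (intro nth_mem) (cases "dec_list M"; simp)
  then show "nth_eigenvalue 2 B \<le> nth_eigenvalue 1 B"
    unfolding 2 by (intro le) (simp add: dec_list_def)
  have "\<mu> * dot n g g \<le> nth_eigenvalue 2 B * dot n g g"
    using dec_list_nth_0_ge[OF M(2)] unfolding 2 by (intro mult_right_mono dot_self_nonneg)
  then show "dot n g (app n (ent B) g) \<le> nth_eigenvalue 2 B * dot n g g" if "dot n g v = 0"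
    using max[OF that] by linarith
qed

text \<open>Weighted arithmetic-geometric mean inequality for \<open>g i * g j\<close> with weights
  \<open>w j / w i\<close> and \<open>w i / w j\<close>; by symmetry of \<open>B\<close> both halves
  sum to the same value. A positive test vector thus bounds the quadratic form without knowledge of
  the eigenvectors.\<close>

lemma Schur_test:
  assumes sym: "sym_on n B" and nn: "nonneg_on n B" and w: "\<And>i. i < n \<Longrightarrow> w i > 0"
    and le: "\<And>i. i < n \<Longrightarrow> app n B w i \<le> \<rho> * w i"
  shows "dot n g (app n B g) \<le> \<rho> * dot n g g"
proof -
  have ag: "g i * g j \<le> ((g i)\<^sup>2 * (w j / w i) + (g j)\<^sup>2 * (w i / w j)) / 2" if "i < n" "j < n" for i j
  proof -
    have "w i > 0" "w j > 0" using w that by auto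
    then have "0 \<le> (g i * w j - g j * w i)\<^sup>2 / (w i * w j)" by simp
    also have "\<dots> = (g i)\<^sup>2 * (w j / w i) + (g j)\<^sup>2 * (w i / w j) - 2 * (g i * g j)"
      using \<open>w i > 0\<close> \<open>w j > 0\<close> by (simp add: field_simps power2_eq_square)
    finally show ?thesis by simp
  qed
  define S where "S = (\<Sum>i<n. \<Sum>j<n. B i j * ((g i)\<^sup>2 * (w j / w i)))"
  have "dot n g (app n B g) = (\<Sum>i<n. \<Sum>j<n. B i j * (g i * g j))" by (rule dot_app)
  also have "\<dots> \<le> (\<Sum>i<n. \<Sum>j<n. B i j * (((g i)\<^sup>2 * (w j / w i) + (g j)\<^sup>2 * (w i / w j)) / 2))"
    using nn ag by (intro sum_mono mult_left_mono) (auto simp: nonneg_on_def)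
  also have "\<dots> = (S + (\<Sum>i<n. \<Sum>j<n. B i j * ((g j)\<^sup>2 * (w i / w j)))) / 2"
    unfolding S_def by (simp add: sum.distrib distrib_left sum_divide_distrib add_divide_distrib)
  also have "(\<Sum>i<n. \<Sum>j<n. B i j * ((g j)\<^sup>2 * (w i / w j))) = S"
    unfolding S_def by (subst sum.swap) (intro sum.cong refl, use sym in \<open>auto simp: sym_on_def\<close>)
  also have "(S + S) / 2 = S" by simp
  also have "S = (\<Sum>i<n. (g i)\<^sup>2 / w i * app n B w i)"
    unfolding S_def app_def sum_distrib_left by (intro sum.cong refl) (simp add: field_simps)
  also have "\<dots> \<le> (\<Sum>i<n. (g i)\<^sup>2 / w i * (\<rho> * w i))"
    using w le by (intro sum_mono mult_left_mono) (auto simp: less_imp_le)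
  also have "\<dots> = (\<Sum>i<n. \<rho> * (g i * g i))"
  proof (intro sum.cong refl)
    fix i assume "i \<in> {..<n}"
    then have "w i \<noteq> 0" using w[of i] by auto
    then show "(g i)\<^sup>2 / w i * (\<rho> * w i) = \<rho> * (g i * g i)" by (simp add: power2_eq_square)
  qed
  finally show ?thesis by (simp add: dot_def sum_distrib_left)
qed

lemma eigenvalue_1_le_Rayleigh:
  assumes B: "B \<in> carrier_mat n n" "sym_on n (ent B)" "n > 0"
    and "\<And>g. a * dot n g (app n (ent B) g) \<le> \<rho> * dot n g g"
  shows "a * nth_eigenvalue 1 B \<le> \<rho>"
proof -
  obtain u where u: "dot n u u = 1" "\<And>i. i < n \<Longrightarrow> app n (ent B) u i = nth_eigenvalue 1 B * u i"
    using Rayleigh_nth_eigenvalue_1[OF B] by metis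
  have "dot n u (app n (ent B) u) = dot n u (\<lambda>i. nth_eigenvalue 1 B * u i)"
    using u by (intro dot_cong) auto
  then show ?thesis using assms(4)[of u] u(1) by (simp add: dot_scale_right)
qed

section \<open>Katz centrality\<close>

definition katz_term :: "nat \<Rightarrow> real \<Rightarrow> (nat \<Rightarrow> nat \<Rightarrow> real) \<Rightarrow> nat \<Rightarrow> nat \<Rightarrow> real" where
  "katz_term n \<alpha> B k = ((\<lambda>f i. \<alpha> * app n B f i) ^^ k) (\<lambda>_. 1)"

lemma pow_mat_mult_vec_index:
  assumes B: "B \<in> carrier_mat n n" and w: "w \<in> carrier_vec n" and i: "i < n"
  shows "((\<alpha> \<cdot>\<^sub>m B) ^\<^sub>m k *\<^sub>v w) $ i = ((\<lambda>f i. \<alpha> * app n (ent B) f i) ^^ k) (($) w) i"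
  using w
proof (induction k arbitrary: w)
  case 0
  then show ?case using B by simp
next
  case (Suc k)
  let ?L = "\<lambda>f i. \<alpha> * app n (ent B) f i"
  have aB: "\<alpha> \<cdot>\<^sub>m B \<in> carrier_mat n n" using B by simp
  define z where "z = (\<alpha> \<cdot>\<^sub>m B) *\<^sub>v w"
  have z: "z \<in> carrier_vec n" using aB Suc.prems unfolding z_def by (rule mult_mat_vec_carrier)
  have zi: "z $ j = ?L (($) w) j" if "j < n" for j
    unfolding z_def using that B mult_mat_vec_index[OF aB Suc.prems that]
    by (simp add: app_def sum_distrib_left mult.assoc)
  have "(\<alpha> \<cdot>\<^sub>m B) ^\<^sub>m Suc k *\<^sub>v w = (\<alpha> \<cdot>\<^sub>m B) ^\<^sub>m k *\<^sub>v z"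
    unfolding z_def using aB Suc.prems by (simp add: assoc_mult_mat_vec[of _ n n _ n])
  then have "((\<alpha> \<cdot>\<^sub>m B) ^\<^sub>m Suc k *\<^sub>v w) $ i = (?L ^^ k) (($) z) i"
    using Suc.IH[OF z] by simp
  \<comment> \<open>The two starting functions agree only below \<open>n\<close>. For
    \<open>k = 0\<close> the index \<open>i\<close> lies there; otherwise the first application of
    \<open>app\<close> ignores all other values.\<close>
  also have "\<dots> = (?L ^^ k) (?L (($) w)) i"
  proof (cases k)
    case 0
    then show ?thesis using zi i by simp
  next
    case (Suc k')
    have Lz: "?L (($) z) = ?L (?L (($) w))"
      using app_cong[of n "($) z" "?L (($) w)"] zi by simp
    have "(?L ^^ k) (($) z) = (?L ^^ k') (?L (($) z))"
      unfolding Suc by (simp only: funpow_Suc_right o_apply)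
    also have "\<dots> = (?L ^^ k) (?L (($) w))"
      unfolding Lz Suc by (simp only: funpow_Suc_right o_apply)
    finally show ?thesis by simp
  qed
  also have "\<dots> = (?L ^^ Suc k) (($) w) i" by (simp only: funpow_Suc_right o_apply)
  finally show ?case .
qed

lemma katz_centrality_index:
  assumes B: "B \<in> carrier_mat n n" and i: "i < n"
  shows "katz_centrality \<alpha> B $ i = (\<Sum>k. katz_term n \<alpha> (ent B) k i)"
proof -
  have o: "ones n \<in> carrier_vec n" by (simp add: ones_def)
  have "((\<lambda>f i. \<alpha> * app n (ent B) f i) ^^ k) (($) (ones n)) i = katz_term n \<alpha> (ent B) k i" for k
  proof (cases k)
    case 0
    then show ?thesis using i by (simp add: katz_term_def ones_def)
  next
    case (Suc k')
    have "app n (ent B) (($) (ones n)) = app n (ent B) (\<lambda>_. 1)"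
      by (rule app_cong) (simp add: ones_def)
    then show ?thesis unfolding Suc katz_term_def by (simp only: funpow_Suc_right o_apply)
  qed
  then show ?thesis
    using B i pow_mat_mult_vec_index[OF B o i] by (simp add: katz_centrality_def)
qed

text \<open>Cauchy-Schwarz against the all-ones vector, then one factor \<open>dot n f f\<close>
  cancels. It serves the Katz partial sums as well as their limit.\<close>

lemma dot_self_bound:
  assumes "c > 0" "c * dot n f f \<le> dot n f (\<lambda>_. 1)"
  shows "c\<^sup>2 * dot n f f \<le> real n"
proof (cases "dot n f f = 0")
  case False
  then have pos: "dot n f f > 0" using dot_self_nonneg[of n f] by linarith
  have "(c * dot n f f)\<^sup>2 \<le> (dot n f (\<lambda>_. 1))\<^sup>2"
    using assms pos by (intro power_mono) auto
  also have "\<dots> \<le> dot n f f * real n"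
    using dot_Cauchy_Schwarz[of n f "\<lambda>_. 1"] by (simp add: dot_def)
  finally have "(c\<^sup>2 * dot n f f) * dot n f f \<le> real n * dot n f f"
    by (simp add: power2_eq_square algebra_simps)
  then show ?thesis using pos by (rule mult_right_le_imp_le)
qed simp

text \<open>The partial sums increase, so
  \<open>dot n (s k) (s k) \<le> dot n (s k) (s (Suc k))\<close>; inserting the recursion for
  \<open>s (Suc k)\<close> and the Rayleigh bound gives an estimate independent of \<open>k\<close>.
  Monotone convergence in each coordinate then defines \<open>y\<close>.\<close>

lemma katz_series:
  fixes B :: "nat \<Rightarrow> nat \<Rightarrow> real"
  assumes nn: "nonneg_on n B" and \<alpha>: "\<alpha> > 0" and c: "c > 0"
    and ray: "\<And>g. \<alpha> * dot n g (app n B g) \<le> (1 - c) * dot n g g"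
  defines "y \<equiv> \<lambda>i. \<Sum>k. katz_term n \<alpha> B k i"
  shows "\<And>i. i < n \<Longrightarrow> y i = 1 + \<alpha> * app n B y i" "c\<^sup>2 * dot n y y \<le> real n"
    "\<And>i. i < n \<Longrightarrow> y i \<ge> 1"
proof -
  let ?t = "katz_term n \<alpha> B"
  have t0: "?t 0 = (\<lambda>_. 1)" and tS: "?t (Suc k) = (\<lambda>i. \<alpha> * app n B (?t k) i)" for k
    by (simp_all add: katz_term_def)
  have tnn: "0 \<le> ?t k i" if "i < n" for k i
    using that
  proof (induction k arbitrary: i)
    case (Suc k)
    then show ?case using \<alpha> app_nonneg[OF nn, of "?t k"] by (simp add: tS)
  qed (simp add: t0)
  define s where "s k i = (\<Sum>l<k. ?t l i)" for k i
  have sS: "s (Suc k) i = 1 + \<alpha> * app n B (s k) i" for k i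
  proof -
    have "app n B (s k) i = (\<Sum>l<k. app n B (?t l) i)"
      unfolding app_def s_def sum_distrib_left by (rule sum.swap)
    then show ?thesis
      by (simp add: s_def sum.lessThan_Suc_shift t0 tS sum_distrib_left del: sum.lessThan_Suc)
  qed
  have snn: "0 \<le> s k i" if "i < n" for k i using tnn[OF that] by (simp add: s_def sum_nonneg)
  have "c\<^sup>2 * dot n (s k) (s k) \<le> real n" for k
  proof (rule dot_self_bound[OF c])
    have "dot n (s k) (s k) \<le> dot n (s k) (s (Suc k))"
      by (intro dot_mono snn) (auto simp: s_def tnn)
    also have "s (Suc k) = (\<lambda>i. 1 + \<alpha> * app n B (s k) i)" using sS by blast
    also have "dot n (s k) \<dots> = dot n (s k) (\<lambda>_. 1) + \<alpha> * dot n (s k) (app n B (s k))"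
      by (simp only: dot_linear)
    finally show "c * dot n (s k) (s k) \<le> dot n (s k) (\<lambda>_. 1)"
      using ray[of "s k"] by (simp add: algebra_simps)
  qed
  then have bound: "s k i \<le> sqrt (real n / c\<^sup>2)" if "i < n" for k i
  proof -
    have "(s k i)\<^sup>2 \<le> dot n (s k) (s k)"
      unfolding dot_def power2_eq_square using that by (intro member_le_sum) auto
    also have "\<dots> \<le> real n / c\<^sup>2" using \<open>c\<^sup>2 * dot n (s k) (s k) \<le> real n\<close> c
      by (simp add: pos_le_divide_eq mult.commute)
    finally show ?thesis by (rule real_le_rsqrt)
  qed
  have summ: "summable (\<lambda>k. ?t k i)" if "i < n" for i
    using tnn[OF that] bound[OF that] by (intro summableI_nonneg_bounded) (auto simp: s_def)
  have lim: "(\<lambda>k. s k i) \<longlonglongrightarrow> y i" if "i < n" for i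
    using summable_LIMSEQ[OF summ[OF that]] by (simp add: s_def y_def)
  show fixp: "y i = 1 + \<alpha> * app n B y i" if "i < n" for i
  proof (rule LIMSEQ_unique)
    show "(\<lambda>k. s (Suc k) i) \<longlonglongrightarrow> y i" using lim[OF that] by (rule LIMSEQ_Suc)
    show "(\<lambda>k. s (Suc k) i) \<longlonglongrightarrow> 1 + \<alpha> * app n B y i"
      unfolding sS app_def by (intro tendsto_intros lim) auto
  qed
  have ynn: "0 \<le> y i" if "i < n" for i
    using summ[OF that] tnn[OF that] by (simp add: y_def suminf_nonneg)
  show "y i \<ge> 1" if "i < n" for i
    using fixp[OF that] app_nonneg[OF nn ynn that] \<alpha> by simp
  show "c\<^sup>2 * dot n y y \<le> real n"
  proof (rule dot_self_bound[OF c])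
    have "dot n y y = dot n y (\<lambda>i. 1 + \<alpha> * app n B y i)"
      using fixp by (intro dot_cong) auto
    also have "\<dots> = dot n y (\<lambda>_. 1) + \<alpha> * dot n y (app n B y)"
      by (simp only: dot_linear)
    finally show "c * dot n y y \<le> dot n y (\<lambda>_. 1)"
      using ray[of y] by (simp add: algebra_simps)
  qed
qed

text \<open>The 2-norm bound gives a 1-norm bound by Cauchy-Schwarz, and a matrix with entries of
  order \<open>1 / n\<close> turns the 1-norm into a sup bound in one application. It is meant for
  the expectation, whose entries are this small.\<close>

lemma katz_sup_bound:
  assumes nn: "nonneg_on n B" and K: "\<And>i j. i < n \<Longrightarrow> j < n \<Longrightarrow> B i j \<le> K / real n"
    and \<alpha>: "\<alpha> > 0" and c: "c > 0" "c\<^sup>2 * dot n y y \<le> real n"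
    and y: "\<And>i. i < n \<Longrightarrow> y i = 1 + \<alpha> * app n B y i" "\<And>i. i < n \<Longrightarrow> y i \<ge> 0" and i: "i < n"
  shows "y i \<le> 1 + \<alpha> * K / c"
proof -
  have "(c * dot n y (\<lambda>_. 1))\<^sup>2 \<le> c\<^sup>2 * dot n y y * real n"
    using mult_left_mono[OF dot_Cauchy_Schwarz[of n y "\<lambda>_. 1"], of "c\<^sup>2"]
    by (simp add: dot_def power_mult_distrib mult.assoc)
  also have "\<dots> \<le> real n * real n" by (rule mult_right_mono[OF c(2)]) simp
  finally have "(c * dot n y (\<lambda>_. 1))\<^sup>2 \<le> (real n)\<^sup>2" by (simp only: power2_eq_square)
  then have "c * dot n y (\<lambda>_. 1) \<le> real n" by (rule power2_le_imp_le) simp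
  have Kn: "0 \<le> K / real n" using K[OF i i] nn i unfolding nonneg_on_def by force
  have "app n B y i \<le> (\<Sum>j<n. K / real n * y j)"
    unfolding app_def using K i y(2) by (intro sum_mono mult_right_mono) auto
  also have "\<dots> = K / real n * dot n y (\<lambda>_. 1)" by (simp add: dot_def sum_distrib_left)
  also have "\<dots> \<le> K / real n * (real n / c)"
    using c \<open>c * dot n y (\<lambda>_. 1) \<le> real n\<close> Kn
    by (intro mult_left_mono) (auto simp: pos_le_divide_eq mult.commute)
  also have "\<dots> = K / c" using i by simp
  finally have "app n B y i \<le> K / c" .
  from mult_left_mono[OF this less_imp_le[OF \<alpha>]]
  have "\<alpha> * app n B y i \<le> \<alpha> * K / c" by simp
  then show ?thesis using y(1)[OF i] by linarith
qed

text \<open>If \<open>z\<close> is the Katz vector of \<open>M\<close> and \<open>(A - M) z\<close> is small from above, then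
  \<open>(1 - \<alpha> A) z\<close> is still bounded below, so that \<open>z\<close> is a test vector for the resolvent of \<open>A\<close>.\<close>

lemma katz_transfer:
  assumes sym: "sym_on n A" and nn: "nonneg_on n A" and \<alpha>: "\<alpha> > 0"
    and z: "\<And>i. i < n \<Longrightarrow> z i = 1 + \<alpha> * app n M z i"
      "\<And>i. i < n \<Longrightarrow> 1 \<le> z i" "\<And>i. i < n \<Longrightarrow> z i \<le> C"
    and X: "\<And>i. i < n \<Longrightarrow> \<alpha> * (app n A z i - app n M z i) \<le> 1 / 2"
  shows "\<alpha> * dot n g (app n A g) \<le> (1 - 1 / (2 * C)) * dot n g g"
    and "(\<And>i. i < n \<Longrightarrow> y i = 1 + \<alpha> * app n A y i) \<Longrightarrow>
      (\<Sum>i<n. \<bar>y i - z i\<bar>) \<le> 2 * \<alpha> * C * (\<Sum>i<n. \<bar>app n A z i - app n M z i\<bar>)"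
proof -
  \<comment> \<open>\<open>z\<close> solves the Katz equation of \<open>M\<close>, so the right-hand
    side is 1 minus the left-hand side of assumption \<open>X\<close>.\<close>
  have half: "1 / 2 \<le> z i - \<alpha> * app n A z i" if "i < n" for i
    using X[OF that] z(1)[OF that] by (simp add: algebra_simps)
  have "dot n g (app n A g) \<le> ((1 - 1 / (2 * C)) / \<alpha>) * dot n g g"
  proof (rule Schur_test[OF sym nn, of z])
    fix i assume i: "i < n"
    show "0 < z i" using z(2)[OF i] by simp
    have C: "C \<ge> 1" using z(2,3)[OF i] by linarith
    \<comment> \<open>As \<open>z i \<le> C\<close>, the lower bound 1/2 is at least the fraction
      \<open>1 / (2 * C)\<close> of \<open>z i\<close>; the Schur test wants a bound proportional to
      the test vector.\<close>
    have "z i / (2 * C) \<le> 1 / 2" using z(3)[OF i] C by (simp add: field_simps)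
    then have "\<alpha> * app n A z i \<le> (1 - 1 / (2 * C)) * z i"
      using half[OF i] by (simp add: left_diff_distrib)
    then show "app n A z i \<le> (1 - 1 / (2 * C)) / \<alpha> * z i"
      using \<alpha> by (simp add: pos_le_divide_eq mult.commute)
  qed
  from mult_left_mono[OF this less_imp_le[OF \<alpha>]]
  show "\<alpha> * dot n g (app n A g) \<le> (1 - 1 / (2 * C)) * dot n g g"
    using \<alpha> by simp
next
  assume y: "\<And>i. i < n \<Longrightarrow> y i = 1 + \<alpha> * app n A y i"
  define X where "X = (\<lambda>i. app n A z i - app n M z i)"
  define d where "d = (\<lambda>i. \<bar>y i - z i\<bar>)"
  have half: "1 / 2 \<le> z i - \<alpha> * app n A z i" if "i < n" for i
    using X[OF that] z(1)[OF that] by (simp add: algebra_simps)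
  have d: "d i - \<alpha> * app n A d i \<le> \<alpha> * \<bar>X i\<bar>" if i: "i < n" for i
  proof -
    have "y i - z i = \<alpha> * (app n A (\<lambda>i. y i - z i) i + X i)"
      unfolding X_def app_diff using y[OF i] z(1)[OF i] by (simp add: algebra_simps)
    then have "d i = \<alpha> * \<bar>app n A (\<lambda>i. y i - z i) i + X i\<bar>"
      unfolding d_def using \<alpha> by (simp add: abs_mult)
    also have "\<dots> \<le> \<alpha> * (\<bar>app n A (\<lambda>i. y i - z i) i\<bar> + \<bar>X i\<bar>)"
      using \<alpha> by (intro mult_left_mono) auto
    also have "\<bar>app n A (\<lambda>i. y i - z i) i\<bar> \<le> (\<Sum>j<n. \<bar>A i j * (y j - z j)\<bar>)"
      unfolding app_def by (rule sum_abs)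
    also have "\<dots> = app n A d i"
      unfolding app_def d_def using nn i by (intro sum.cong) (auto simp: abs_mult nonneg_on_def)
    finally show ?thesis using \<alpha> by (simp add: algebra_simps)
  qed
  have dnn: "0 \<le> d i" for i by (simp add: d_def)
  \<comment> \<open>\<open>d\<close> is tested against a vector that is at least 1/2; symmetry then
    moves \<open>A\<close> from \<open>z\<close> to \<open>d\<close>, where the entrywise bound
    \<open>d\<close> applies.\<close>
  have "(\<Sum>i<n. d i) / 2 = dot n d (\<lambda>_. 1 / 2)" by (simp add: dot_def sum_divide_distrib)
  also have "\<dots> \<le> dot n d (\<lambda>i. z i - \<alpha> * app n A z i)"
    by (rule dot_mono[OF dnn half])
  also have "\<dots> = dot n d z - \<alpha> * dot n d (app n A z)" by (simp only: dot_linear)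
  also have "dot n d (app n A z) = dot n z (app n A d)"
    using dot_app_sym[OF sym, of d z] by (simp add: dot_commute)
  also have "dot n d z - \<alpha> * dot n z (app n A d) = dot n z (\<lambda>i. d i - \<alpha> * app n A d i)"
    by (simp only: dot_linear dot_commute[of n d z])
  also have "\<dots> \<le> dot n z (\<lambda>i. \<alpha> * \<bar>X i\<bar>)"
  proof (rule dot_mono)
    show "0 \<le> z i" if "i < n" for i using z(2)[OF that] by linarith
  qed (rule d)
  also have "\<dots> \<le> (\<Sum>i<n. C * (\<alpha> * \<bar>X i\<bar>))"
    unfolding dot_def
  proof (rule sum_mono)
    fix i assume "i \<in> {..<n}"
    then show "z i * (\<alpha> * \<bar>X i\<bar>) \<le> C * (\<alpha> * \<bar>X i\<bar>)"
      using z(3)[of i] \<alpha> by (intro mult_right_mono) simp_all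
  qed
  also have "\<dots> = C * \<alpha> * (\<Sum>i<n. \<bar>X i\<bar>)" by (simp add: sum_distrib_left mult.assoc)
  finally show "(\<Sum>i<n. \<bar>y i - z i\<bar>) \<le> 2 * \<alpha> * C * (\<Sum>i<n. \<bar>app n A z i - app n M z i\<bar>)"
    unfolding d_def X_def by (simp add: mult.commute mult.left_commute)
qed

section \<open>Dominant eigenvectors\<close>

lemma is_dominant_eigenvector_iff:
  assumes B: "B \<in> carrier_mat n n"
  shows "is_dominant_eigenvector B v \<longleftrightarrow> v \<in> carrier_vec n \<and> dot n (($) v) (($) v) = 1 \<and>
    (\<forall>i<n. 0 \<le> v $ i) \<and> (\<forall>i<n. app n (ent B) (($) v) i = nth_eigenvalue 1 B * v $ i)"
proof (cases "v \<in> carrier_vec n")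
  case v: True
  have "norm2_vec v = 1 \<longleftrightarrow> dot n (($) v) (($) v) = 1"
    using v by (simp add: norm2_vec_def dot_def power2_eq_square)
  moreover have "\<exists>i<n. v $ i \<noteq> 0" if "dot n (($) v) (($) v) = 1"
    using dot_self_eq_0[of n "($) v"] that by auto
  ultimately show ?thesis
    using v B unfolding is_dominant_eigenvector_def eigenvector_iff_app[OF B] by auto
qed (auto simp: is_dominant_eigenvector_def eigenvector_iff_app[OF B])

definition top_vector :: "nat \<Rightarrow> real mat \<Rightarrow> (nat \<Rightarrow> real) \<Rightarrow> bool" where
  "top_vector n B f \<longleftrightarrow> dot n f f = 1 \<and> (\<forall>i<n. 0 \<le> f i) \<and>
     (\<forall>i<n. app n (ent B) f i = nth_eigenvalue 1 B * f i)"

lemma is_dominant_eigenvector_iff_top_vector: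
  assumes "B \<in> carrier_mat n n"
  shows "is_dominant_eigenvector B v \<longleftrightarrow> v \<in> carrier_vec n \<and> top_vector n B (($) v)"
  unfolding is_dominant_eigenvector_iff[OF assms] top_vector_def by blast

lemma top_vector_vec:
  assumes "top_vector n B f"
  shows "top_vector n B (($) (vec n f))"
proof -
  have "app n (ent B) (($) (vec n f)) = app n (ent B) f" by (rule app_cong) simp
  moreover have "dot n (($) (vec n f)) (($) (vec n f)) = dot n f f" by (rule dot_cong) simp_all
  ultimately show ?thesis using assms by (simp add: top_vector_def)
qed

lemma dot_abs_app_ge:
  assumes "nonneg_on n B"
  shows "\<bar>dot n u (app n B u)\<bar> \<le> dot n (\<lambda>i. \<bar>u i\<bar>) (app n B (\<lambda>i. \<bar>u i\<bar>))"
proof -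
  have "\<bar>dot n u (app n B u)\<bar> \<le> (\<Sum>i<n. \<Sum>j<n. \<bar>B i j * (u i * u j)\<bar>)"
    unfolding dot_app by (intro order_trans[OF sum_abs] sum_mono sum_abs)
  also have "\<dots> = (\<Sum>i<n. \<Sum>j<n. B i j * (\<bar>u i\<bar> * \<bar>u j\<bar>))"
    using assms by (intro sum.cong refl) (simp add: nonneg_on_def abs_mult)
  finally show ?thesis by (simp add: dot_app)
qed

text \<open>The Perron-Frobenius idea via Rayleigh quotients: absolute values keep the norm and
  cannot decrease the form of a nonnegative matrix, so they give a maximizer again, hence an
  eigenvector.\<close>

lemma top_eigenvector_abs:
  assumes B: "B \<in> carrier_mat n n" "sym_on n (ent B)" "n > 0" and nn: "nonneg_on n (ent B)"
    and u: "\<And>i. i < n \<Longrightarrow> app n (ent B) u i = nth_eigenvalue 1 B * u i" and i: "i < n"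
  shows "app n (ent B) (\<lambda>i. \<bar>u i\<bar>) i = nth_eigenvalue 1 B * \<bar>u i\<bar>"
proof -
  let ?l = "nth_eigenvalue 1 B" and ?a = "\<lambda>i. \<bar>u i\<bar>"
  have ray: "dot n g (app n (ent B) g) \<le> ?l * dot n g g" for g
    using Rayleigh_nth_eigenvalue_1[OF B] by metis
  have aa: "dot n ?a ?a = dot n u u" by (simp add: dot_def)
  have "dot n u (app n (ent B) u) = dot n u (\<lambda>i. ?l * u i)" using u by (intro dot_cong) auto
  then have "?l * dot n u u \<le> dot n ?a (app n (ent B) ?a)"
    using dot_abs_app_ge[OF nn, of u] by (simp add: dot_scale_right)
  then have eq: "dot n ?a (app n (ent B) ?a) = ?l * dot n ?a ?a" using ray[of ?a] aa by simp
  show ?thesis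
    by (rule Rayleigh_maximizer[OF B(2), of "\<lambda>_. 0" 0, OF _ _ ray eq i]) (auto simp: app_def dot_def)
qed

lemma ex_top_vector:
  assumes B: "B \<in> carrier_mat n n" "sym_on n (ent B)" "n > 0" and nn: "nonneg_on n (ent B)"
  obtains f where "top_vector n B f"
proof -
  obtain u where u: "dot n u u = 1" "\<And>i. i < n \<Longrightarrow> app n (ent B) u i = nth_eigenvalue 1 B * u i"
    using Rayleigh_nth_eigenvalue_1[OF B] by metis
  have "dot n (\<lambda>i. \<bar>u i\<bar>) (\<lambda>i. \<bar>u i\<bar>) = dot n u u" by (simp add: dot_def)
  then have "top_vector n B (\<lambda>i. \<bar>u i\<bar>)"
    using u top_eigenvector_abs[OF B nn u(2)] by (simp add: top_vector_def)
  then show ?thesis by (rule that)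
qed

lemma Bessel_two:
  assumes "dot n f f = 1" "dot n g g = 1" "dot n f g = 0" "dot n v v = 1"
  shows "(dot n f v)\<^sup>2 + (dot n g v)\<^sup>2 \<le> 1"
proof -
  define w where "w = (\<lambda>i. v i - (dot n f v * f i + dot n g v * g i))"
  have "dot n w w = 1 - (dot n f v)\<^sup>2 - (dot n g v)\<^sup>2"
    unfolding w_def dot_linear
    using assms dot_commute[of n v f] dot_commute[of n v g] dot_commute[of n g f]
    by (simp add: power2_eq_square)
  then show ?thesis using dot_self_nonneg[of n w] by linarith
qed

lemma dot_normalized:
  assumes "dot n f f \<noteq> 0"
  shows "dot n (\<lambda>i. (1 / sqrt (dot n f f)) * f i) (\<lambda>i. (1 / sqrt (dot n f f)) * f i) = 1"
proof -
  have "dot n f f > 0" using assms dot_self_nonneg[of n f] by linarith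
  then show ?thesis unfolding dot_linear by simp
qed

text \<open>Two different nonnegative unit eigenvectors for the largest eigenvalue would give two orthogonal
  ones, namely the normalized positive and negative parts of their difference; both cannot be
  close to the same unit vector.\<close>

lemma top_vector_unique:
  assumes B: "B \<in> carrier_mat n n" "sym_on n (ent B)" "n > 0" and nn: "nonneg_on n (ent B)"
    and v: "dot n v v = 1" and close: "\<And>f. top_vector n B f \<Longrightarrow> (dot n f v)\<^sup>2 > 1 / 2"
    and f: "top_vector n B f" and g: "top_vector n B g" and i: "i < n"
  shows "f i = g i"
proof (rule ccontr)
  let ?l = "nth_eigenvalue 1 B"
  assume ne: "f i \<noteq> g i"
  define u where "u = (\<lambda>i. f i - g i)"
  define P where "P = (\<lambda>i. (1 / 2) * (\<bar>u i\<bar> + u i))"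
  define N where "N = (\<lambda>i. (1 / 2) * (\<bar>u i\<bar> - u i))"
  have u: "app n (ent B) u j = ?l * u j" if "j < n" for j
    unfolding u_def app_diff using f g that by (simp add: top_vector_def right_diff_distrib)
  have au: "app n (ent B) (\<lambda>i. \<bar>u i\<bar>) j = ?l * \<bar>u j\<bar>" if "j < n" for j
    using top_eigenvector_abs[OF B nn u that] .
  \<comment> \<open>\<open>u\<close> and its absolute value satisfy the same eigenvalue equation,
    hence so do their combinations \<open>P\<close> and \<open>N\<close>.\<close>
  have P: "app n (ent B) P j = ?l * P j" if "j < n" for j
    unfolding P_def app_scale app_add using u[OF that] au[OF that] by (simp add: algebra_simps)
  have N: "app n (ent B) N j = ?l * N j" if "j < n" for j
    unfolding N_def app_scale app_diff using u[OF that] au[OF that] by (simp add: algebra_simps)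
  have Pnn: "0 \<le> P j" and Nnn: "0 \<le> N j" and PN: "P j * N j = 0" and uPN: "u j = P j - N j" for j
    by (auto simp: P_def N_def abs_if)
  have eq: "dot n f f = 1" "dot n g g = 1" and fnn: "\<And>j. j < n \<Longrightarrow> 0 \<le> f j" "\<And>j. j < n \<Longrightarrow> 0 \<le> g j"
    using f g by (auto simp: top_vector_def)
  \<comment> \<open>\<open>dot n u u\<close> equals \<open>2 - 2 * dot n f g\<close>. If
    \<open>P\<close> or \<open>N\<close> vanished, \<open>f\<close> and \<open>g\<close> would be
    comparable entrywise, which forces \<open>dot n f g \<ge> 1\<close>.\<close>
  have contr: False if "1 \<le> dot n f g"
  proof -
    have "dot n u u \<le> 0"
      unfolding u_def dot_linear using that eq dot_commute[of n g f] by simp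
    then have "u i = 0" using dot_self_nonneg[of n u] dot_self_eq_0[of n u] i by auto
    then show False using ne by (simp add: u_def)
  qed
  have P0: "dot n P P \<noteq> 0"
  proof
    assume "dot n P P = 0"
    then have "f j \<le> g j" if "j < n" for j
      using that uPN[of j] Nnn[of j] by (simp add: dot_self_eq_0 u_def)
    then have "dot n f f \<le> dot n f g" using fnn by (intro dot_mono) auto
    then show False using contr eq by simp
  qed
  have N0: "dot n N N \<noteq> 0"
  proof
    assume "dot n N N = 0"
    then have "g j \<le> f j" if "j < n" for j
      using that uPN[of j] Pnn[of j] by (simp add: dot_self_eq_0 u_def)
    then have "dot n g g \<le> dot n g f" using fnn by (intro dot_mono) auto
    then show False using contr eq by (simp add: dot_commute)
  qed
  define P' where "P' = (\<lambda>i. (1 / sqrt (dot n P P)) * P i)"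
  define N' where "N' = (\<lambda>i. (1 / sqrt (dot n N N)) * N i)"
  have "top_vector n B P'" "top_vector n B N'"
    unfolding top_vector_def P'_def N'_def app_scale
    using dot_normalized[OF P0] dot_normalized[OF N0] Pnn Nnn P N dot_self_nonneg[of n] by auto
  then have "(dot n P' v)\<^sup>2 > 1 / 2" "(dot n N' v)\<^sup>2 > 1 / 2"
    using close by blast+
  moreover have "dot n P N = 0" using PN by (simp add: dot_def)
  then have "dot n P' N' = 0" unfolding P'_def N'_def dot_linear by simp
  then have "(dot n P' v)\<^sup>2 + (dot n N' v)\<^sup>2 \<le> 1"
    using \<open>top_vector n B P'\<close> \<open>top_vector n B N'\<close> v by (intro Bessel_two) (simp_all add: top_vector_def)
  ultimately show False by linarith
qed

text \<open>It is applied with \<open>v\<close> a top vector of the expectation, both to the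
  expectation itself and to the random matrix; in the second case \<open>top_vector_overlap\<close>
  supplies the closeness.\<close>

lemma ex1_dominant_eigenvector:
  assumes B: "B \<in> carrier_mat n n" "sym_on n (ent B)" "n > 0" and nn: "nonneg_on n (ent B)"
    and v: "dot n v v = 1" and close: "\<And>f. top_vector n B f \<Longrightarrow> (dot n f v)\<^sup>2 > 1 / 2"
  shows "\<exists>!x. is_dominant_eigenvector B x"
proof -
  obtain f where f: "top_vector n B f" using ex_top_vector[OF B nn] .
  have "is_dominant_eigenvector B (vec n f)"
    unfolding is_dominant_eigenvector_iff_top_vector[OF B(1)] using top_vector_vec[OF f] by simp
  moreover have "x = y" if "is_dominant_eigenvector B x" "is_dominant_eigenvector B y" for x y
  proof -
    have xy: "x \<in> carrier_vec n" "top_vector n B (($) x)" "y \<in> carrier_vec n" "top_vector n B (($) y)"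
      using that unfolding is_dominant_eigenvector_iff_top_vector[OF B(1)] by auto
    show ?thesis using top_vector_unique[OF B nn v close xy(2,4)] xy(1,3) by (intro eq_vecI) auto
  qed
  ultimately show ?thesis by blast
qed

lemma eigenvector_centrality_props:
  assumes B: "B \<in> carrier_mat n n" and ex1: "\<exists>!x. is_dominant_eigenvector B x"
  obtains f where "top_vector n B f" "eigenvector_centrality B \<in> carrier_vec n"
    "\<And>i. i < n \<Longrightarrow> eigenvector_centrality B $ i = sqrt (real n) * f i"
proof -
  define x where "x = (THE v. is_dominant_eigenvector B v)"
  have "is_dominant_eigenvector B x" unfolding x_def using ex1 by (rule theI')
  then have x: "x \<in> carrier_vec n" "top_vector n B (($) x)"
    unfolding is_dominant_eigenvector_iff_top_vector[OF B] by auto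
  then show ?thesis
    using B that[of "($) x"] unfolding eigenvector_centrality_def x_def[symmetric] by simp
qed

text \<open>For unit vectors the squared distance is \<open>2 - 2 * dot n f g\<close>, and
  \<open>dot n f g\<close>, lying in [0, 1], is at least its square. The factor
  \<open>sqrt (real n)\<close> of the centrality and the one lost in passing to the 1-norm cancel
  against the average over n nodes.\<close>

lemma norm1_diff_le:
  assumes f: "dot n f f = 1" "dot n g g = 1" and n: "n > 0" and ip: "0 \<le> dot n f g" "1 - \<eta> \<le> (dot n f g)\<^sup>2"
  shows "1 / real n * (\<Sum>i<n. \<bar>sqrt (real n) * f i - sqrt (real n) * g i\<bar>) \<le> sqrt (2 * \<eta>)"
proof -
  define d where "d = (\<lambda>i. f i - g i)"
  have "(dot n f g)\<^sup>2 \<le> 1" using dot_Cauchy_Schwarz[of n f g] f by simp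
  then have "dot n f g \<le> 1" using power2_le_imp_le[of "dot n f g" 1] by simp
  then have "(dot n f g)\<^sup>2 \<le> dot n f g" using ip(1) by (simp add: power2_eq_square mult_left_le)
  moreover have "dot n d d = 2 - 2 * dot n f g"
    unfolding d_def dot_linear using f dot_commute[of n g f] by simp
  ultimately have d: "dot n d d \<le> 2 * \<eta>" using ip(2) by linarith
  have "(\<Sum>i<n. \<bar>d i\<bar>)\<^sup>2 \<le> dot n d d * real n"
    using dot_Cauchy_Schwarz[of n "\<lambda>i. \<bar>d i\<bar>" "\<lambda>_. 1"] by (simp add: dot_def)
  also have "\<dots> \<le> 2 * \<eta> * real n" using d by (rule mult_right_mono) simp
  finally have "(\<Sum>i<n. \<bar>d i\<bar>) \<le> sqrt (2 * \<eta> * real n)" by (rule real_le_rsqrt)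
  then have "(\<Sum>i<n. \<bar>d i\<bar>) \<le> sqrt (2 * \<eta>) * sqrt (real n)" by (simp add: real_sqrt_mult)
  from mult_left_mono[OF this, of "sqrt (real n)"]
  have "sqrt (real n) * (\<Sum>i<n. \<bar>d i\<bar>) \<le> (sqrt (real n) * sqrt (real n)) * sqrt (2 * \<eta>)"
    by (simp only: mult_ac) simp
  then have "sqrt (real n) * (\<Sum>i<n. \<bar>d i\<bar>) \<le> real n * sqrt (2 * \<eta>)" by simp
  moreover have "(\<Sum>i<n. \<bar>sqrt (real n) * f i - sqrt (real n) * g i\<bar>) = sqrt (real n) * (\<Sum>i<n. \<bar>d i\<bar>)"
    by (simp add: d_def sum_distrib_left abs_mult right_diff_distrib[symmetric])
  ultimately show ?thesis using n by (simp add: pos_divide_le_eq mult.commute)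
qed

section \<open>Consequences of a spectral gap\<close>

lemma gap_imp_eigenvalue_1_ge:
  assumes B: "B \<in> carrier_mat n n" "sym_on n (ent B)" and n: "n \<ge> 2" and nn: "nonneg_on n (ent B)"
    and v: "dot n v v = 1" "\<And>i. i < n \<Longrightarrow> app n (ent B) v i = nth_eigenvalue 1 B * v i"
    and gap: "\<kappa> \<le> \<bar>nth_eigenvalue 1 B - nth_eigenvalue 2 B\<bar>"
  shows "\<kappa> \<le> nth_eigenvalue 1 B - nth_eigenvalue 2 B" "\<kappa> / 2 \<le> nth_eigenvalue 1 B"
proof -
  have R1: "nth_eigenvalue 2 B \<le> nth_eigenvalue 1 B"
    using v by (rule Rayleigh_nth_eigenvalue_2[OF B n])
  have R2: "dot n u (app n (ent B) u) \<le> nth_eigenvalue 2 B * dot n u u" if "dot n u v = 0" for u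
    using v that by (rule Rayleigh_nth_eigenvalue_2[OF B n])
  show 1: "\<kappa> \<le> nth_eigenvalue 1 B - nth_eigenvalue 2 B" using R1 gap by simp
  have n0: "n > 0" using n by simp
  have ray: "dot n g (app n (ent B) g) \<le> nth_eigenvalue 1 B * dot n g g" for g
    using Rayleigh_nth_eigenvalue_1[OF B n0] by metis
  obtain u where u: "dot n u u = 1" "dot n u v = 0" using exists_unit_orthogonal[OF n] .
  have "dot n (\<lambda>i. \<bar>u i\<bar>) (\<lambda>i. \<bar>u i\<bar>) = 1" using u(1) by (simp add: dot_def)
  \<comment> \<open>The form at \<open>u\<close> is bounded below through the absolute values of
    \<open>u\<close> by minus the largest eigenvalue, so the gap is at most twice that
    eigenvalue.\<close>
  then have "- nth_eigenvalue 1 B \<le> dot n u (app n (ent B) u)"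
    using dot_abs_app_ge[OF nn, of u] ray[of "\<lambda>i. \<bar>u i\<bar>"] by simp
  also have "\<dots> \<le> nth_eigenvalue 2 B" using R2[OF u(2)] u(1) by simp
  finally show "\<kappa> / 2 \<le> nth_eigenvalue 1 B" using 1 by simp
qed

lemma gap_Rayleigh:
  assumes B: "B \<in> carrier_mat n n" "sym_on n (ent B)" and n: "n \<ge> 2" and nn: "nonneg_on n (ent B)"
    and v: "dot n v v = 1" "\<And>i. i < n \<Longrightarrow> app n (ent B) v i = nth_eigenvalue 1 B * v i"
    and \<kappa>: "\<kappa> > 0" and gap: "\<kappa> \<le> \<bar>nth_eigenvalue 1 B - nth_eigenvalue 2 B\<bar>" and w: "dot n w w \<le> 1"
  shows "dot n w (app n (ent B) w) \<le> nth_eigenvalue 1 B - \<kappa> / 2 * (1 - (dot n w v)\<^sup>2)"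
proof -
  let ?l = "nth_eigenvalue 1 B" and ?a = "dot n w v"
  have g1: "\<kappa> \<le> ?l - nth_eigenvalue 2 B"
    using v gap by (rule gap_imp_eigenvalue_1_ge[OF B n nn])
  have g2: "\<kappa> / 2 \<le> ?l"
    using v gap by (rule gap_imp_eigenvalue_1_ge[OF B n nn])
  define h where "h = (\<lambda>i. w i - ?a * v i)"
  have hv: "dot n h v = 0" unfolding h_def dot_linear using v(1) by simp
  have hh: "dot n h h = dot n w w - ?a\<^sup>2"
    unfolding h_def dot_linear using v(1) dot_commute[of n v w] by (simp add: power2_eq_square)
  have wh: "w = (\<lambda>i. ?a * v i + h i)" by (simp add: h_def)
  have vh: "dot n v (app n (ent B) h) = 0" "dot n h (app n (ent B) v) = 0" "dot n v (app n (ent B) v) = ?l"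
  proof -
    have "dot n h (app n (ent B) v) = dot n h (\<lambda>i. ?l * v i)" "dot n v (app n (ent B) v) = dot n v (\<lambda>i. ?l * v i)"
      using v(2) by (auto intro!: dot_cong)
    then show 1: "dot n h (app n (ent B) v) = 0" "dot n v (app n (ent B) v) = ?l"
      using hv v(1) unfolding dot_linear by simp_all
    then show "dot n v (app n (ent B) h) = 0" using dot_app_sym[OF B(2), of v h] by (simp add: dot_commute)
  qed
  have "dot n w (app n (ent B) w) = ?a\<^sup>2 * ?l + dot n h (app n (ent B) h)"
    by (subst (1 2) wh, simp only: app_add app_scale dot_linear vh) (simp add: power2_eq_square algebra_simps)
  also have "dot n h (app n (ent B) h) \<le> nth_eigenvalue 2 B * dot n h h"
    using v hv by (rule Rayleigh_nth_eigenvalue_2[OF B n])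
  \<comment> \<open>Half of the gap is given away to have a coefficient known to be nonnegative, so
    that \<open>dot n h h\<close> may be replaced by its upper bound
    \<open>1 - ?a\<^sup>2\<close>.\<close>
  also have "\<dots> \<le> (?l - \<kappa> / 2) * dot n h h"
    using g1 \<kappa> dot_self_nonneg[of n h] by (intro mult_right_mono) simp_all
  also have "\<dots> \<le> (?l - \<kappa> / 2) * (1 - ?a\<^sup>2)"
    using g2 hh w by (intro mult_left_mono) simp_all
  finally show ?thesis by (simp add: algebra_simps)
qed

text \<open>Decomposition into layers: the minimum \<open>m\<close> of \<open>f\<close> on
  \<open>H\<close> is subtracted from all values. The constant layer costs at most
  \<open>m * (\<delta> * card H)\<close>, the rest vanishes in the row and column of the minimizing
  vertex, and the induction goes on without this vertex.\<close>

lemma sum_min_le: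
  fixes f :: "'a \<Rightarrow> real"
  assumes "finite H" "\<And>i. i \<in> H \<Longrightarrow> 0 \<le> f i"
    and "\<And>S. S \<subseteq> H \<Longrightarrow> (\<Sum>i\<in>S. \<Sum>j\<in>S. A i j) \<le> \<delta> * real (card S)"
  shows "(\<Sum>i\<in>H. \<Sum>j\<in>H. A i j * min (f i) (f j)) \<le> \<delta> * (\<Sum>i\<in>H. f i)"
  using assms
proof (induction "card H" arbitrary: H f)
  case 0
  then show ?case by simp
next
  case (Suc k)
  note fin = Suc.prems(1)
  have ne: "H \<noteq> {}" using Suc.hyps(2) by auto
  define m where "m = Min (f ` H)"
  have "m \<in> f ` H" unfolding m_def using fin ne by simp
  then obtain a where a: "a \<in> H" "f a = m" by blast
  have m: "m \<le> f i" if "i \<in> H" for i unfolding m_def using fin that by simp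
  have m0: "0 \<le> m" using a Suc.prems(2) by force
  define g where "g = (\<lambda>i. f i - m)"
  define H' where "H' = H - {a}"
  have fm: "min (f i) (f j) = m + min (g i) (g j)" for i j by (simp add: g_def min_def)
  have g0: "min (g i) (g j) = 0" if "i \<in> H" "j \<in> H" "i = a \<or> j = a" for i j
    using that m[of i] m[of j] a by (auto simp: g_def min_def)
  have H: "H = insert a H'" "a \<notin> H'" "finite H'" using a fin by (auto simp: H'_def)
  have IH: "(\<Sum>i\<in>H'. \<Sum>j\<in>H'. A i j * min (g i) (g j)) \<le> \<delta> * (\<Sum>i\<in>H'. g i)"
  proof (rule Suc.hyps(1))
    show "k = card H'" using Suc.hyps(2) H by simp
    show "0 \<le> g i" if "i \<in> H'" for i using m[of i] that by (simp add: g_def H'_def)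
    show "(\<Sum>i\<in>S. \<Sum>j\<in>S. A i j) \<le> \<delta> * real (card S)" if "S \<subseteq> H'" for S
      using that Suc.prems(3)[of S] by (auto simp: H'_def)
  qed (use H in simp)
  have "(\<Sum>i\<in>H. \<Sum>j\<in>H. A i j * min (f i) (f j)) =
      m * (\<Sum>i\<in>H. \<Sum>j\<in>H. A i j) + (\<Sum>i\<in>H. \<Sum>j\<in>H. A i j * min (g i) (g j))"
    unfolding fm by (simp add: distrib_left sum.distrib sum_distrib_left mult.commute)
  also have "(\<Sum>i\<in>H. \<Sum>j\<in>H. A i j * min (g i) (g j)) = (\<Sum>i\<in>H'. \<Sum>j\<in>H'. A i j * min (g i) (g j))"
  proof -
    have "(\<Sum>j\<in>H. A i j * min (g i) (g j)) = (\<Sum>j\<in>H'. A i j * min (g i) (g j))" if "i \<in> H" for i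
      using H g0[OF that a(1)] by simp
    moreover have "(\<Sum>j\<in>H. A a j * min (g a) (g j)) = 0"
      using g0[OF a(1)] by (intro sum.neutral) simp
    ultimately show ?thesis using H by (simp add: a)
  qed
  also note IH
  also have "m * (\<Sum>i\<in>H. \<Sum>j\<in>H. A i j) \<le> m * (\<delta> * real (card H))"
    using Suc.prems(3)[OF order_refl] m0 by (rule mult_left_mono)
  also have "(\<Sum>i\<in>H'. g i) = (\<Sum>i\<in>H. g i)" using H a by (simp add: g_def)
  also have "(\<Sum>i\<in>H. g i) = (\<Sum>i\<in>H. f i) - real (card H) * m" by (simp add: g_def sum_subtractf)
  finally show ?case by (simp add: algebra_simps)
qed

text \<open>A bilinear form on a box is largest at vertices. One argument after the other is
  replaced by \<open>b\<close> times the indicator of the indices with positive coefficient: first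
  \<open>S\<close> for the rows, then \<open>T\<close> for the columns summed over
  \<open>S\<close>.\<close>

lemma bilinear_box_le:
  fixes w :: "nat \<Rightarrow> real"
  assumes b: "b \<ge> 0" and w: "\<And>i. i < n \<Longrightarrow> 0 \<le> w i \<and> w i \<le> b"
    and C: "\<And>S T. S \<subseteq> {..<n} \<Longrightarrow> T \<subseteq> {..<n} \<Longrightarrow> (\<Sum>i\<in>S. \<Sum>j\<in>T. C i j) \<le> c"
  shows "(\<Sum>i<n. \<Sum>j<n. C i j * (w i * w j)) \<le> b\<^sup>2 * (c::real)"
proof -
  have lin: "(\<Sum>i<n. w i * r i) \<le> b * (\<Sum>i\<in>{i. i < n \<and> r i > 0}. r i)" for r :: "nat \<Rightarrow> real"
  proof -
    have "(\<Sum>i<n. w i * r i) \<le> (\<Sum>i<n. if r i > 0 then b * r i else 0)"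
    proof (rule sum_mono)
      fix i assume "i \<in> {..<n}"
      then have "0 \<le> w i" "w i \<le> b" using w by auto
      then show "w i * r i \<le> (if r i > 0 then b * r i else 0)"
        by (auto simp: mult_nonneg_nonpos intro: mult_right_mono)
    qed
    also have "\<dots> = (\<Sum>i\<in>{i. i < n \<and> r i > 0}. b * r i)"
      using sum.inter_filter[of "{..<n}" "\<lambda>i. b * r i" "\<lambda>i. r i > 0"] by simp
    finally show ?thesis by (simp add: sum_distrib_left)
  qed
  define S where "S = {i. i < n \<and> (\<Sum>j<n. C i j * w j) > 0}"
  define T where "T = {j. j < n \<and> (\<Sum>i\<in>S. C i j) > 0}"
  have "(\<Sum>i<n. \<Sum>j<n. C i j * (w i * w j)) = (\<Sum>i<n. w i * (\<Sum>j<n. C i j * w j))"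
    by (simp add: sum_distrib_left mult.left_commute)
  also have "\<dots> \<le> b * (\<Sum>i\<in>S. \<Sum>j<n. C i j * w j)" unfolding S_def by (rule lin)
  also have "(\<Sum>i\<in>S. \<Sum>j<n. C i j * w j) = (\<Sum>j<n. w j * (\<Sum>i\<in>S. C i j))"
    by (subst sum.swap) (simp add: sum_distrib_left mult.commute)
  also have "b * \<dots> \<le> b * (b * (\<Sum>j\<in>T. \<Sum>i\<in>S. C i j))"
    unfolding T_def by (rule mult_left_mono[OF lin b])
  also have "(\<Sum>j\<in>T. \<Sum>i\<in>S. C i j) = (\<Sum>i\<in>S. \<Sum>j\<in>T. C i j)" by (rule sum.swap)
  also have "b * (b * \<dots>) \<le> b * (b * c)"
    using b by (intro mult_left_mono C) (auto simp: S_def T_def)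
  finally show ?thesis by (simp add: power2_eq_square)
qed

text \<open>Splitting \<open>f\<close> at the level \<open>k \<tau>\<close>: the pairs of coordinates below this level are controlled by
  the discrepancy bound, comparable large coordinates by the sparsity of small vertex sets, and
  incomparable ones by the row sums, since there the product is at most \<open>max\<^sup>2 / k\<close>.\<close>

lemma top_vector_overlap:
  assumes A: "A \<in> carrier_mat n n" "nonneg_on n (ent A)" "sym_on n (ent A)"
    and M: "M \<in> carrier_mat n n" "sym_on n (ent M)" "nonneg_on n (ent M)" and n: "n \<ge> 2"
    and v: "top_vector n M v" and f: "top_vector n A f"
    and \<kappa>: "\<kappa> > 0" "\<kappa> \<le> \<bar>nth_eigenvalue 1 M - nth_eigenvalue 2 M\<bar>"
    and k: "k \<ge> 1" and \<eta>: "\<eta> > 0"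
    and quad: "nth_eigenvalue 1 M - \<delta>1 \<le> dot n v (app n (ent A) v)"
    and rows: "\<And>i. i < n \<Longrightarrow> app n (ent A) (\<lambda>_. 1) i \<le> 2"
    and sparse: "\<And>S. S \<subseteq> {..<n} \<Longrightarrow> real (card S) \<le> \<eta> * real n \<Longrightarrow>
      (\<Sum>i\<in>S. \<Sum>j\<in>S. A $$ (i, j)) \<le> \<delta>2 * real (card S)"
    and disc: "\<And>S T. S \<subseteq> {..<n} \<Longrightarrow> T \<subseteq> {..<n} \<Longrightarrow>
      (\<Sum>i\<in>S. \<Sum>j\<in>T. A $$ (i, j) - M $$ (i, j)) \<le> \<delta>3 * real n"
    and \<delta>2: "\<delta>2 \<ge> 0"
  shows "1 - 2 / \<kappa> * (\<delta>1 + k * \<delta>2 / 2 + 4 / k + k\<^sup>2 * \<delta>3 / \<eta>) \<le> (dot n f v)\<^sup>2"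
proof -
  have f1: "dot n f f = 1" and fnn: "\<And>i. i < n \<Longrightarrow> 0 \<le> f i"
    and fev: "\<And>i. i < n \<Longrightarrow> app n (ent A) f i = nth_eigenvalue 1 A * f i"
    using f by (auto simp: top_vector_def)
  have v1: "dot n v v = 1" and vnn: "\<And>i. i < n \<Longrightarrow> 0 \<le> v i"
    and vev: "\<And>i. i < n \<Longrightarrow> app n (ent M) v i = nth_eigenvalue 1 M * v i"
    using v by (auto simp: top_vector_def)
  have n0: "n > 0" using n by simp
  \<comment> \<open>At most \<open>\<eta> * real n\<close> coordinates of a unit vector exceed this
    level, which is the range where \<open>sparse\<close> applies.\<close>
  define \<tau> where "\<tau> = 1 / sqrt (\<eta> * real n)"
  have \<tau>: "\<tau> > 0" "\<tau>\<^sup>2 = 1 / (\<eta> * real n)" using \<eta> n0 by (simp_all add: \<tau>_def power_divide)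
  define H where "H = {i. i < n \<and> f i > \<tau>}"
  have H: "H \<subseteq> {..<n}" "finite H" by (auto simp: H_def)
  have sumf: "(\<Sum>i\<in>S. (f i)\<^sup>2) \<le> 1" if "S \<subseteq> {..<n}" for S
  proof -
    have "(\<Sum>i\<in>S. (f i)\<^sup>2) \<le> (\<Sum>i<n. (f i)\<^sup>2)" using that by (intro sum_mono2) auto
    then show ?thesis using f1 by (simp add: dot_def power2_eq_square)
  qed
  have cardH: "real (card H) \<le> \<eta> * real n"
  proof -
    have "real (card H) * \<tau>\<^sup>2 = (\<Sum>i\<in>H. \<tau>\<^sup>2)" by simp
    also have "\<dots> \<le> (\<Sum>i\<in>H. (f i)\<^sup>2)"
      using \<tau>(1) by (intro sum_mono power_mono) (auto simp: H_def)
    also have "\<dots> \<le> 1" by (rule sumf[OF H(1)])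
    finally show ?thesis using \<eta> n0 by (simp add: \<tau>(2) pos_divide_le_eq)
  qed
  define w where "w i = (if f i \<le> k * \<tau> then f i else 0)" for i
  have wf: "0 \<le> w i" "w i \<le> f i" "w i \<le> k * \<tau>" if "i < n" for i
    using fnn[OF that] k \<tau> by (auto simp: w_def)
  define mn where "mn i j = (if i \<in> H \<and> j \<in> H then min ((f i)\<^sup>2) ((f j)\<^sup>2) else 0)" for i j
  have pair: "f i * f j \<le> w i * w j + k / 2 * mn i j + 1 / k * ((f i)\<^sup>2 + (f j)\<^sup>2)"
    if ij: "i < n" "j < n" for i j
  proof -
    have mn0: "0 \<le> mn i j" by (simp add: mn_def)
    have *: "f a * f b \<le> k / 2 * mn a b + 1 / k * ((f a)\<^sup>2 + (f b)\<^sup>2)"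
      if ab: "a < n" "b < n" "f a \<le> f b" "k * \<tau> < f b" for a b
    proof (cases "f a > \<tau>")
      case True
      have "\<tau> \<le> k * \<tau>" using k \<tau>(1) by simp
      then have "f b > \<tau>" using ab by linarith
      then have "mn a b = min ((f a)\<^sup>2) ((f b)\<^sup>2)" using True ab by (simp add: mn_def H_def)
      also have "\<dots> = (f a)\<^sup>2" using ab fnn[of a] by (simp add: min_absorb1 power_mono)
      finally have mn: "mn a b = (f a)\<^sup>2" .
      \<comment> \<open>Arithmetic-geometric mean inequality with weight \<open>k\<close>: the large
        factor goes to the smaller square, which is the one recorded by \<open>mn\<close>.\<close>
      have "0 \<le> (k * f a - f b)\<^sup>2 / (2 * k)" using k by simp
      also have "\<dots> = k / 2 * (f a)\<^sup>2 + 1 / k * (f b)\<^sup>2 / 2 - f a * f b"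
        using k by (simp add: power2_diff power_mult_distrib diff_divide_distrib add_divide_distrib)
          (simp add: power2_eq_square)
      finally have "f a * f b \<le> k / 2 * (f a)\<^sup>2 + 1 / k * (f b)\<^sup>2 / 2" by simp
      moreover have "0 \<le> 1 / k * (f a)\<^sup>2" "0 \<le> 1 / k * (f b)\<^sup>2" using k by simp_all
      moreover have "x \<le> P + (R + Q)" if "x \<le> P + Q / 2" "0 \<le> R" "0 \<le> Q" for x P Q R :: real
        using that by linarith
      ultimately show ?thesis unfolding mn distrib_left by blast
    next
      case False
      \<comment> \<open>Here \<open>f a \<le> \<tau>\<close> while \<open>f b\<close> exceeds
        \<open>k * \<tau>\<close>, so the two differ at least by the factor
        \<open>k\<close>.\<close>
      then have "k * f a \<le> k * \<tau>" using k by simp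
      then have "k * f a \<le> f b" using ab by linarith
      then have "f a \<le> f b / k" using k by (simp add: pos_le_divide_eq mult.commute)
      then have "f a * f b \<le> f b / k * f b" using fnn[OF ab(2)] by (rule mult_right_mono)
      also have "\<dots> = 1 / k * (f b)\<^sup>2" by (simp add: power2_eq_square)
      finally have "f a * f b \<le> 1 / k * (f b)\<^sup>2" .
      moreover have "0 \<le> 1 / k * (f a)\<^sup>2" "0 \<le> k / 2 * mn a b" using k by (simp_all add: mn_def)
      moreover have "x \<le> P + (R + Q)" if "x \<le> Q" "0 \<le> R" "0 \<le> P" for x P Q R :: real
        using that by linarith
      ultimately show ?thesis unfolding distrib_left by blast
    qed
    have ww: "0 \<le> w i * w j" using wf[OF ij(1)] wf[OF ij(2)] by simp
    consider "f i \<le> k * \<tau>" "f j \<le> k * \<tau>" | "f i \<le> f j" "k * \<tau> < f j" | "f j \<le> f i" "k * \<tau> < f i"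
      by linarith
    then show ?thesis
    proof cases
      case 1
      have "0 \<le> k / 2 * mn i j" "0 \<le> 1 / k * ((f i)\<^sup>2 + (f j)\<^sup>2)" using k mn0 by simp_all
      then show ?thesis using 1 by (simp add: w_def)
    next
      case 2
      then show ?thesis using *[OF ij 2] ww by linarith
    next
      case 3
      have "mn j i = mn i j" by (auto simp: mn_def min.commute)
      then show ?thesis using *[OF ij(2,1) 3] ww by (simp add: mult.commute add.commute)
    qed
  qed
  let ?A = "ent A"
  have Ann: "0 \<le> A $$ (i, j)" if "i < n" "j < n" for i j using A(2) that by (simp add: nonneg_on_def)
  have "nth_eigenvalue 1 A = dot n f (\<lambda>i. nth_eigenvalue 1 A * f i)" using f1 by (simp add: dot_scale_right)
  also have "\<dots> = dot n f (app n ?A f)" using fev by (intro dot_cong) simp_all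
  also have "\<dots> = (\<Sum>i<n. \<Sum>j<n. A $$ (i, j) * (f i * f j))" by (rule dot_app)
  also have "\<dots> \<le> (\<Sum>i<n. \<Sum>j<n. A $$ (i, j) * (w i * w j + k / 2 * mn i j + 1 / k * ((f i)\<^sup>2 + (f j)\<^sup>2)))"
    using pair Ann by (intro sum_mono mult_left_mono) auto
  also have "\<dots> = (\<Sum>i<n. \<Sum>j<n. A $$ (i, j) * (w i * w j)) + k / 2 * (\<Sum>i<n. \<Sum>j<n. A $$ (i, j) * mn i j)
      + 1 / k * ((\<Sum>i<n. \<Sum>j<n. A $$ (i, j) * (f i)\<^sup>2) + (\<Sum>i<n. \<Sum>j<n. A $$ (i, j) * (f j)\<^sup>2))"
    by (simp add: distrib_left sum.distrib sum_distrib_left mult.left_commute add.assoc)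
  finally have up: "nth_eigenvalue 1 A \<le> (\<Sum>i<n. \<Sum>j<n. A $$ (i, j) * (w i * w j))
      + k / 2 * (\<Sum>i<n. \<Sum>j<n. A $$ (i, j) * mn i j)
      + 1 / k * ((\<Sum>i<n. \<Sum>j<n. A $$ (i, j) * (f i)\<^sup>2) + (\<Sum>i<n. \<Sum>j<n. A $$ (i, j) * (f j)\<^sup>2))" .
  have swap: "(\<Sum>i<n. \<Sum>j<n. A $$ (i, j) * (f j)\<^sup>2) = (\<Sum>i<n. \<Sum>j<n. A $$ (i, j) * (f i)\<^sup>2)"
    using A(3) by (subst sum.swap) (simp add: sym_on_def)
  have "(\<Sum>i<n. \<Sum>j<n. A $$ (i, j) * (f i)\<^sup>2) \<le> 2"
  proof -
    have "(\<Sum>i<n. \<Sum>j<n. A $$ (i, j) * (f i)\<^sup>2) = (\<Sum>i<n. app n ?A (\<lambda>_. 1) i * (f i)\<^sup>2)"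
      by (simp add: app_def sum_distrib_right)
    also have "\<dots> \<le> (\<Sum>i<n. 2 * (f i)\<^sup>2)" using rows by (intro sum_mono mult_right_mono) auto
    also have "\<dots> \<le> 2" using sumf[of "{..<n}"] by (simp add: sum_distrib_left[symmetric])
    finally show ?thesis .
  qed
  then have R: "1 / k * ((\<Sum>i<n. \<Sum>j<n. A $$ (i, j) * (f i)\<^sup>2) +
      (\<Sum>i<n. \<Sum>j<n. A $$ (i, j) * (f j)\<^sup>2)) \<le> 1 / k * (2 + 2)"
    unfolding swap using k by (intro mult_left_mono add_mono) simp_all
  have "(\<Sum>i<n. \<Sum>j<n. A $$ (i, j) * mn i j) \<le> \<delta>2"
  proof -
    have "(\<Sum>j<n. A $$ (i, j) * mn i j) = (if i \<in> H then \<Sum>j\<in>H. A $$ (i, j) * min ((f i)\<^sup>2) ((f j)\<^sup>2) else 0)" for i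
      using H by (auto simp: mn_def intro!: sum.mono_neutral_cong_right)
    then have "(\<Sum>i<n. \<Sum>j<n. A $$ (i, j) * mn i j) =
        (\<Sum>i<n. if i \<in> H then \<Sum>j\<in>H. A $$ (i, j) * min ((f i)\<^sup>2) ((f j)\<^sup>2) else 0)" by simp
    also have "\<dots> = (\<Sum>i\<in>H. \<Sum>j\<in>H. A $$ (i, j) * min ((f i)\<^sup>2) ((f j)\<^sup>2))"
      using H by (intro sum.mono_neutral_cong_right) auto
    also have "\<dots> \<le> \<delta>2 * (\<Sum>i\<in>H. (f i)\<^sup>2)"
    proof (rule sum_min_le[OF H(2)])
      fix S assume S: "S \<subseteq> H"
      then have "card S \<le> card H" using H by (intro card_mono)
      then have "real (card S) \<le> \<eta> * real n" using cardH by linarith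
      then show "(\<Sum>i\<in>S. \<Sum>j\<in>S. A $$ (i, j)) \<le> \<delta>2 * real (card S)"
        using S H by (intro sparse) auto
    qed simp
    also have "\<dots> \<le> \<delta>2" using sumf[OF H(1)] \<delta>2 by (simp add: mult_left_le)
    finally show ?thesis .
  qed
  then have Q: "k / 2 * (\<Sum>i<n. \<Sum>j<n. A $$ (i, j) * mn i j) \<le> k / 2 * \<delta>2"
    using k by (intro mult_left_mono) simp_all
  have "(\<Sum>i<n. \<Sum>j<n. A $$ (i, j) * (w i * w j)) =
      dot n w (app n (ent M) w) + (\<Sum>i<n. \<Sum>j<n. (A $$ (i, j) - M $$ (i, j)) * (w i * w j))"
    by (simp add: dot_app left_diff_distrib sum_subtractf)
  \<comment> \<open>The entries of \<open>w\<close> are at most \<open>k * \<tau>\<close>, and the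
    choice of \<open>\<tau>\<close> makes \<open>n\<close> cancel.\<close>
  also have "(\<Sum>i<n. \<Sum>j<n. (A $$ (i, j) - M $$ (i, j)) * (w i * w j)) \<le> (k * \<tau>)\<^sup>2 * (\<delta>3 * real n)"
    using disc wf k \<tau>(1) by (intro bilinear_box_le) auto
  also have "(k * \<tau>)\<^sup>2 * (\<delta>3 * real n) = k\<^sup>2 * \<delta>3 / \<eta>"
    using n0 by (simp add: power_mult_distrib \<tau>(2))
  also have "dot n w (app n (ent M) w) \<le> nth_eigenvalue 1 M - \<kappa> / 2 * (1 - (dot n w v)\<^sup>2)"
  proof (rule gap_Rayleigh[OF M(1,2) n M(3) v1 vev \<kappa>])
    have "dot n w w \<le> dot n w f" using wf by (intro dot_mono)
    also have "\<dots> = dot n f w" by (rule dot_commute)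
    also have "\<dots> \<le> dot n f f" using wf fnn by (intro dot_mono)
    finally show "dot n w w \<le> 1" using f1 by simp
  qed
  finally have "(\<Sum>i<n. \<Sum>j<n. A $$ (i, j) * (w i * w j)) \<le>
      nth_eigenvalue 1 M - \<kappa> / 2 * (1 - (dot n w v)\<^sup>2) + k\<^sup>2 * \<delta>3 / \<eta>" by simp
  then have up: "nth_eigenvalue 1 A \<le> nth_eigenvalue 1 M - \<kappa> / 2 * (1 - (dot n w v)\<^sup>2) + k\<^sup>2 * \<delta>3 / \<eta>
      + k / 2 * \<delta>2 + 1 / k * (2 + 2)"
    using up Q R by linarith
  have simps: "k * \<delta>2 / 2 = k / 2 * \<delta>2" "4 / k = 1 / k * (2 + 2)" by simp_all
  \<comment> \<open>With \<open>v\<close> as test vector the largest eigenvalue of \<open>A\<close>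
    is bounded below; against the upper estimate this leaves little room for
    \<open>1 - (dot n w v)\<^sup>2\<close>.\<close>
  have "dot n v (app n ?A v) \<le> nth_eigenvalue 1 A * dot n v v"
    using Rayleigh_nth_eigenvalue_1[OF A(1,3) n0] by metis
  then have "nth_eigenvalue 1 M - \<delta>1 \<le> nth_eigenvalue 1 A" using quad v1 by simp
  then have "\<kappa> / 2 * (1 - (dot n w v)\<^sup>2) \<le> \<delta>1 + k * \<delta>2 / 2 + 4 / k + k\<^sup>2 * \<delta>3 / \<eta>"
    using up unfolding simps by linarith
  then have le1: "1 - (dot n w v)\<^sup>2 \<le> (\<delta>1 + k * \<delta>2 / 2 + 4 / k + k\<^sup>2 * \<delta>3 / \<eta>) / (\<kappa> / 2)"
    using \<kappa>(1) by (subst pos_le_divide_eq) (simp_all only: mult.commute half_gt_zero)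
  have le2: "(dot n w v)\<^sup>2 \<le> (dot n f v)\<^sup>2"
  proof (rule power_mono)
    show "0 \<le> dot n w v" using wf vnn by (intro dot_nonneg)
    have "dot n v w \<le> dot n v f" using wf vnn by (intro dot_mono)
    then show "dot n w v \<le> dot n f v" by (simp only: dot_commute[of n _ v])
  qed
  have eq: "x / (\<kappa> / 2) = 2 / \<kappa> * x" for x by simp
  have "1 - y \<le> b" if "1 - a \<le> y" "a \<le> b" for a b y :: real using that by linarith
  from this[OF le1 le2] show ?thesis unfolding eq .
qed

section \<open>Concentration\<close>

lemma prob_le_expectation:
  assumes "finite (set_pmf p)" "\<And>x. x \<in> set_pmf p \<Longrightarrow> 0 \<le> f x"
    "\<And>x. x \<in> set_pmf p \<Longrightarrow> x \<in> S \<Longrightarrow> 1 \<le> f x"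
  shows "measure_pmf.prob p S \<le> measure_pmf.expectation p f"
proof -
  have "measure_pmf.prob p S = measure_pmf.expectation p (indicator S)" by simp
  also have "\<dots> \<le> measure_pmf.expectation p f"
    using assms by (intro integral_mono_AE integrable_measure_pmf_finite)
      (auto simp: AE_measure_pmf_iff indicator_def)
  finally show ?thesis .
qed

text \<open>Binomial theorem; it totals a union bound over vertex sets with failure probabilities
  \<open>q ^ card S\<close>.\<close>

lemma sum_Pow_power_card:
  assumes "finite X"
  shows "(\<Sum>S\<in>Pow X. q ^ card S) = (1 + q :: real) ^ card X"
  using assms
proof (induction X)
  case (insert x F)
  have "(\<Sum>S\<in>Pow (insert x F). q ^ card S) =
      (\<Sum>S\<in>Pow F. q ^ card S) + (\<Sum>S\<in>insert x ` Pow F. q ^ card S)"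
    unfolding Pow_insert using insert.hyps by (intro sum.union_disjoint) auto
  also have "(\<Sum>S\<in>insert x ` Pow F. q ^ card S) = (\<Sum>S\<in>Pow F. q ^ card (insert x S))"
    using insert.hyps by (subst sum.reindex) (auto simp: inj_on_def)
  also have "\<dots> = (\<Sum>S\<in>Pow F. q * q ^ card S)"
    using insert.hyps by (intro sum.cong refl) (auto simp: finite_subset card_insert_if)
  finally show ?case using insert by (simp add: sum_distrib_left[symmetric] algebra_simps)
qed simp

text \<open>The common form of all statistics needed: rows applied to a fixed vector, sums over a
  block of vertices and quadratic forms differ only in \<open>W\<close>.\<close>

definition wsum :: "nat \<Rightarrow> (nat \<Rightarrow> nat \<Rightarrow> real) \<Rightarrow> real mat \<Rightarrow> real" where
  "wsum n W A = (\<Sum>i<n. \<Sum>j<n. A $$ (i, j) * W i j)"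

definition whp :: "(nat \<Rightarrow> 'a pmf) \<Rightarrow> (nat \<Rightarrow> 'a \<Rightarrow> bool) \<Rightarrow> bool" where
  "whp D P \<longleftrightarrow> (\<forall>\<epsilon>>0. \<forall>\<^sub>F n in sequentially. measure_pmf.prob (D n) {A. \<not> P n A} \<le> \<epsilon>)"

lemma whp_conj:
  assumes "whp D P" "whp D Q"
  shows "whp D (\<lambda>n A. P n A \<and> Q n A)"
  unfolding whp_def
proof (intro allI impI)
  fix \<epsilon> :: real assume "\<epsilon> > 0"
  then have "\<epsilon> / 2 > 0" by simp
  then have "\<forall>\<^sub>F n in sequentially. measure_pmf.prob (D n) {A. \<not> P n A} \<le> \<epsilon> / 2"
    "\<forall>\<^sub>F n in sequentially. measure_pmf.prob (D n) {A. \<not> Q n A} \<le> \<epsilon> / 2"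
    using assms unfolding whp_def by blast+
  then show "\<forall>\<^sub>F n in sequentially. measure_pmf.prob (D n) {A. \<not> (P n A \<and> Q n A)} \<le> \<epsilon>"
  proof eventually_elim
    case (elim n)
    have "{A. \<not> (P n A \<and> Q n A)} = {A. \<not> P n A} \<union> {A. \<not> Q n A}" by auto
    then have "measure_pmf.prob (D n) {A. \<not> (P n A \<and> Q n A)} \<le>
        measure_pmf.prob (D n) {A. \<not> P n A} + measure_pmf.prob (D n) {A. \<not> Q n A}"
      by (simp add: measure_Un_le)
    then show ?case using elim by linarith
  qed
qed

lemma whp_mono:
  assumes "whp D P" "\<forall>\<^sub>F n in sequentially. \<forall>A\<in>set_pmf (D n). P n A \<longrightarrow> Q n A"
  shows "whp D Q"
  unfolding whp_def
proof (intro allI impI)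
  fix \<epsilon> :: real assume "\<epsilon> > 0"
  then have "\<forall>\<^sub>F n in sequentially. measure_pmf.prob (D n) {A. \<not> P n A} \<le> \<epsilon>"
    using assms by (simp add: whp_def)
  with assms(2) show "\<forall>\<^sub>F n in sequentially. measure_pmf.prob (D n) {A. \<not> Q n A} \<le> \<epsilon>"
  proof eventually_elim
    case (elim n)
    have "measure_pmf.prob (D n) {A. \<not> Q n A} \<le> measure_pmf.prob (D n) {A. \<not> P n A}"
      using elim(1) by (intro measure_pmf.finite_measure_mono_AE) (auto simp: AE_measure_pmf_iff)
    then show ?case using elim(2) by linarith
  qed
qed

lemma whpI:
  assumes "\<forall>\<^sub>F n in sequentially. measure_pmf.prob (D n) {A. \<not> P n A} \<le> f n" "f \<longlonglongrightarrow> 0"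
  shows "whp D P"
  unfolding whp_def
proof (intro allI impI)
  fix \<epsilon> :: real assume "\<epsilon> > 0"
  then have "\<forall>\<^sub>F n in sequentially. f n < \<epsilon>" using assms(2) by (intro order_tendstoD)
  with assms(1) show "\<forall>\<^sub>F n in sequentially. measure_pmf.prob (D n) {A. \<not> P n A} \<le> \<epsilon>"
    by eventually_elim simp
qed

text \<open>\<open>d\<close> stands for the degree scale and \<open>g\<close> for the relative loss of mass by truncating multiple
  edges, which shifts the upper tail.\<close>

lemma wsum_row:
  assumes "i < n"
  shows "wsum n (\<lambda>a j. if a = i then y j else 0) A = app n (ent A) y i"
proof -
  have "wsum n (\<lambda>a j. if a = i then y j else 0) A = (\<Sum>a<n. if a = i then (\<Sum>j<n. A $$ (a, j) * y j) else 0)"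
    unfolding wsum_def by (intro sum.cong) auto
  then show ?thesis using assms by (simp add: app_def)
qed

lemma wsum_row_total:
  fixes n :: nat
  assumes "i < n"
  shows "(\<Sum>a<n. \<Sum>j<n. if a = i then y j else 0) = (\<Sum>j<n. y j :: real)"
proof -
  have "(\<Sum>a<n. \<Sum>j<n. if a = i then y j else 0) = (\<Sum>a<n. if a = i then (\<Sum>j<n. y j) else 0)"
    by (intro sum.cong) auto
  then show ?thesis using assms by simp
qed

text \<open>Division by \<open>C\<close> brings the weights into [0, 1] with total at most
  \<open>n\<close>, the normalization under which \<open>tail\<close> and
  \<open>expectation_abs\<close> are applied to rows.\<close>

lemma row_weights:
  fixes n :: nat
  assumes i: "i < n" and C: "C > 0" and y: "\<forall>i<n. 0 \<le> y i \<and> y i \<le> C"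
  defines "W \<equiv> \<lambda>a j. if a = i then 1 / C * y j else 0"
  shows "\<forall>a<n. \<forall>j<n. 0 \<le> W a j \<and> W a j \<le> 1" "(\<Sum>a<n. \<Sum>j<n. W a j) \<le> 1 * real n"
    "wsum n W A = 1 / C * app n (ent A) y i"
proof -
  have y01: "0 \<le> 1 / C * y j" "1 / C * y j \<le> 1" if "j < n" for j
  proof -
    have "0 \<le> y j" "y j \<le> C" using y that by blast+
    then show "0 \<le> 1 / C * y j" "1 / C * y j \<le> 1" using C by simp_all
  qed
  show "\<forall>a<n. \<forall>j<n. 0 \<le> W a j \<and> W a j \<le> 1"
    unfolding W_def using y01 by (simp only: split: if_split) simp
  have "(\<Sum>a<n. \<Sum>j<n. W a j) = (\<Sum>j<n. 1 / C * y j)" unfolding W_def by (rule wsum_row_total[OF i])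
  also have "\<dots> \<le> (\<Sum>j<n. 1)" by (rule sum_mono) (use y01(2) in simp)
  finally show "(\<Sum>a<n. \<Sum>j<n. W a j) \<le> 1 * real n" by simp
  show "wsum n W A = 1 / C * app n (ent A) y i"
    unfolding W_def using wsum_row[OF i, of "\<lambda>j. 1 / C * y j" A] by (simp only: app_scale)
qed

lemma wsum_block:
  assumes "S \<subseteq> {..<n}" "T \<subseteq> {..<n}"
  shows "wsum n (\<lambda>i j. if i \<in> S \<and> j \<in> T then 1 else 0) A = (\<Sum>i\<in>S. \<Sum>j\<in>T. A $$ (i, j))"
proof -
  have "(\<Sum>j<n. A $$ (i, j) * (if i \<in> S \<and> j \<in> T then 1 else 0)) = (if i \<in> S then (\<Sum>j\<in>T. A $$ (i, j)) else 0)" for i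
  proof (cases "i \<in> S")
    case True
    have "(\<Sum>j<n. A $$ (i, j) * (if i \<in> S \<and> j \<in> T then 1 else 0)) = (\<Sum>j\<in>T. A $$ (i, j))"
      using assms(2) True by (intro sum.mono_neutral_cong_right) auto
    then show ?thesis using True by simp
  qed simp
  then have "wsum n (\<lambda>i j. if i \<in> S \<and> j \<in> T then 1 else 0) A = (\<Sum>i<n. if i \<in> S then (\<Sum>j\<in>T. A $$ (i, j)) else 0)"
    unfolding wsum_def by simp
  also have "\<dots> = (\<Sum>i\<in>S. \<Sum>j\<in>T. A $$ (i, j))"
    using assms(1) by (intro sum.mono_neutral_cong_right) auto
  finally show ?thesis .
qed

lemma wsum_block_total:
  fixes n :: nat
  assumes "S \<subseteq> {..<n}" "T \<subseteq> {..<n}"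
  shows "(\<Sum>i<n. \<Sum>j<n. if i \<in> S \<and> j \<in> T then 1 else 0) = real (card S) * real (card T)"
proof -
  have "(\<Sum>j<n. if i \<in> S \<and> j \<in> T then 1 else 0) = (if i \<in> S then real (card T) else 0)" for i
  proof -
    have "{..<n} \<inter> T = T" using assms(2) by blast
    then show ?thesis by (auto simp: sum.If_cases)
  qed
  moreover have "{..<n} \<inter> S = S" using assms(1) by blast
  ultimately show ?thesis by (simp add: sum.If_cases)
qed

text \<open>The interface between the random graphs and the centralities. One indicator moves the
  functional by order \<open>1 / d n\<close>, whence the range of \<open>\<theta>\<close> in
  \<open>mgf\<close>; the entries of \<open>M n\<close> are of order \<open>1 / n\<close>, which
  explains the second-order term with \<open>real n * d n\<close> in the denominator. The bound is
  uniform in \<open>W\<close> because the weights vary with \<open>n\<close> and over vertex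
  sets.\<close>

locale concentrated =
  fixes D :: "nat \<Rightarrow> real mat pmf" and M :: "nat \<Rightarrow> real mat" and K :: real and d g :: "nat \<Rightarrow> real"
  assumes finite_support: "finite (set_pmf (D n))"
    and support: "A \<in> set_pmf (D n) \<Longrightarrow> A \<in> carrier_mat n n \<and> sym_on n (ent A) \<and> nonneg_on n (ent A)"
    and M_eq: "M n = expected_mat n (D n)"
    and K: "K > 0"
    and entry_le: "\<forall>\<^sub>F n in sequentially. \<forall>i<n. \<forall>j<n. M n $$ (i, j) \<le> K / real n"
    and row_le: "\<forall>\<^sub>F n in sequentially. \<forall>i<n. app n (ent (M n)) (\<lambda>_. 1) i \<le> 1"
    and d_top: "filterlim d at_top sequentially"
    and d_exp: "c > 0 \<Longrightarrow> (\<lambda>n. real n * exp (- c * d n)) \<longlonglongrightarrow> 0"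
    and g_lim: "g \<longlonglongrightarrow> 0"
    and mgf: "\<forall>\<^sub>F n in sequentially. \<forall>W \<theta>. (\<forall>i<n. \<forall>j<n. 0 \<le> W i j \<and> W i j \<le> 1) \<longrightarrow> 0 \<le> \<theta> \<longrightarrow> K * \<theta> \<le> d n \<longrightarrow>
      measure_pmf.expectation (D n) (\<lambda>A. exp (\<theta> * (wsum n W A - wsum n W (M n))))
        \<le> exp (\<theta>\<^sup>2 * K * (\<Sum>i<n. \<Sum>j<n. W i j) / (real n * d n) + \<theta> * g n * (\<Sum>i<n. \<Sum>j<n. W i j) / real n)"
begin

section \<open>Deviation bounds from an exponential moment bound\<close>

lemma integrable: "integrable (measure_pmf (D n)) (f :: real mat \<Rightarrow> real)"
  by (rule integrable_measure_pmf_finite[OF finite_support])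

lemma M_index: "i < n \<Longrightarrow> j < n \<Longrightarrow> M n $$ (i, j) = measure_pmf.expectation (D n) (\<lambda>A. A $$ (i, j))"
  by (simp add: M_eq expected_mat_def)

lemma M_carrier: "M n \<in> carrier_mat n n" by (simp add: M_eq expected_mat_def)

lemma M_nonneg: "nonneg_on n (ent (M n))"
  unfolding nonneg_on_def
proof (intro allI impI)
  fix i j assume ij: "i < n" "j < n"
  have "0 \<le> measure_pmf.expectation (D n) (\<lambda>A. A $$ (i, j))"
    using support[of _ n] ij by (intro integral_nonneg_AE) (auto simp: AE_measure_pmf_iff nonneg_on_def)
  then show "0 \<le> M n $$ (i, j)" using M_index[OF ij] by simp
qed

lemma M_sym: "sym_on n (ent (M n))"
  unfolding sym_on_def
proof (intro allI impI)
  fix i j assume ij: "i < n" "j < n"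
  have "measure_pmf.expectation (D n) (\<lambda>A. A $$ (i, j)) = measure_pmf.expectation (D n) (\<lambda>A. A $$ (j, i))"
    using support[of _ n] ij by (intro integral_cong_AE) (auto simp: AE_measure_pmf_iff sym_on_def)
  then show "M n $$ (i, j) = M n $$ (j, i)" using M_index[OF ij] M_index[OF ij(2,1)] by simp
qed

lemma expectation_wsum: "measure_pmf.expectation (D n) (wsum n W) = wsum n W (M n)"
  unfolding wsum_def by (simp add: Bochner_Integration.integral_sum integrable M_index)

text \<open>Chernoff bound with \<open>\<theta>\<close> proportional to \<open>d n\<close>. The
  parameter \<open>B\<close> measures the total weight in units of \<open>n\<close> and reappears in
  the exponent: rows use 1, vertex sets \<open>S\<close> use \<open>card S\<close>, pairs of vertex
  sets use \<open>n\<close>.\<close>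

lemma tail:
  assumes \<delta>: "\<delta> > 0"
  obtains c where "c > 0" "\<forall>\<^sub>F n in sequentially. \<forall>W B. (\<forall>i<n. \<forall>j<n. 0 \<le> W i j \<and> W i j \<le> 1) \<longrightarrow> 0 \<le> B \<longrightarrow>
      (\<Sum>i<n. \<Sum>j<n. W i j) \<le> B * real n \<longrightarrow>
      measure_pmf.prob (D n) {A. \<delta> * B \<le> wsum n W A - wsum n W (M n)} \<le> exp (- c * d n * B)"
proof -
  \<comment> \<open>The first bound makes \<open>\<theta> = b * d n\<close> admissible in
    \<open>mgf\<close>; the second, together with \<open>g n < \<delta> / 4\<close>, keeps the
    exponent of the moment below half of that of the threshold.\<close>
  define b where "b = min (1 / K) (\<delta> / (4 * K))"
  have b0: "b > 0" "b \<le> 1 / K" "b \<le> \<delta> / (4 * K)" using K \<delta> by (simp_all add: b_def)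
  have b: "b > 0" "K * b \<le> 1" "K * b \<le> \<delta> / 4"
    using b0(1) mult_left_mono[OF b0(2), of K] mult_left_mono[OF b0(3), of K] K by simp_all
  have "\<forall>\<^sub>F n in sequentially. g n < \<delta> / 4" using g_lim \<delta> by (intro order_tendstoD) auto
  moreover have "\<forall>\<^sub>F n in sequentially. d n > 0" using d_top by (simp add: filterlim_at_top_dense)
  ultimately have "\<forall>\<^sub>F n in sequentially. \<forall>W B. (\<forall>i<n. \<forall>j<n. 0 \<le> W i j \<and> W i j \<le> 1) \<longrightarrow> 0 \<le> B \<longrightarrow>
      (\<Sum>i<n. \<Sum>j<n. W i j) \<le> B * real n \<longrightarrow>
      measure_pmf.prob (D n) {A. \<delta> * B \<le> wsum n W A - wsum n W (M n)} \<le> exp (- (b * \<delta> / 2) * d n * B)"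
    using mgf eventually_gt_at_top[of 0]
  proof eventually_elim
    case (elim n)
    show ?case
    proof (intro allI impI)
      fix W B assume W: "\<forall>i<n. \<forall>j<n. 0 \<le> W i j \<and> W i j \<le> (1::real)" and B: "0 \<le> B"
        and L: "(\<Sum>i<n. \<Sum>j<n. W i j) \<le> B * real n"
      let ?L = "\<Sum>i<n. \<Sum>j<n. W i j" and ?X = "\<lambda>A. wsum n W A - wsum n W (M n)"
      define \<theta> where "\<theta> = b * d n"
      have \<theta>: "0 \<le> \<theta>" using b(1) elim(2) by (simp add: \<theta>_def)
      have K\<theta>: "K * \<theta> \<le> d n" using mult_right_mono[OF b(2), of "d n"] elim(2) by (simp add: \<theta>_def mult.assoc)
      define u where "u = ?L / real n"
      have u: "0 \<le> u" "u \<le> B" using L W elim(4) by (auto simp: u_def pos_divide_le_eq intro!: divide_nonneg_nonneg sum_nonneg)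
      have "\<theta>\<^sup>2 * K * ?L / (real n * d n) = \<theta> * ((K * b) * u)"
        using elim(2) by (simp add: \<theta>_def u_def power2_eq_square)
      moreover have "\<theta> * g n * ?L / real n = \<theta> * (g n * u)" by (simp add: u_def)
      moreover have le: "(K * b) * u + g n * u \<le> \<delta> / 2 * B"
      proof -
        have "(K * b + g n) * u \<le> \<delta> / 2 * u" using b(3) elim(1) u by (intro mult_right_mono) auto
        also have "\<dots> \<le> \<delta> / 2 * B" using u \<delta> by (intro mult_left_mono) auto
        finally show ?thesis by (simp add: distrib_right)
      qed
      ultimately have "\<theta>\<^sup>2 * K * ?L / (real n * d n) + \<theta> * g n * ?L / real n \<le> \<theta> * (\<delta> / 2 * B)"
        using mult_left_mono[OF le \<theta>] by (simp only: distrib_left)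
      moreover have "measure_pmf.expectation (D n) (\<lambda>A. exp (\<theta> * ?X A)) \<le>
          exp (\<theta>\<^sup>2 * K * ?L / (real n * d n) + \<theta> * g n * ?L / real n)"
        using elim(3) W \<theta> K\<theta> by blast
      ultimately have ex: "measure_pmf.expectation (D n) (\<lambda>A. exp (\<theta> * ?X A)) \<le> exp (\<theta> * (\<delta> / 2 * B))"
        by (meson exp_le_cancel_iff order_trans)
      have "measure_pmf.prob (D n) {A. \<delta> * B \<le> ?X A} \<le>
          measure_pmf.expectation (D n) (\<lambda>A. exp (- (\<theta> * (\<delta> * B))) * exp (\<theta> * ?X A))"
        using \<theta> by (intro prob_le_expectation finite_support)
          (auto simp: exp_add[symmetric] intro!: mult_left_mono)
      also have "\<dots> = exp (- (\<theta> * (\<delta> * B))) * measure_pmf.expectation (D n) (\<lambda>A. exp (\<theta> * ?X A))"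
        by simp
      also have "\<dots> \<le> exp (- (\<theta> * (\<delta> * B))) * exp (\<theta> * (\<delta> / 2 * B))"
        using ex by (rule mult_left_mono) simp
      also have "\<dots> = exp (- (b * \<delta> / 2) * d n * B)"
        by (simp add: exp_add[symmetric] \<theta>_def)
      finally show "measure_pmf.prob (D n) {A. \<delta> * B \<le> ?X A} \<le> exp (- (b * \<delta> / 2) * d n * B)" .
    qed
  qed
  then show ?thesis using b \<delta> by (intro that[of "b * \<delta> / 2"]) auto
qed

text \<open>The deviation has mean 0, so an upper exponential moment alone controls its absolute
  value, through \<open>\<bar>x\<bar> \<le> 2 / \<theta> * exp (\<theta> * x) - x\<close>. For fixed
  \<open>\<theta>\<close> the exponent in \<open>mgf\<close> tends to 0, and the moment is
  eventually at most 2.\<close>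

lemma expectation_abs:
  assumes \<delta>: "\<delta> > 0" and C: "C \<ge> 0"
  shows "\<forall>\<^sub>F n in sequentially. \<forall>W. (\<forall>i<n. \<forall>j<n. 0 \<le> W i j \<and> W i j \<le> 1) \<longrightarrow>
      (\<Sum>i<n. \<Sum>j<n. W i j) \<le> C * real n \<longrightarrow>
      measure_pmf.expectation (D n) (\<lambda>A. \<bar>wsum n W A - wsum n W (M n)\<bar>) \<le> \<delta>"
proof -
  \<comment> \<open>The final estimate is \<open>2 / \<theta> * 2\<close>, which is to equal
    \<open>\<delta>\<close>.\<close>
  define \<theta> where "\<theta> = 4 / \<delta>"
  have \<theta>: "\<theta> > 0" using \<delta> by (simp add: \<theta>_def)
  have "(\<lambda>n. \<theta>\<^sup>2 * K * C / d n + \<theta> * \<bar>g n\<bar> * C) \<longlonglongrightarrow> 0 + \<theta> * \<bar>0\<bar> * C"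
    using g_lim d_top by (intro tendsto_intros tendsto_divide_0[OF tendsto_const] filterlim_at_top_imp_at_infinity)
  then have "\<forall>\<^sub>F n in sequentially. \<theta>\<^sup>2 * K * C / d n + \<theta> * \<bar>g n\<bar> * C < ln 2"
    by (intro order_tendstoD) auto
  moreover have "\<forall>\<^sub>F n in sequentially. d n > K * \<theta>" "\<forall>\<^sub>F n in sequentially. d n > 0"
    using d_top by (simp_all add: filterlim_at_top_dense)
  ultimately show ?thesis using mgf eventually_gt_at_top[of 0]
  proof eventually_elim
    case (elim n)
    show ?case
    proof (intro allI impI)
      fix W assume W: "\<forall>i<n. \<forall>j<n. 0 \<le> W i j \<and> W i j \<le> (1::real)"
        and L: "(\<Sum>i<n. \<Sum>j<n. W i j) \<le> C * real n"
      let ?L = "\<Sum>i<n. \<Sum>j<n. W i j" and ?X = "\<lambda>A. wsum n W A - wsum n W (M n)"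
      define u where "u = ?L / real n"
      have u: "0 \<le> u" "u \<le> C" using L W elim(5) by (auto simp: u_def pos_divide_le_eq intro!: divide_nonneg_nonneg sum_nonneg)
      have "\<theta>\<^sup>2 * K * ?L / (real n * d n) = (\<theta>\<^sup>2 * K / d n) * u" by (simp add: u_def)
      also have "\<dots> \<le> (\<theta>\<^sup>2 * K / d n) * C" using u K elim(3) by (intro mult_left_mono) auto
      finally have 1: "\<theta>\<^sup>2 * K * ?L / (real n * d n) \<le> \<theta>\<^sup>2 * K * C / d n" by simp
      have "\<theta> * g n * ?L / real n = (\<theta> * g n) * u" by (simp add: u_def)
      also have "\<dots> \<le> (\<theta> * \<bar>g n\<bar>) * u" using u(1) \<theta> by (intro mult_right_mono) simp_all
      also have "\<dots> \<le> (\<theta> * \<bar>g n\<bar>) * C" using u(2) \<theta> by (intro mult_left_mono) simp_all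
      finally have 2: "\<theta> * g n * ?L / real n \<le> \<theta> * \<bar>g n\<bar> * C" .
      have "measure_pmf.expectation (D n) (\<lambda>A. exp (\<theta> * ?X A)) \<le>
          exp (\<theta>\<^sup>2 * K * ?L / (real n * d n) + \<theta> * g n * ?L / real n)"
        using elim(4) W less_imp_le[OF \<theta>] less_imp_le[OF elim(2)] by blast
      also have "\<dots> \<le> exp (ln 2)" using 1 2 elim(1) by (subst exp_le_cancel_iff) linarith
      finally have ex: "measure_pmf.expectation (D n) (\<lambda>A. exp (\<theta> * ?X A)) \<le> 2" by simp
      have "\<bar>x\<bar> \<le> 2 / \<theta> * exp (\<theta> * x) - x" for x
      proof (cases "x \<ge> 0")
        case True
        have "\<theta> * x \<le> exp (\<theta> * x)" using exp_ge_add_one_self[of "\<theta> * x"] by linarith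
        then have "2 * x \<le> 2 / \<theta> * exp (\<theta> * x)" using \<theta> by (simp add: pos_le_divide_eq mult.commute)
        then show ?thesis using True by simp
      qed (use \<theta> in simp)
      then have "measure_pmf.expectation (D n) (\<lambda>A. \<bar>?X A\<bar>) \<le>
          measure_pmf.expectation (D n) (\<lambda>A. 2 / \<theta> * exp (\<theta> * ?X A) - ?X A)"
        by (intro integral_mono integrable)
      also have "\<dots> = 2 / \<theta> * measure_pmf.expectation (D n) (\<lambda>A. exp (\<theta> * ?X A)) - measure_pmf.expectation (D n) ?X"
        by (subst Bochner_Integration.integral_diff) (simp_all add: integrable)
      also have "measure_pmf.expectation (D n) ?X = 0"
        by (subst Bochner_Integration.integral_diff) (simp_all add: integrable expectation_wsum)
      also have "2 / \<theta> * measure_pmf.expectation (D n) (\<lambda>A. exp (\<theta> * ?X A)) - 0 \<le> 2 / \<theta> * 2"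
        using mult_left_mono[OF ex, of "2 / \<theta>"] \<theta> by simp
      also have "\<dots> = \<delta>" by (simp add: \<theta>_def)
      finally show "measure_pmf.expectation (D n) (\<lambda>A. \<bar>?X A\<bar>) \<le> \<delta>" .
    qed
  qed
qed

text \<open>A union over \<open>n\<close> rows, each failing with probability at most
  \<open>exp (- c * d n)\<close>; \<open>d_exp\<close> beats the factor \<open>n\<close>.\<close>

lemma whp_rows:
  assumes C: "C > 0" and \<delta>: "\<delta> > 0"
    and y: "\<forall>\<^sub>F n in sequentially. \<forall>i<n. 0 \<le> y n i \<and> y n i \<le> C"
  shows "whp D (\<lambda>n A. \<forall>i<n. app n (ent A) (y n) i - app n (ent (M n)) (y n) i \<le> \<delta>)"
proof -
  obtain c where c: "c > 0" and t: "\<forall>\<^sub>F n in sequentially. \<forall>W B. (\<forall>i<n. \<forall>j<n. 0 \<le> W i j \<and> W i j \<le> 1) \<longrightarrow> 0 \<le> B \<longrightarrow>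
      (\<Sum>i<n. \<Sum>j<n. W i j) \<le> B * real n \<longrightarrow>
      measure_pmf.prob (D n) {A. (\<delta> / C) * B \<le> wsum n W A - wsum n W (M n)} \<le> exp (- c * d n * B)"
    by (rule tail[of "\<delta> / C"]) (use \<delta> C in simp)
  show ?thesis
  proof (rule whpI)
    show "(\<lambda>n. real n * exp (- c * d n)) \<longlonglongrightarrow> 0" by (rule d_exp[OF c])
    show "\<forall>\<^sub>F n in sequentially. measure_pmf.prob (D n)
        {A. \<not> (\<forall>i<n. app n (ent A) (y n) i - app n (ent (M n)) (y n) i \<le> \<delta>)} \<le> real n * exp (- c * d n)"
      using t y
    proof eventually_elim
      case (elim n)
      let ?W = "\<lambda>i a j. if a = i then 1 / C * y n j else 0"
      have b: "measure_pmf.prob (D n) {A. \<not> (app n (ent A) (y n) i - app n (ent (M n)) (y n) i \<le> \<delta>)} \<le> exp (- c * d n)"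
        if i: "i < n" for i
      proof -
        have "measure_pmf.prob (D n) {A. \<not> (app n (ent A) (y n) i - app n (ent (M n)) (y n) i \<le> \<delta>)} \<le>
            measure_pmf.prob (D n) {A. (\<delta> / C) * 1 \<le> wsum n (?W i) A - wsum n (?W i) (M n)}"
          unfolding row_weights(3)[OF i C elim(2)] right_diff_distrib[symmetric] using C
          by (intro measure_pmf.finite_measure_mono) (auto simp: divide_right_mono)
        also have "\<dots> \<le> exp (- c * d n * 1)"
          by (rule elim(1)[THEN spec, of "?W i", THEN spec, of 1, THEN mp, OF row_weights(1)[OF i C elim(2)],
                THEN mp, OF zero_le_one, THEN mp, OF row_weights(2)[OF i C elim(2)]])
        finally show ?thesis by simp
      qed
      have "{A. \<not> (\<forall>i<n. app n (ent A) (y n) i - app n (ent (M n)) (y n) i \<le> \<delta>)} =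
          (\<Union>i\<in>{..<n}. {A. \<not> (app n (ent A) (y n) i - app n (ent (M n)) (y n) i \<le> \<delta>)})" by auto
      then have "measure_pmf.prob (D n) {A. \<not> (\<forall>i<n. app n (ent A) (y n) i - app n (ent (M n)) (y n) i \<le> \<delta>)} \<le>
          (\<Sum>i<n. measure_pmf.prob (D n) {A. \<not> (app n (ent A) (y n) i - app n (ent (M n)) (y n) i \<le> \<delta>)})"
        using measure_pmf.finite_measure_subadditive_finite[of "{..<n}"] by simp
      also have "\<dots> \<le> (\<Sum>i<n. exp (- c * d n))" using b by (intro sum_mono) simp
      finally show ?case by simp
    qed
  qed
qed

lemma Markov:
  assumes "\<delta> > 0" "\<And>A. 0 \<le> f A"
  shows "measure_pmf.prob (D n) {A. \<not> f A \<le> \<delta>} \<le> measure_pmf.expectation (D n) f / \<delta>"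
proof -
  have "measure_pmf.prob (D n) {A. \<not> f A \<le> \<delta>} \<le> measure_pmf.expectation (D n) (\<lambda>A. f A / \<delta>)"
    using assms by (intro prob_le_expectation finite_support) (auto simp: pos_le_divide_eq)
  then show ?thesis by simp
qed

text \<open>Two-sided control of every single row would need lower tails; for the average, first
  absolute moments and Markov's inequality suffice.\<close>

lemma whp_rows_average:
  assumes C: "C > 0" and \<delta>: "\<delta> > 0"
    and y: "\<forall>\<^sub>F n in sequentially. \<forall>i<n. 0 \<le> y n i \<and> y n i \<le> C"
  shows "whp D (\<lambda>n A. 1 / real n * (\<Sum>i<n. \<bar>app n (ent A) (y n) i - app n (ent (M n)) (y n) i\<bar>) \<le> \<delta>)"
  unfolding whp_def
proof (intro allI impI)
  fix \<epsilon> :: real assume \<epsilon>: "\<epsilon> > 0"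
  have "\<forall>\<^sub>F n in sequentially. \<forall>W. (\<forall>i<n. \<forall>j<n. 0 \<le> W i j \<and> W i j \<le> 1) \<longrightarrow>
      (\<Sum>i<n. \<Sum>j<n. W i j) \<le> 1 * real n \<longrightarrow>
      measure_pmf.expectation (D n) (\<lambda>A. \<bar>wsum n W A - wsum n W (M n)\<bar>) \<le> \<epsilon> * \<delta> / C"
    using \<epsilon> \<delta> C by (intro expectation_abs) auto
  then show "\<forall>\<^sub>F n in sequentially. measure_pmf.prob (D n)
      {A. \<not> 1 / real n * (\<Sum>i<n. \<bar>app n (ent A) (y n) i - app n (ent (M n)) (y n) i\<bar>) \<le> \<delta>} \<le> \<epsilon>"
    using y eventually_gt_at_top[of 0]
  proof eventually_elim
    case (elim n)
    let ?W = "\<lambda>i a j. if a = i then 1 / C * y n j else 0"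
    let ?X = "\<lambda>A i. app n (ent A) (y n) i - app n (ent (M n)) (y n) i"
    have b: "measure_pmf.expectation (D n) (\<lambda>A. \<bar>?X A i\<bar>) \<le> \<epsilon> * \<delta>" if i: "i < n" for i
    proof -
      have "\<bar>wsum n (?W i) A - wsum n (?W i) (M n)\<bar> = \<bar>?X A i\<bar> / C" for A
        unfolding row_weights(3)[OF i C elim(2)] right_diff_distrib[symmetric] using C by (simp add: abs_mult)
      moreover have "measure_pmf.expectation (D n) (\<lambda>A. \<bar>wsum n (?W i) A - wsum n (?W i) (M n)\<bar>) \<le> \<epsilon> * \<delta> / C"
        by (rule elim(1)[THEN spec, of "?W i", THEN mp, OF row_weights(1)[OF i C elim(2)],
              THEN mp, OF row_weights(2)[OF i C elim(2)]])
      ultimately have "measure_pmf.expectation (D n) (\<lambda>A. \<bar>?X A i\<bar>) / C \<le> \<epsilon> * \<delta> / C" by simp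
      then show ?thesis using C by (simp add: divide_le_cancel)
    qed
    have "measure_pmf.expectation (D n) (\<lambda>A. 1 / real n * (\<Sum>i<n. \<bar>?X A i\<bar>)) =
        1 / real n * (\<Sum>i<n. measure_pmf.expectation (D n) (\<lambda>A. \<bar>?X A i\<bar>))"
      by (simp add: Bochner_Integration.integral_sum integrable)
    also have "\<dots> \<le> 1 / real n * (\<Sum>i<n. \<epsilon> * \<delta>)"
      using b by (intro mult_left_mono sum_mono) simp_all
    also have "\<dots> = \<epsilon> * \<delta>" using elim(3) by simp
    finally have E: "measure_pmf.expectation (D n) (\<lambda>A. 1 / real n * (\<Sum>i<n. \<bar>?X A i\<bar>)) \<le> \<epsilon> * \<delta>" .
    have "measure_pmf.prob (D n) {A. \<not> 1 / real n * (\<Sum>i<n. \<bar>?X A i\<bar>) \<le> \<delta>} \<le>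
        measure_pmf.expectation (D n) (\<lambda>A. 1 / real n * (\<Sum>i<n. \<bar>?X A i\<bar>)) / \<delta>"
      by (rule Markov[OF \<delta>]) (simp add: sum_nonneg)
    also have "\<dots> \<le> \<epsilon> * \<delta> / \<delta>" using E \<delta> by (intro divide_right_mono) simp_all
    finally show ?case using \<delta> by simp
  qed
qed

text \<open>The products \<open>v n i * v n j\<close> lie in [0, 1] and sum to at most
  \<open>n\<close> by Cauchy-Schwarz against the all-ones vector. Since \<open>v n\<close> is
  deterministic, this is a single functional and no union over vectors arises.\<close>

lemma whp_quadratic_form:
  assumes \<delta>: "\<delta> > 0"
    and v: "\<forall>\<^sub>F n in sequentially. dot n (v n) (v n) = 1 \<and> (\<forall>i<n. 0 \<le> v n i)"
  shows "whp D (\<lambda>n A. \<bar>dot n (v n) (app n (ent A) (v n)) - dot n (v n) (app n (ent (M n)) (v n))\<bar> \<le> \<delta>)"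
  unfolding whp_def
proof (intro allI impI)
  fix \<epsilon> :: real assume \<epsilon>: "\<epsilon> > 0"
  have "\<forall>\<^sub>F n in sequentially. \<forall>W. (\<forall>i<n. \<forall>j<n. 0 \<le> W i j \<and> W i j \<le> 1) \<longrightarrow>
      (\<Sum>i<n. \<Sum>j<n. W i j) \<le> 1 * real n \<longrightarrow>
      measure_pmf.expectation (D n) (\<lambda>A. \<bar>wsum n W A - wsum n W (M n)\<bar>) \<le> \<epsilon> * \<delta>"
    using \<epsilon> \<delta> by (intro expectation_abs) auto
  then show "\<forall>\<^sub>F n in sequentially. measure_pmf.prob (D n)
      {A. \<not> \<bar>dot n (v n) (app n (ent A) (v n)) - dot n (v n) (app n (ent (M n)) (v n))\<bar> \<le> \<delta>} \<le> \<epsilon>"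
    using v
  proof eventually_elim
    case (elim n)
    let ?W = "\<lambda>i j. v n i * v n j"
    have quad: "wsum n ?W A = dot n (v n) (app n (ent A) (v n))" for A
      by (simp add: wsum_def dot_app)
    have v1: "0 \<le> v n i" "v n i \<le> 1" if "i < n" for i
    proof -
      show "0 \<le> v n i" using elim(2) that by blast
      have "(v n i)\<^sup>2 \<le> dot n (v n) (v n)"
        unfolding dot_def power2_eq_square using that by (intro member_le_sum) auto
      then have "(v n i)\<^sup>2 \<le> 1\<^sup>2" using elim(2) by simp
      then show "v n i \<le> 1" by (rule power2_le_imp_le) simp
    qed
    have W: "0 \<le> ?W i j \<and> ?W i j \<le> 1" if "i < n" "j < n" for i j
      using v1[OF that(1)] v1[OF that(2)] by (simp add: mult_le_one)
    have "(\<Sum>i<n. \<Sum>j<n. ?W i j) = (dot n (v n) (\<lambda>_. 1))\<^sup>2"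
      by (simp add: dot_def power2_eq_square sum_product)
    also have "\<dots> \<le> 1 * real n"
      using dot_Cauchy_Schwarz[of n "v n" "\<lambda>_. 1"] elim(2) by (simp add: dot_def)
    finally have L: "(\<Sum>i<n. \<Sum>j<n. ?W i j) \<le> 1 * real n" .
    have E: "measure_pmf.expectation (D n) (\<lambda>A. \<bar>wsum n ?W A - wsum n ?W (M n)\<bar>) \<le> \<epsilon> * \<delta>"
    proof (rule elim(1)[THEN spec, of ?W, THEN mp, THEN mp, OF _ L])
      show "\<forall>i<n. \<forall>j<n. 0 \<le> ?W i j \<and> ?W i j \<le> 1" by (intro allI impI W)
    qed
    have "measure_pmf.prob (D n) {A. \<not> \<bar>wsum n ?W A - wsum n ?W (M n)\<bar> \<le> \<delta>} \<le>
        measure_pmf.expectation (D n) (\<lambda>A. \<bar>wsum n ?W A - wsum n ?W (M n)\<bar>) / \<delta>"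
      by (rule Markov[OF \<delta>]) simp
    also have "\<dots> \<le> \<epsilon> * \<delta> / \<delta>" using E \<delta> by (intro divide_right_mono) simp_all
    finally show ?case unfolding quad using \<delta> by simp
  qed
qed

text \<open>There are \<open>4 ^ n\<close> pairs of vertex sets; with \<open>B = n\<close> each
  fails with probability at most \<open>exp (- c * d n) ^ n\<close>, and \<open>d n\<close> tends to
  infinity.\<close>

lemma whp_discrepancy:
  assumes \<delta>: "\<delta> > 0"
  shows "whp D (\<lambda>n A. \<forall>S T. S \<subseteq> {..<n} \<longrightarrow> T \<subseteq> {..<n} \<longrightarrow>
    (\<Sum>i\<in>S. \<Sum>j\<in>T. A $$ (i, j) - M n $$ (i, j)) \<le> \<delta> * real n)"
proof -
  obtain c where c: "c > 0" and t: "\<forall>\<^sub>F n in sequentially. \<forall>W B. (\<forall>i<n. \<forall>j<n. 0 \<le> W i j \<and> W i j \<le> 1) \<longrightarrow> 0 \<le> B \<longrightarrow>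
      (\<Sum>i<n. \<Sum>j<n. W i j) \<le> B * real n \<longrightarrow>
      measure_pmf.prob (D n) {A. \<delta> * B \<le> wsum n W A - wsum n W (M n)} \<le> exp (- c * d n * B)"
    by (rule tail[OF \<delta>])
  have q0: "(\<lambda>n. 4 * exp (- c * d n)) \<longlonglongrightarrow> 4 * 0"
  proof (intro tendsto_mult tendsto_const)
    have "filterlim (\<lambda>n. - (c * d n)) at_bot sequentially"
      using filterlim_tendsto_pos_mult_at_top[OF tendsto_const c d_top]
      by (simp add: filterlim_uminus_at_bot)
    then show "(\<lambda>n. exp (- c * d n)) \<longlonglongrightarrow> 0"
      using filterlim_compose[OF exp_at_bot] by simp
  qed
  show ?thesis
  proof (rule whpI)
    show "(\<lambda>n. 4 * exp (- c * d n)) \<longlonglongrightarrow> 0" using q0 by simp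
    have "\<forall>\<^sub>F n in sequentially. 4 * exp (- c * d n) < 1"
      using order_tendstoD(2)[OF q0, of 1] by simp
    then show "\<forall>\<^sub>F n in sequentially. measure_pmf.prob (D n) {A. \<not> (\<forall>S T. S \<subseteq> {..<n} \<longrightarrow> T \<subseteq> {..<n} \<longrightarrow>
        (\<Sum>i\<in>S. \<Sum>j\<in>T. A $$ (i, j) - M n $$ (i, j)) \<le> \<delta> * real n)} \<le> 4 * exp (- c * d n)"
      using t eventually_gt_at_top[of 0]
    proof eventually_elim
      case (elim n)
      let ?q = "exp (- c * d n)"
      let ?bad = "\<lambda>ST. {A. \<not> ((\<Sum>i\<in>fst ST. \<Sum>j\<in>snd ST. A $$ (i, j) - M n $$ (i, j)) \<le> \<delta> * real n)}"
      let ?I = "Pow {..<n} \<times> Pow {..<n}"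
      have b: "measure_pmf.prob (D n) (?bad ST) \<le> ?q ^ n" if "ST \<in> ?I" for ST
      proof -
        obtain S T where ST: "ST = (S, T)" "S \<subseteq> {..<n}" "T \<subseteq> {..<n}" using \<open>ST \<in> ?I\<close> by auto
        let ?W = "\<lambda>i j. if i \<in> S \<and> j \<in> T then 1 else (0::real)"
        have "real (card S) * real (card T) \<le> real n * real n"
          using card_mono[OF _ ST(2)] card_mono[OF _ ST(3)] by (intro mult_mono) simp_all
        then have L: "(\<Sum>i<n. \<Sum>j<n. ?W i j) \<le> real n * real n"
          using wsum_block_total[OF ST(2,3)] by simp
        have "measure_pmf.prob (D n) (?bad ST) \<le>
            measure_pmf.prob (D n) {A. \<delta> * real n \<le> wsum n ?W A - wsum n ?W (M n)}"
          unfolding wsum_block[OF ST(2,3)] ST(1) fst_conv snd_conv sum_subtractf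
          by (intro measure_pmf.finite_measure_mono) auto
        also have "\<dots> \<le> exp (- c * d n * real n)"
          by (rule elim(2)[THEN spec, of ?W, THEN spec, of "real n", THEN mp, THEN mp, THEN mp, OF _ _ L]) simp_all
        also have "\<dots> = ?q ^ n" by (simp add: exp_of_nat_mult[symmetric] mult.commute)
        finally show ?thesis .
      qed
      have "{A. \<not> (\<forall>S T. S \<subseteq> {..<n} \<longrightarrow> T \<subseteq> {..<n} \<longrightarrow>
          (\<Sum>i\<in>S. \<Sum>j\<in>T. A $$ (i, j) - M n $$ (i, j)) \<le> \<delta> * real n)} = (\<Union>ST\<in>?I. ?bad ST)"
        by fastforce
      then have "measure_pmf.prob (D n) {A. \<not> (\<forall>S T. S \<subseteq> {..<n} \<longrightarrow> T \<subseteq> {..<n} \<longrightarrow>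
          (\<Sum>i\<in>S. \<Sum>j\<in>T. A $$ (i, j) - M n $$ (i, j)) \<le> \<delta> * real n)} \<le> (\<Sum>ST\<in>?I. measure_pmf.prob (D n) (?bad ST))"
        using measure_pmf.finite_measure_subadditive_finite[of ?I ?bad "D n"] by simp
      also have "\<dots> \<le> (\<Sum>ST\<in>?I. ?q ^ n)" by (rule sum_mono[OF b])
      also have "\<dots> = (4 * ?q) ^ n"
      proof -
        have "(2::real) ^ n * 2 ^ n = 4 ^ n" by (simp add: power_mult_distrib[symmetric])
        then show ?thesis by (simp add: card_Pow power_mult_distrib)
      qed
      also have "\<dots> \<le> (4 * ?q) ^ 1" using elim(1,3) by (intro power_decreasing) simp_all
      finally show ?case by simp
    qed
  qed
qed

text \<open>On at most \<open>\<eta> * n\<close> vertices the mean uses up at most half of the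
  bound, because the entries of \<open>M n\<close> are at most \<open>K / n\<close>. The deviation
  fails with probability at most \<open>q ^ card S\<close>; over nonempty sets this sums to at most
  \<open>(1 + q) ^ n - 1 \<le> exp (n * q) - 1\<close>.\<close>

lemma whp_sparse:
  assumes \<delta>: "\<delta> > 0" and \<eta>: "\<eta> > 0" "K * \<eta> \<le> \<delta> / 2"
  shows "whp D (\<lambda>n A. \<forall>S. S \<subseteq> {..<n} \<longrightarrow> real (card S) \<le> \<eta> * real n \<longrightarrow>
    (\<Sum>i\<in>S. \<Sum>j\<in>S. A $$ (i, j)) \<le> \<delta> * real (card S))"
proof -
  obtain c where c: "c > 0" and t: "\<forall>\<^sub>F n in sequentially. \<forall>W B. (\<forall>i<n. \<forall>j<n. 0 \<le> W i j \<and> W i j \<le> 1) \<longrightarrow> 0 \<le> B \<longrightarrow>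
      (\<Sum>i<n. \<Sum>j<n. W i j) \<le> B * real n \<longrightarrow>
      measure_pmf.prob (D n) {A. (\<delta> / 2) * B \<le> wsum n W A - wsum n W (M n)} \<le> exp (- c * d n * B)"
    by (rule tail[of "\<delta> / 2"]) (use \<delta> in simp)
  show ?thesis
  proof (rule whpI)
    have "(\<lambda>n. exp (real n * exp (- c * d n)) - 1) \<longlonglongrightarrow> exp 0 - 1"
      by (intro tendsto_intros d_exp c)
    then show "(\<lambda>n. exp (real n * exp (- c * d n)) - 1) \<longlonglongrightarrow> 0" by simp
    show "\<forall>\<^sub>F n in sequentially. measure_pmf.prob (D n) {A. \<not> (\<forall>S. S \<subseteq> {..<n} \<longrightarrow> real (card S) \<le> \<eta> * real n \<longrightarrow>
        (\<Sum>i\<in>S. \<Sum>j\<in>S. A $$ (i, j)) \<le> \<delta> * real (card S))} \<le> exp (real n * exp (- c * d n)) - 1"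
      using t entry_le eventually_gt_at_top[of 0]
    proof eventually_elim
      case (elim n)
      let ?q = "exp (- c * d n)"
      let ?bad = "\<lambda>S. {A. \<not> (\<Sum>i\<in>S. \<Sum>j\<in>S. A $$ (i, j)) \<le> \<delta> * real (card S)}"
      \<comment> \<open>The empty set satisfies the bound and must be left out, as its term in the
        union bound would be 1.\<close>
      let ?I = "{S. S \<subseteq> {..<n} \<and> S \<noteq> {} \<and> real (card S) \<le> \<eta> * real n}"
      have fin: "finite ?I" by simp
      have b: "measure_pmf.prob (D n) (?bad S) \<le> ?q ^ card S" if "S \<in> ?I" for S
      proof -
        have S: "S \<subseteq> {..<n}" "real (card S) \<le> \<eta> * real n" using that by auto
        let ?W = "\<lambda>i j. if i \<in> S \<and> j \<in> S then 1 else (0::real)"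
        have "real (card S) \<le> real n" using card_mono[OF _ S(1)] by simp
        then have L: "(\<Sum>i<n. \<Sum>j<n. ?W i j) \<le> real (card S) * real n"
          unfolding wsum_block_total[OF S(1) S(1)] by (rule mult_left_mono) simp
        have "(\<Sum>i\<in>S. \<Sum>j\<in>S. M n $$ (i, j)) \<le> (\<Sum>i\<in>S. \<Sum>j\<in>S. K / real n)"
          using elim(2) S(1) by (intro sum_mono) blast
        also have "\<dots> = K / real n * real (card S) * real (card S)" by simp
        also have "\<dots> \<le> K / real n * real (card S) * (\<eta> * real n)"
          using K S(2) by (intro mult_left_mono) simp_all
        also have "\<dots> = K * \<eta> * real (card S)" using elim(3) by simp
        also have "\<dots> \<le> \<delta> / 2 * real (card S)" using \<eta>(2) by (rule mult_right_mono) simp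
        finally have MS: "(\<Sum>i\<in>S. \<Sum>j\<in>S. M n $$ (i, j)) \<le> \<delta> / 2 * real (card S)" .
        have "measure_pmf.prob (D n) (?bad S) \<le>
            measure_pmf.prob (D n) {A. (\<delta> / 2) * real (card S) \<le> wsum n ?W A - wsum n ?W (M n)}"
          unfolding wsum_block[OF S(1) S(1)] using MS
          by (intro measure_pmf.finite_measure_mono) auto
        also have "\<dots> \<le> exp (- c * d n * real (card S))"
          by (rule elim(1)[THEN spec, of ?W, THEN spec, of "real (card S)", THEN mp, THEN mp, THEN mp, OF _ _ L]) simp_all
        also have "\<dots> = ?q ^ card S" by (simp add: exp_of_nat_mult[symmetric] mult.commute)
        finally show ?thesis .
      qed
      have "{A. \<not> (\<forall>S. S \<subseteq> {..<n} \<longrightarrow> real (card S) \<le> \<eta> * real n \<longrightarrow>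
          (\<Sum>i\<in>S. \<Sum>j\<in>S. A $$ (i, j)) \<le> \<delta> * real (card S))} \<subseteq> (\<Union>S\<in>?I. ?bad S)"
      proof
        fix A assume "A \<in> {A. \<not> (\<forall>S. S \<subseteq> {..<n} \<longrightarrow> real (card S) \<le> \<eta> * real n \<longrightarrow>
          (\<Sum>i\<in>S. \<Sum>j\<in>S. A $$ (i, j)) \<le> \<delta> * real (card S))}"
        then obtain S where S: "S \<subseteq> {..<n}" "real (card S) \<le> \<eta> * real n"
          "\<not> (\<Sum>i\<in>S. \<Sum>j\<in>S. A $$ (i, j)) \<le> \<delta> * real (card S)" by auto
        then have "S \<noteq> {}" by auto
        then show "A \<in> (\<Union>S\<in>?I. ?bad S)" using S by blast
      qed
      then have "measure_pmf.prob (D n) {A. \<not> (\<forall>S. S \<subseteq> {..<n} \<longrightarrow> real (card S) \<le> \<eta> * real n \<longrightarrow>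
          (\<Sum>i\<in>S. \<Sum>j\<in>S. A $$ (i, j)) \<le> \<delta> * real (card S))} \<le> measure_pmf.prob (D n) (\<Union>S\<in>?I. ?bad S)"
        by (intro measure_pmf.finite_measure_mono) simp_all
      also have "\<dots> \<le> (\<Sum>S\<in>?I. measure_pmf.prob (D n) (?bad S))"
        by (rule measure_pmf.finite_measure_subadditive_finite[OF fin]) simp
      also have "\<dots> \<le> (\<Sum>S\<in>?I. ?q ^ card S)" by (rule sum_mono[OF b])
      also have "\<dots> \<le> (\<Sum>S\<in>Pow {..<n} - {{}}. ?q ^ card S)"
        by (intro sum_mono2) auto
      also have "\<dots> = (\<Sum>S\<in>Pow {..<n}. ?q ^ card S) - 1"
        by (subst sum_diff) simp_all
      also have "\<dots> = (1 + ?q) ^ n - 1" by (subst sum_Pow_power_card) simp_all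
      also have "\<dots> \<le> exp ?q ^ n - 1"
        using exp_ge_add_one_self[of ?q] by (intro diff_right_mono power_mono) (simp_all add: add_nonneg_nonneg)
      also have "exp ?q ^ n = exp (real n * ?q)" by (rule exp_of_nat_mult[symmetric])
      finally show ?case .
    qed
  qed
qed

end

section \<open>Accuracy of the three centralities\<close>

lemma norm1_vec_diff:
  assumes "b \<in> carrier_vec n"
  shows "norm1_vec (a - b) = (\<Sum>i<n. \<bar>a $ i - b $ i\<bar>)"
proof -
  have "dim_vec b = n" using assms by simp
  then show ?thesis unfolding norm1_vec_def by simp
qed

lemma degree_centrality_index:
  assumes "A \<in> carrier_mat n n" "i < n"
  shows "degree_centrality A $ i = app n (ent A) (\<lambda>_. 1) i"
proof -
  have "degree_centrality A $ i = app n (ent A) (($) (ones n)) i"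
    using assms mult_mat_vec_index[OF assms(1) _ assms(2), of "ones n"]
    by (simp add: degree_centrality_def ones_def del: index_mult_mat_vec)
  also have "app n (ent A) (($) (ones n)) = app n (ent A) (\<lambda>_. 1)"
    by (rule app_cong) (simp add: ones_def)
  finally show ?thesis .
qed

context concentrated
begin

definition accurate :: "centrality_kind \<Rightarrow> real \<Rightarrow> nat \<Rightarrow> real mat \<Rightarrow> bool" where
  "accurate c \<delta> n A \<longleftrightarrow> centrality_defined c A \<and>
     1 / real n * norm1_vec (centrality c A - centrality c (M n)) \<le> \<delta>"

lemma degree_accurate:
  assumes \<delta>: "\<delta> > 0"
  shows "whp D (accurate Degree \<delta>)"
proof (rule whp_mono)
  show "whp D (\<lambda>n A. 1 / real n * (\<Sum>i<n. \<bar>app n (ent A) (\<lambda>_. 1) i - app n (ent (M n)) (\<lambda>_. 1) i\<bar>) \<le> \<delta>)"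
    using \<delta> by (intro whp_rows_average[of 1]) simp_all
  show "\<forall>\<^sub>F n in sequentially. \<forall>A\<in>set_pmf (D n).
     1 / real n * (\<Sum>i<n. \<bar>app n (ent A) (\<lambda>_. 1) i - app n (ent (M n)) (\<lambda>_. 1) i\<bar>) \<le> \<delta> \<longrightarrow> accurate Degree \<delta> n A"
  proof (intro always_eventually allI ballI impI)
    fix n A assume A: "A \<in> set_pmf (D n)"
      and le: "1 / real n * (\<Sum>i<n. \<bar>app n (ent A) (\<lambda>_. 1) i - app n (ent (M n)) (\<lambda>_. 1) i\<bar>) \<le> \<delta>"
    have Ac: "A \<in> carrier_mat n n" using support[OF A] by simp
    have "degree_centrality (M n) \<in> carrier_vec n"
      using M_carrier[of n] by (auto simp: degree_centrality_def ones_def intro: mult_mat_vec_carrier)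
    then have "norm1_vec (degree_centrality A - degree_centrality (M n)) =
        (\<Sum>i<n. \<bar>degree_centrality A $ i - degree_centrality (M n) $ i\<bar>)" by (rule norm1_vec_diff)
    also have "\<dots> = (\<Sum>i<n. \<bar>app n (ent A) (\<lambda>_. 1) i - app n (ent (M n)) (\<lambda>_. 1) i\<bar>)"
      using degree_centrality_index[OF Ac] degree_centrality_index[OF M_carrier] by (intro sum.cong) simp_all
    finally show "accurate Degree \<delta> n A" using le by (simp add: accurate_def)
  qed
qed

lemma katz_accurate:
  assumes \<delta>: "\<delta> > 0" and \<alpha>: "\<alpha> > 0" "\<alpha> * l < 1"
    and lim: "(\<lambda>n. nth_eigenvalue 1 (M n)) \<longlonglongrightarrow> l"
  shows "\<forall>\<^sub>F n in sequentially. centrality_defined (Katz \<alpha>) (M n)"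
    and "whp D (accurate (Katz \<alpha>) \<delta>)"
proof -
  \<comment> \<open>Half of the slack \<open>1 - \<alpha> * l\<close>; the other half absorbs the
    distance of the eigenvalues from their limit.\<close>
  define c where "c = (1 - \<alpha> * l) / 2"
  have c: "c > 0" using \<alpha> by (simp add: c_def)
  have "(\<lambda>n. \<alpha> * nth_eigenvalue 1 (M n)) \<longlonglongrightarrow> \<alpha> * l" by (intro tendsto_intros lim)
  moreover have "\<alpha> * l < 1 - c" using \<alpha> by (simp add: c_def field_simps)
  ultimately have ev: "\<forall>\<^sub>F n in sequentially. \<alpha> * nth_eigenvalue 1 (M n) < 1 - c"
    by (rule order_tendstoD)
  show "\<forall>\<^sub>F n in sequentially. centrality_defined (Katz \<alpha>) (M n)"
    using ev by eventually_elim (use \<alpha> c in simp)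
  define z where "z n i = (\<Sum>k. katz_term n \<alpha> (ent (M n)) k i)" for n i
  define C where "C = 1 + \<alpha> * K / c"
  have C: "C > 0" using \<alpha> K c by (simp add: C_def add_pos_nonneg)
  have z: "\<forall>\<^sub>F n in sequentially. \<forall>i<n. z n i = 1 + \<alpha> * app n (ent (M n)) (z n) i \<and> 1 \<le> z n i \<and> z n i \<le> C"
    using ev entry_le eventually_gt_at_top[of 0]
  proof eventually_elim
    case (elim n)
    have ray: "\<alpha> * dot n f (app n (ent (M n)) f) \<le> (1 - c) * dot n f f" for f
    proof -
      have "dot n f (app n (ent (M n)) f) \<le> nth_eigenvalue 1 (M n) * dot n f f"
        using Rayleigh_nth_eigenvalue_1[OF M_carrier M_sym elim(3)] by metis
      then have "\<alpha> * dot n f (app n (ent (M n)) f) \<le> (\<alpha> * nth_eigenvalue 1 (M n)) * dot n f f"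
        using \<alpha>(1) by (simp add: mult.assoc)
      also have "\<dots> \<le> (1 - c) * dot n f f"
        using elim(1) by (intro mult_right_mono dot_self_nonneg) simp
      finally show ?thesis .
    qed
    have z_fun: "(\<lambda>i. \<Sum>k. katz_term n \<alpha> (ent (M n)) k i) = z n" by (simp add: z_def fun_eq_iff)
    have 1: "z n i = 1 + \<alpha> * app n (ent (M n)) (z n) i" if "i < n" for i
      using katz_series(1)[OF M_nonneg \<alpha>(1) c ray that] by (simp only: z_fun z_def[symmetric])
    have 2: "c\<^sup>2 * dot n (z n) (z n) \<le> real n"
      using katz_series(2)[OF M_nonneg \<alpha>(1) c ray] by (simp only: z_fun)
    have 3: "1 \<le> z n i" if "i < n" for i
      using katz_series(3)[OF M_nonneg \<alpha>(1) c ray that] by (simp only: z_def[symmetric])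
    have 4: "z n i \<le> C" if i: "i < n" for i
      unfolding C_def
    proof (rule katz_sup_bound[OF M_nonneg _ \<alpha>(1) c 2 1 _ i])
      show "M n $$ (i, j) \<le> K / real n" if "i < n" "j < n" for i j using elim(2) that by blast
      show "0 \<le> z n i" if "i < n" for i using 3[OF that] by linarith
    qed
    show ?case using 1 3 4 by blast
  qed
  have zb: "\<forall>\<^sub>F n in sequentially. \<forall>i<n. 0 \<le> z n i \<and> z n i \<le> C"
    using z
  proof eventually_elim
    case (elim n)
    show ?case
    proof (intro allI impI)
      fix i assume "i < n"
      then have "1 \<le> z n i" "z n i \<le> C" using elim by blast+
      then show "0 \<le> z n i \<and> z n i \<le> C" by linarith
    qed
  qed
  let ?X = "\<lambda>n A i. app n (ent A) (z n) i - app n (ent (M n)) (z n) i"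
  \<comment> \<open>Multiplied by \<open>\<alpha>\<close>, this threshold is the
    \<open>1 / 2\<close> of \<open>katz_transfer\<close>; the tolerance in \<open>w2\<close> cancels
    the factor \<open>2 * \<alpha> * C\<close> there.\<close>
  have w1: "whp D (\<lambda>n A. \<forall>i<n. ?X n A i \<le> 1 / (2 * \<alpha>))"
    using \<alpha>(1) by (intro whp_rows[OF C _ zb]) simp
  have w2: "whp D (\<lambda>n A. 1 / real n * (\<Sum>i<n. \<bar>?X n A i\<bar>) \<le> \<delta> / (2 * \<alpha> * C))"
    using \<delta> \<alpha>(1) C by (intro whp_rows_average[OF C _ zb]) simp
  show "whp D (accurate (Katz \<alpha>) \<delta>)"
  proof (rule whp_mono[OF whp_conj[OF w1 w2]])
    show "\<forall>\<^sub>F n in sequentially. \<forall>A\<in>set_pmf (D n). (\<forall>i<n. ?X n A i \<le> 1 / (2 * \<alpha>)) \<and>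
        1 / real n * (\<Sum>i<n. \<bar>?X n A i\<bar>) \<le> \<delta> / (2 * \<alpha> * C) \<longrightarrow> accurate (Katz \<alpha>) \<delta> n A"
      using z eventually_gt_at_top[of 0]
    proof eventually_elim
      case (elim n)
      show ?case
      proof (intro ballI impI, elim conjE)
        fix A assume A: "A \<in> set_pmf (D n)" and up: "\<forall>i<n. ?X n A i \<le> 1 / (2 * \<alpha>)"
          and av: "1 / real n * (\<Sum>i<n. \<bar>?X n A i\<bar>) \<le> \<delta> / (2 * \<alpha> * C)"
        have Ac: "A \<in> carrier_mat n n" and As: "sym_on n (ent A)" and An: "nonneg_on n (ent A)"
          using support[OF A] by blast+
        have z1: "z n i = 1 + \<alpha> * app n (ent (M n)) (z n) i" and z2: "1 \<le> z n i" and z3: "z n i \<le> C" if "i < n" for i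
          using elim(1) that by blast+
        have half: "\<alpha> * ?X n A i \<le> 1 / 2" if "i < n" for i
        proof -
          have "\<alpha> * ?X n A i \<le> \<alpha> * (1 / (2 * \<alpha>))"
            using up that \<alpha>(1) by (intro mult_left_mono) simp_all
          then show ?thesis using \<alpha>(1) by simp
        qed
        have ray: "\<alpha> * dot n f (app n (ent A) f) \<le> (1 - 1 / (2 * C)) * dot n f f" for f
          by (rule katz_transfer(1)[OF As An \<alpha>(1) z1 z2 z3 half])
        have "\<alpha> * nth_eigenvalue 1 A \<le> 1 - 1 / (2 * C)"
          by (rule eigenvalue_1_le_Rayleigh[OF Ac As elim(2) ray])
        also have "\<dots> < 1" using C by simp
        finally have def: "centrality_defined (Katz \<alpha>) A" using \<alpha>(1) by simp
        define y where "y i = (\<Sum>k. katz_term n \<alpha> (ent A) k i)" for i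
        have y_fun: "(\<lambda>i. \<Sum>k. katz_term n \<alpha> (ent A) k i) = y" by (simp add: y_def fun_eq_iff)
        have C2: "1 / (2 * C) > 0" using C by simp
        have y: "y i = 1 + \<alpha> * app n (ent A) y i" if "i < n" for i
          using katz_series(1)[OF An \<alpha>(1) C2 ray that] by (simp only: y_fun y_def[symmetric])
        have "norm1_vec (katz_centrality \<alpha> A - katz_centrality \<alpha> (M n)) =
            (\<Sum>i<n. \<bar>katz_centrality \<alpha> A $ i - katz_centrality \<alpha> (M n) $ i\<bar>)"
          using M_carrier[of n] by (intro norm1_vec_diff) (simp add: katz_centrality_def)
        also have "\<dots> = (\<Sum>i<n. \<bar>y i - z n i\<bar>)"
          by (intro sum.cong refl)
            (simp add: katz_centrality_index[OF Ac] katz_centrality_index[OF M_carrier] y_def z_def)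
        also have "\<dots> \<le> 2 * \<alpha> * C * (\<Sum>i<n. \<bar>?X n A i\<bar>)"
          by (rule katz_transfer(2)[OF As An \<alpha>(1) z1 z2 z3 half y])
        finally have "1 / real n * norm1_vec (katz_centrality \<alpha> A - katz_centrality \<alpha> (M n)) \<le>
            1 / real n * (2 * \<alpha> * C * (\<Sum>i<n. \<bar>?X n A i\<bar>))" by (rule mult_left_mono) simp
        also have "\<dots> = 2 * \<alpha> * C * (1 / real n * (\<Sum>i<n. \<bar>?X n A i\<bar>))" by simp
        also have "\<dots> \<le> 2 * \<alpha> * C * (\<delta> / (2 * \<alpha> * C))"
          using \<alpha>(1) C by (intro mult_left_mono[OF av]) simp
        also have "\<dots> = \<delta>" using \<alpha>(1) C by simp
        finally show "accurate (Katz \<alpha>) \<delta> n A" using def by (simp add: accurate_def)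
      qed
    qed
  qed
qed

lemma eigenvector_accurate:
  assumes \<delta>: "\<delta> > 0" and \<kappa>: "\<kappa> > 0"
    and gap: "\<forall>\<^sub>F n in sequentially. \<kappa> \<le> \<bar>nth_eigenvalue 1 (M n) - nth_eigenvalue 2 (M n)\<bar>"
  shows "\<forall>\<^sub>F n in sequentially. centrality_defined Eigenvector (M n)"
    and "whp D (accurate Eigenvector \<delta>)"
proof -
  have def: "\<forall>\<^sub>F n in sequentially. \<exists>!x. is_dominant_eigenvector (M n) x"
    using gap eventually_ge_at_top[of 2]
  proof eventually_elim
    case (elim n)
    have n0: "n > 0" using elim(2) by simp
    obtain v where v: "top_vector n (M n) v" using ex_top_vector[OF M_carrier M_sym n0 M_nonneg] .
    have v1: "dot n v v = 1" and vev: "\<And>i. i < n \<Longrightarrow> app n (ent (M n)) v i = nth_eigenvalue 1 (M n) * v i"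
      using v by (auto simp: top_vector_def)
    show ?case
    proof (rule ex1_dominant_eigenvector[OF M_carrier M_sym n0 M_nonneg v1])
      fix f assume f: "top_vector n (M n) f"
      then have f1: "dot n f f = 1" and fev: "\<And>i. i < n \<Longrightarrow> app n (ent (M n)) f i = nth_eigenvalue 1 (M n) * f i"
        by (auto simp: top_vector_def)
      have "nth_eigenvalue 1 (M n) = dot n f (\<lambda>i. nth_eigenvalue 1 (M n) * f i)"
        unfolding dot_scale_right f1 by simp
      also have "\<dots> = dot n f (app n (ent (M n)) f)" by (rule dot_cong) (simp_all add: fev)
      \<comment> \<open>For the expectation the gap alone gives closeness: inserting a top vector
        \<open>f\<close> for \<open>w\<close> forces
        \<open>(dot n f v)\<^sup>2 \<ge> 1\<close>.\<close>
      also have "\<dots> \<le> nth_eigenvalue 1 (M n) - \<kappa> / 2 * (1 - (dot n f v)\<^sup>2)"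
        by (rule gap_Rayleigh[OF M_carrier M_sym elim(2) M_nonneg v1 vev \<kappa> elim(1)]) (simp_all add: f1)
      finally have "\<kappa> / 2 * (1 - (dot n f v)\<^sup>2) \<le> 0" by simp
      then have "1 - (dot n f v)\<^sup>2 \<le> 0" using \<kappa> by (simp add: mult_le_0_iff)
      then show "1 / 2 < (dot n f v)\<^sup>2" by simp
    qed
  qed
  then show "\<forall>\<^sub>F n in sequentially. centrality_defined Eigenvector (M n)" by simp
  \<comment> \<open>One top vector representing the centrality of \<open>M n\<close> is chosen for
    each \<open>n\<close>, so that it can serve as a deterministic weight in
    \<open>whp_quadratic_form\<close>.\<close>
  define Q where "Q n f \<longleftrightarrow> top_vector n (M n) f \<and> eigenvector_centrality (M n) \<in> carrier_vec n \<and>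
     (\<forall>i<n. eigenvector_centrality (M n) $ i = sqrt (real n) * f i)" for n f
  define v where "v n = (SOME f. Q n f)" for n
  have Q: "\<forall>\<^sub>F n in sequentially. Q n (v n)"
    using def
  proof eventually_elim
    case (elim n)
    have "\<exists>f. Q n f" unfolding Q_def using eigenvector_centrality_props[OF M_carrier elim] by metis
    then show ?case unfolding v_def by (rule someI_ex)
  qed
  \<comment> \<open>The bound by \<open>\<delta>\<^sup>2 / 2\<close> serves the final error
    \<open>sqrt (2 * e)\<close>; the bound by 1/4 keeps squared overlaps above 1/2, as uniqueness of
    the dominant eigenvector requires.\<close>
  define e where "e = min (\<delta>\<^sup>2 / 2) (1 / 4)"
  have e: "e > 0" "e \<le> 1 / 4" "2 * e \<le> \<delta>\<^sup>2" using \<delta> by (auto simp: e_def min_def)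
  \<comment> \<open>The constants \<open>k\<close>, \<open>s\<close>, \<open>\<eta>\<close>,
    \<open>t\<close> are chosen in this order so that the four error terms of
    \<open>top_vector_overlap\<close> become 1, 1/2, 4 and 1 times \<open>1 / k\<close>. Their sum
    is below \<open>7 / k\<close>, and the prefactor \<open>2 / \<kappa>\<close> produces the 14.
    The size of \<open>\<eta>\<close> is dictated by \<open>whp_sparse\<close>.\<close>
  define k where "k = max 1 (14 / (\<kappa> * e))"
  have k: "k \<ge> 1" "14 / (\<kappa> * e) \<le> k" by (simp_all add: k_def)
  define s where "s = 1 / k\<^sup>2"
  define \<eta> where "\<eta> = s / (2 * K)"
  define t where "t = \<eta> / k ^ 3"
  have pos: "s > 0" "\<eta> > 0" "t > 0" "1 / k > 0" using k K by (simp_all add: s_def \<eta>_def t_def)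
  have K\<eta>: "K * \<eta> \<le> s / 2" using K by (simp add: \<eta>_def)
  have total: "2 / \<kappa> * (1 / k + k * s / 2 + 4 / k + k\<^sup>2 * t / \<eta>) \<le> e"
  proof -
    have "k * s / 2 = 1 / 2 * (1 / k)" using k by (simp add: s_def power2_eq_square)
    moreover have "k\<^sup>2 * t / \<eta> = 1 / k" using k pos by (simp add: t_def power2_eq_square power3_eq_cube)
    moreover have "4 / k = 4 * (1 / k)" by simp
    ultimately have "1 / k + k * s / 2 + 4 / k + k\<^sup>2 * t / \<eta> \<le> 7 * (1 / k)" using pos(4) by linarith
    then have "2 / \<kappa> * (1 / k + k * s / 2 + 4 / k + k\<^sup>2 * t / \<eta>) \<le> 2 / \<kappa> * (7 * (1 / k))"
      using \<kappa> by (intro mult_left_mono) simp_all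
    also have "\<dots> = 14 / (\<kappa> * k)" by simp
    also have "\<dots> \<le> e"
    proof -
      have "14 \<le> k * (\<kappa> * e)" using k(2) \<kappa> e(1) by (simp add: pos_divide_le_eq)
      then show ?thesis using k(1) \<kappa> by (simp add: pos_divide_le_eq mult.commute mult.left_commute)
    qed
    finally show ?thesis .
  qed
  have vQ: "\<forall>\<^sub>F n in sequentially. dot n (v n) (v n) = 1 \<and> (\<forall>i<n. 0 \<le> v n i)"
    using Q by eventually_elim (simp add: Q_def top_vector_def)
  have w1: "whp D (\<lambda>n A. \<bar>dot n (v n) (app n (ent A) (v n)) - dot n (v n) (app n (ent (M n)) (v n))\<bar> \<le> 1 / k)"
    by (rule whp_quadratic_form[OF pos(4) vQ])
  have w2: "whp D (\<lambda>n A. \<forall>i<n. app n (ent A) (\<lambda>_. 1) i - app n (ent (M n)) (\<lambda>_. 1) i \<le> 1)"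
    by (rule whp_rows[of 1]) simp_all
  have w3: "whp D (\<lambda>n A. \<forall>S. S \<subseteq> {..<n} \<longrightarrow> real (card S) \<le> \<eta> * real n \<longrightarrow>
      (\<Sum>i\<in>S. \<Sum>j\<in>S. A $$ (i, j)) \<le> s * real (card S))"
    by (rule whp_sparse[OF pos(1,2) K\<eta>])
  have w4: "whp D (\<lambda>n A. \<forall>S T. S \<subseteq> {..<n} \<longrightarrow> T \<subseteq> {..<n} \<longrightarrow>
      (\<Sum>i\<in>S. \<Sum>j\<in>T. A $$ (i, j) - M n $$ (i, j)) \<le> t * real n)"
    by (rule whp_discrepancy[OF pos(3)])
  show "whp D (accurate Eigenvector \<delta>)"
  proof (rule whp_mono[OF whp_conj[OF whp_conj[OF w1 w2] whp_conj[OF w3 w4]]])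
    show "\<forall>\<^sub>F n in sequentially. \<forall>A\<in>set_pmf (D n).
      (\<bar>dot n (v n) (app n (ent A) (v n)) - dot n (v n) (app n (ent (M n)) (v n))\<bar> \<le> 1 / k \<and>
       (\<forall>i<n. app n (ent A) (\<lambda>_. 1) i - app n (ent (M n)) (\<lambda>_. 1) i \<le> 1)) \<and>
      (\<forall>S. S \<subseteq> {..<n} \<longrightarrow> real (card S) \<le> \<eta> * real n \<longrightarrow> (\<Sum>i\<in>S. \<Sum>j\<in>S. A $$ (i, j)) \<le> s * real (card S)) \<and>
      (\<forall>S T. S \<subseteq> {..<n} \<longrightarrow> T \<subseteq> {..<n} \<longrightarrow> (\<Sum>i\<in>S. \<Sum>j\<in>T. A $$ (i, j) - M n $$ (i, j)) \<le> t * real n)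
      \<longrightarrow> accurate Eigenvector \<delta> n A"
      using Q gap row_le eventually_ge_at_top[of 2]
    proof eventually_elim
      case (elim n)
      show ?case
      proof (intro ballI impI, elim conjE)
        fix A assume A: "A \<in> set_pmf (D n)"
          and a1: "\<bar>dot n (v n) (app n (ent A) (v n)) - dot n (v n) (app n (ent (M n)) (v n))\<bar> \<le> 1 / k"
          and a2: "\<forall>i<n. app n (ent A) (\<lambda>_. 1) i - app n (ent (M n)) (\<lambda>_. 1) i \<le> 1"
          and a3: "\<forall>S. S \<subseteq> {..<n} \<longrightarrow> real (card S) \<le> \<eta> * real n \<longrightarrow> (\<Sum>i\<in>S. \<Sum>j\<in>S. A $$ (i, j)) \<le> s * real (card S)"
          and a4: "\<forall>S T. S \<subseteq> {..<n} \<longrightarrow> T \<subseteq> {..<n} \<longrightarrow> (\<Sum>i\<in>S. \<Sum>j\<in>T. A $$ (i, j) - M n $$ (i, j)) \<le> t * real n"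
        have Ac: "A \<in> carrier_mat n n" and As: "sym_on n (ent A)" and An: "nonneg_on n (ent A)"
          using support[OF A] by blast+
        have n0: "n > 0" using elim(4) by simp
        have v: "top_vector n (M n) (v n)" and cM: "eigenvector_centrality (M n) \<in> carrier_vec n"
          and cMi: "\<And>i. i < n \<Longrightarrow> eigenvector_centrality (M n) $ i = sqrt (real n) * v n i"
          using elim(1) unfolding Q_def by blast+
        have v1: "dot n (v n) (v n) = 1" and vnn: "\<And>i. i < n \<Longrightarrow> 0 \<le> v n i"
          and vev: "\<And>i. i < n \<Longrightarrow> app n (ent (M n)) (v n) i = nth_eigenvalue 1 (M n) * v n i"
          using v by (auto simp: top_vector_def)
        have quad: "nth_eigenvalue 1 (M n) - 1 / k \<le> dot n (v n) (app n (ent A) (v n))"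
        proof -
          have "dot n (v n) (app n (ent (M n)) (v n)) = dot n (v n) (\<lambda>i. nth_eigenvalue 1 (M n) * v n i)"
            by (rule dot_cong) (simp_all add: vev)
          then have "dot n (v n) (app n (ent (M n)) (v n)) = nth_eigenvalue 1 (M n)"
            unfolding dot_scale_right v1 by simp
          then show ?thesis using a1 by linarith
        qed
        have rows: "app n (ent A) (\<lambda>_. 1) i \<le> 2" if "i < n" for i
        proof -
          have "app n (ent A) (\<lambda>_. 1) i - app n (ent (M n)) (\<lambda>_. 1) i \<le> 1" "app n (ent (M n)) (\<lambda>_. 1) i \<le> 1"
            using a2 elim(3) that by blast+
          then show ?thesis by linarith
        qed
        have close: "1 - e \<le> (dot n f (v n))\<^sup>2" if f: "top_vector n A f" for f
        proof -
          have "1 - 2 / \<kappa> * (1 / k + k * s / 2 + 4 / k + k\<^sup>2 * t / \<eta>) \<le> (dot n f (v n))\<^sup>2"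
          proof (rule top_vector_overlap[OF Ac An As M_carrier M_sym M_nonneg elim(4) v f \<kappa> elim(2) k(1) pos(2) quad])
            show "app n (ent A) (\<lambda>_. 1) i \<le> 2" if "i < n" for i by (rule rows[OF that])
            show "(\<Sum>i\<in>S. \<Sum>j\<in>S. A $$ (i, j)) \<le> s * real (card S)"
              if "S \<subseteq> {..<n}" "real (card S) \<le> \<eta> * real n" for S using a3 that by blast
            show "(\<Sum>i\<in>S. \<Sum>j\<in>T. A $$ (i, j) - M n $$ (i, j)) \<le> t * real n"
              if "S \<subseteq> {..<n}" "T \<subseteq> {..<n}" for S T using a4 that by blast
            show "0 \<le> s" using pos(1) by simp
          qed
          then show ?thesis using total by linarith
        qed
        have ex1: "\<exists>!x. is_dominant_eigenvector A x"
        proof (rule ex1_dominant_eigenvector[OF Ac As n0 An v1])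
          fix f assume "top_vector n A f"
          from close[OF this] show "1 / 2 < (dot n f (v n))\<^sup>2" using e(2) by linarith
        qed
        obtain f where f: "top_vector n A f"
          and fi: "\<And>i. i < n \<Longrightarrow> eigenvector_centrality A $ i = sqrt (real n) * f i"
          using eigenvector_centrality_props[OF Ac ex1] by metis
        have f1: "dot n f f = 1" and fnn: "\<And>i. i < n \<Longrightarrow> 0 \<le> f i" using f by (auto simp: top_vector_def)
        have "1 / real n * norm1_vec (eigenvector_centrality A - eigenvector_centrality (M n)) =
            1 / real n * (\<Sum>i<n. \<bar>sqrt (real n) * f i - sqrt (real n) * v n i\<bar>)"
          unfolding norm1_vec_diff[OF cM] by (simp add: fi cMi)
        also have "\<dots> \<le> sqrt (2 * e)"
          by (rule norm1_diff_le[OF f1 v1 n0 dot_nonneg[OF fnn vnn] close[OF f]])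
        also have "\<dots> \<le> \<delta>" using e(3) \<delta> by (simp add: real_le_lsqrt)
        finally show "accurate Eigenvector \<delta> n A" using ex1 by (simp add: accurate_def)
      qed
    qed
  qed
qed

end

section \<open>Sums of independent Bernoulli variables\<close>

text \<open>The Weierstrass product inequality.\<close>

lemma one_minus_sum_le_prod:
  fixes y :: "'a \<Rightarrow> real"
  assumes "finite I" "\<And>k. k \<in> I \<Longrightarrow> 0 \<le> y k \<and> y k \<le> 1"
  shows "1 - (\<Sum>k\<in>I. y k) \<le> (\<Prod>k\<in>I. 1 - y k)"
  using assms
proof (induction I)
  case (insert x F)
  have IH: "1 - (\<Sum>k\<in>F. y k) \<le> (\<Prod>k\<in>F. 1 - y k)" using insert by blast
  have yx: "0 \<le> y x" "y x \<le> 1" using insert.prems[of x] by auto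
  have S: "0 \<le> (\<Sum>k\<in>F. y k)" using insert.prems by (intro sum_nonneg) auto
  have "1 - (y x + (\<Sum>k\<in>F. y k)) \<le> (1 - y x) * (1 - (\<Sum>k\<in>F. y k))"
    using mult_nonneg_nonneg[OF yx(1) S] by (simp add: algebra_simps)
  also have "\<dots> \<le> (1 - y x) * (\<Prod>k\<in>F. 1 - y k)"
    using IH yx by (intro mult_left_mono) auto
  finally show ?case using insert.hyps by simp
qed simp

definition bern :: "'a set \<Rightarrow> ('a \<Rightarrow> real) \<Rightarrow> ('a \<Rightarrow> bool) pmf" where
  "bern I q = Pi_pmf I False (\<lambda>k. bernoulli_pmf (q k))"

lemma finite_set_bern: "finite I \<Longrightarrow> finite (set_pmf (bern I q))"
  unfolding bern_def by (simp add: set_Pi_pmf finite_PiE_dflt)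

lemma expectation_bern:
  assumes "finite I" "k \<in> I" "0 \<le> q k" "q k \<le> 1"
  shows "measure_pmf.expectation (bern I q) (\<lambda>x. of_bool (x k)) = q k"
proof -
  have "measure_pmf.expectation (bern I q) (\<lambda>x. of_bool (x k)) =
      (measure_pmf.expectation (map_pmf (\<lambda>x. x k) (bern I q)) of_bool :: real)" by simp
  also have "map_pmf (\<lambda>x. x k) (bern I q) = bernoulli_pmf (q k)"
    unfolding bern_def using assms by (simp add: Pi_pmf_component)
  finally show ?thesis using assms by simp
qed

lemma expectation_prod_bern:
  fixes f :: "'a \<Rightarrow> bool \<Rightarrow> real"
  assumes "finite I" "\<And>k. k \<in> I \<Longrightarrow> 0 \<le> q k \<and> q k \<le> 1" "\<And>k b. k \<in> I \<Longrightarrow> 0 \<le> f k b"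
  shows "measure_pmf.expectation (bern I q) (\<lambda>x. \<Prod>k\<in>I. f k (x k)) =
    (\<Prod>k\<in>I. q k * f k True + (1 - q k) * f k False)"
proof -
  have "measure_pmf.expectation (bern I q) (\<lambda>x. \<Prod>k\<in>I. f k (x k)) =
      (\<Prod>k\<in>I. measure_pmf.expectation (bernoulli_pmf (q k)) (f k))"
    unfolding bern_def using assms
    by (intro expectation_prod_Pi_pmf) (auto intro!: integrable_measure_pmf_finite)
  also have "\<dots> = (\<Prod>k\<in>I. q k * f k True + (1 - q k) * f k False)"
    using assms(2) by (intro prod.cong refl) (simp add: algebra_simps)
  finally show ?thesis .
qed

text \<open>Factor by factor, with \<open>exp y \<le> 1 + y + y\<^sup>2\<close> for
  \<open>0 \<le> y \<le> 1\<close>. Second moments are bounded by \<open>b\<close> times first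
  moments, so the exponent involves only the mean.\<close>

lemma bern_mgf:
  assumes I: "finite I" and q: "\<And>k. k \<in> I \<Longrightarrow> 0 \<le> q k \<and> q k \<le> 1"
    and a: "\<And>k. k \<in> I \<Longrightarrow> 0 \<le> a k \<and> a k \<le> b" and \<theta>: "0 \<le> \<theta>" "\<theta> * b \<le> 1"
  shows "measure_pmf.expectation (bern I q) (\<lambda>x. exp (\<theta> * (\<Sum>k\<in>I. of_bool (x k) * a k)))
    \<le> exp (\<theta> * (\<Sum>k\<in>I. q k * a k) + \<theta>\<^sup>2 * b * (\<Sum>k\<in>I. q k * a k))"
proof -
  have "measure_pmf.expectation (bern I q) (\<lambda>x. exp (\<theta> * (\<Sum>k\<in>I. of_bool (x k) * a k))) =
      measure_pmf.expectation (bern I q) (\<lambda>x. \<Prod>k\<in>I. exp (\<theta> * (of_bool (x k) * a k)))"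
    by (simp only: sum_distrib_left exp_sum[OF I])
  also have "\<dots> = (\<Prod>k\<in>I. q k * exp (\<theta> * (of_bool True * a k)) + (1 - q k) * exp (\<theta> * (of_bool False * a k)))"
    by (rule expectation_prod_bern[OF I q]) simp_all
  also have "\<dots> \<le> (\<Prod>k\<in>I. exp (\<theta> * (q k * a k) + \<theta>\<^sup>2 * b * (q k * a k)))"
  proof (rule prod_mono)
    fix k assume k: "k \<in> I"
    have qk: "0 \<le> q k" "q k \<le> 1" and ak: "0 \<le> a k" "a k \<le> b" using q[OF k] a[OF k] by auto
    have y: "0 \<le> \<theta> * a k" "\<theta> * a k \<le> 1"
      using \<theta> ak mult_left_mono[OF ak(2) \<theta>(1)] by auto
    have "q k * exp (\<theta> * a k) + (1 - q k) \<le> q k * (1 + \<theta> * a k + (\<theta> * a k)\<^sup>2) + (1 - q k)"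
      using exp_bound[OF y] qk by (intro add_right_mono mult_left_mono) auto
    also have "\<dots> = 1 + (\<theta> * (q k * a k) + \<theta>\<^sup>2 * (q k * a k) * a k)"
      by (simp add: algebra_simps power2_eq_square)
    also have "\<dots> \<le> 1 + (\<theta> * (q k * a k) + \<theta>\<^sup>2 * (q k * a k) * b)"
      using qk ak by (intro add_left_mono mult_left_mono) auto
    also have "\<dots> \<le> exp (\<theta> * (q k * a k) + \<theta>\<^sup>2 * (q k * a k) * b)" by (rule exp_ge_add_one_self)
    finally show "0 \<le> q k * exp (\<theta> * (of_bool True * a k)) + (1 - q k) * exp (\<theta> * (of_bool False * a k)) \<and>
      q k * exp (\<theta> * (of_bool True * a k)) + (1 - q k) * exp (\<theta> * (of_bool False * a k))
        \<le> exp (\<theta> * (q k * a k) + \<theta>\<^sup>2 * b * (q k * a k))"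
      using qk by (simp add: mult.commute mult.left_commute)
  qed
  also have "\<dots> = exp (\<theta> * (\<Sum>k\<in>I. q k * a k) + \<theta>\<^sup>2 * b * (\<Sum>k\<in>I. q k * a k))"
    using I by (simp add: exp_sum[symmetric] sum.distrib sum_distrib_left)
  finally show ?thesis .
qed

text \<open>The product of \<open>1 - x + x\<^sup>2\<close> and \<open>1 + x\<close> is
  \<open>1 + x ^ 3\<close>, and \<open>1 + x \<le> exp x\<close>.\<close>

lemma exp_minus_le: "(x::real) \<ge> 0 \<Longrightarrow> exp (- x) \<le> 1 - x + x\<^sup>2"
proof -
  assume x: "x \<ge> 0"
  have "0 \<le> x * x * x" using x by simp
  then have "1 \<le> (1 - x + x\<^sup>2) * (1 + x)" by (simp add: algebra_simps power2_eq_square)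
  also have "\<dots> \<le> (1 - x + x\<^sup>2) * exp x"
  proof (rule mult_left_mono)
    have "0 \<le> (x - 1 / 2)\<^sup>2" by simp
    then show "0 \<le> 1 - x + x\<^sup>2" by (simp add: power2_eq_square algebra_simps)
  qed (rule exp_ge_add_one_self)
  finally show "exp (- x) \<le> 1 - x + x\<^sup>2" by (simp add: exp_minus field_simps)
qed

text \<open>The truncated sum is at least 1 minus the product of the
  \<open>1 - of_bool (x k) * a k\<close>. The expectation of this product factorizes by independence
  and is at most \<open>exp (- \<mu>)\<close>, so truncation costs only a second-order term.\<close>

lemma bern_min_ge:
  assumes I: "finite I" and q: "\<And>k. k \<in> I \<Longrightarrow> 0 \<le> q k \<and> q k \<le> 1"
    and a: "\<And>k. k \<in> I \<Longrightarrow> 0 \<le> a k \<and> a k \<le> 1"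
  defines "\<mu> \<equiv> \<Sum>k\<in>I. q k * a k"
  shows "\<mu> - \<mu>\<^sup>2 \<le> measure_pmf.expectation (bern I q) (\<lambda>x. min (\<Sum>k\<in>I. of_bool (x k) * a k) 1)"
proof -
  have \<mu>: "\<mu> \<ge> 0" unfolding \<mu>_def using q a by (intro sum_nonneg) auto
  have "measure_pmf.expectation (bern I q) (\<lambda>x. \<Prod>k\<in>I. 1 - of_bool (x k) * a k) =
      (\<Prod>k\<in>I. q k * (1 - of_bool True * a k) + (1 - q k) * (1 - of_bool False * a k))"
    using a by (intro expectation_prod_bern[OF I q]) auto
  also have "\<dots> \<le> (\<Prod>k\<in>I. exp (- (q k * a k)))"
  proof (rule prod_mono)
    fix k assume k: "k \<in> I"
    have qk: "0 \<le> q k" "q k \<le> 1" and ak: "0 \<le> a k" "a k \<le> 1" using q[OF k] a[OF k] by auto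
    have "q k * (1 - a k) + (1 - q k) = 1 + - (q k * a k)" by (simp add: algebra_simps)
    also have "\<dots> \<le> exp (- (q k * a k))" by (rule exp_ge_add_one_self)
    finally show "0 \<le> q k * (1 - of_bool True * a k) + (1 - q k) * (1 - of_bool False * a k) \<and>
        q k * (1 - of_bool True * a k) + (1 - q k) * (1 - of_bool False * a k) \<le> exp (- (q k * a k))"
      using qk ak by simp
  qed
  also have "\<dots> = exp (- \<mu>)" unfolding \<mu>_def using I by (simp add: exp_sum[symmetric] sum_negf)
  also have "\<dots> \<le> 1 - \<mu> + \<mu>\<^sup>2" by (rule exp_minus_le[OF \<mu>])
  finally have "\<mu> - \<mu>\<^sup>2 \<le> 1 - measure_pmf.expectation (bern I q) (\<lambda>x. \<Prod>k\<in>I. 1 - of_bool (x k) * a k)"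
    by simp
  also have "\<dots> = measure_pmf.expectation (bern I q) (\<lambda>x. 1 - (\<Prod>k\<in>I. 1 - of_bool (x k) * a k))"
    by (subst Bochner_Integration.integral_diff)
      (auto intro!: integrable_measure_pmf_finite finite_set_bern I)
  also have "\<dots> \<le> measure_pmf.expectation (bern I q) (\<lambda>x. min (\<Sum>k\<in>I. of_bool (x k) * a k) 1)"
  proof (rule integral_mono)
    fix x :: "'a \<Rightarrow> bool"
    have "1 - (\<Sum>k\<in>I. of_bool (x k) * a k) \<le> (\<Prod>k\<in>I. 1 - of_bool (x k) * a k)"
      using a by (intro one_minus_sum_le_prod I) auto
    moreover have "0 \<le> (\<Prod>k\<in>I. 1 - of_bool (x k) * a k)" using a by (intro prod_nonneg) auto
    ultimately show "1 - (\<Prod>k\<in>I. 1 - of_bool (x k) * a k) \<le> min (\<Sum>k\<in>I. of_bool (x k) * a k) 1" by simp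
  qed (auto intro!: integrable_measure_pmf_finite finite_set_bern I)
  finally show ?thesis .
qed

section \<open>Counting subgraphs\<close>

lemma ordered_lists_finite: "finite (ordered_lists n m)"
  by (rule finite_subset[OF _ finite_lists_length_eq[of "{..<n}" m]]) (auto simp: ordered_lists_def)

text \<open>Such a list is determined by its values at the other \<open>m - 2\<close>
  positions.\<close>

lemma card_lists_two_fixed:
  assumes ab: "a < m" "b < m" "a \<noteq> b"
  shows "card {L \<in> ordered_lists n m. L ! a = i \<and> L ! b = j} \<le> n ^ (m - 2)"
proof -
  let ?S = "{L \<in> ordered_lists n m. L ! a = i \<and> L ! b = j}"
  let ?I = "{..<m} - {a, b}"
  let ?r = "\<lambda>L. restrict (\<lambda>c. L ! c) ?I"
  have "inj_on ?r ?S"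
  proof (rule inj_onI)
    fix L L' assume L: "L \<in> ?S" "L' \<in> ?S" and eq: "?r L = ?r L'"
    show "L = L'"
    proof (rule nth_equalityI)
      show "length L = length L'" using L by (simp add: ordered_lists_def)
      fix c assume "c < length L"
      then have c: "c < m" using L by (simp add: ordered_lists_def)
      show "L ! c = L' ! c"
      proof (cases "c \<in> {a, b}")
        case True
        then show ?thesis using L by auto
      next
        case False
        then show ?thesis using fun_cong[OF eq, of c] c by simp
      qed
    qed
  qed
  moreover have "?r ` ?S \<subseteq> ?I \<rightarrow>\<^sub>E {..<n}"
  proof (rule image_subsetI)
    fix L assume L: "L \<in> ?S"
    have "L ! c \<in> {..<n}" if "c \<in> ?I" for c
      using L that nth_mem[of c L] unfolding ordered_lists_def by blast
    then show "?r L \<in> ?I \<rightarrow>\<^sub>E {..<n}" by (simp only: restrict_PiE_iff) blast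
  qed
  ultimately have "card ?S \<le> card (?I \<rightarrow>\<^sub>E {..<n})"
    by (intro card_inj_on_le) (auto intro!: finite_PiE)
  also have "\<dots> = n ^ card ?I" by (simp add: card_PiE)
  also have "card ?I = m - 2" using ab by (simp add: card_Diff_subset)
  finally show ?thesis .
qed

text \<open>The lists are counted by a falling factorial, all of whose factors are at least
  \<open>n / 2\<close>.\<close>

lemma card_ordered_lists_ge:
  assumes "2 * m \<le> n"
  shows "(real n / 2) ^ m \<le> real (card (ordered_lists n m))"
proof -
  let ?R = "{n - m + 1..n}"
  have "card {xs. length xs = m \<and> distinct xs \<and> set xs \<subseteq> {..<n}} = \<Prod>{card {..<n} - m + 1..card {..<n}}"
    by (rule card_lists_distinct_length_eq) (use assms in simp_all)
  then have "card (ordered_lists n m) = \<Prod>?R" by (simp only: ordered_lists_def card_lessThan)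
  then have "real (card (ordered_lists n m)) = (\<Prod>i\<in>?R. real i)" by (simp only: of_nat_prod)
  moreover have "(real n / 2) ^ m = (\<Prod>i\<in>?R. real n / 2)"
  proof -
    have "card ?R = m" using assms by simp
    then show ?thesis by (simp only: prod_constant)
  qed
  moreover have "(\<Prod>i\<in>?R. real n / 2) \<le> (\<Prod>i\<in>?R. real i)"
  proof (rule prod_mono)
    fix i assume "i \<in> ?R"
    then have "n - m + 1 \<le> i" by simp
    then have "n \<le> 2 * i" using assms by linarith
    then have "real n \<le> 2 * real i" by linarith
    then show "0 \<le> real n / 2 \<and> real n / 2 \<le> real i" by simp
  qed
  ultimately show ?thesis by (simp only:)
qed

lemma subgraph_adj_index:
  assumes "i < n" "j < n"
  shows "subgraph_adj n t L $$ (i, j) =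
    of_bool (\<exists>a < fst t. \<exists>b < fst t. {a, b} \<in> snd t \<and> L ! a = i \<and> L ! b = j)"
  using assms by (simp add: subgraph_adj_def)

lemma subgraph_adj_commute:
  assumes "i < n" "j < n"
  shows "subgraph_adj n t L $$ (i, j) = subgraph_adj n t L $$ (j, i)"
proof -
  have "(\<exists>a < fst t. \<exists>b < fst t. {a, b} \<in> snd t \<and> L ! a = i \<and> L ! b = j) \<longleftrightarrow>
      (\<exists>a < fst t. \<exists>b < fst t. {a, b} \<in> snd t \<and> L ! a = j \<and> L ! b = i)"
  proof -
    have "{a, b} \<in> snd t \<longleftrightarrow> {b, a} \<in> snd t" for a b by (simp only: insert_commute)
    then show ?thesis by blast
  qed
  then show ?thesis using assms by (simp only: subgraph_adj_index)
qed

text \<open>Union over the pairs of positions that carry the edge; the positions differ because an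
  edge of a type has two distinct ends.\<close>

lemma card_subgraph_adj_le:
  assumes t: "nonempty_graph t"
  shows "card {L \<in> ordered_lists n (fst t). \<exists>a < fst t. \<exists>b < fst t. {a, b} \<in> snd t \<and> L ! a = i \<and> L ! b = j}
    \<le> (fst t)\<^sup>2 * n ^ (fst t - 2)"
proof -
  let ?m = "fst t"
  let ?P = "{ab \<in> {..<?m} \<times> {..<?m}. fst ab \<noteq> snd ab}"
  let ?F = "\<lambda>ab. {L \<in> ordered_lists n ?m. L ! fst ab = i \<and> L ! snd ab = j}"
  have ne: "a \<noteq> b" if "{a, b} \<in> snd t" for a b
  proof -
    have "{a, b} \<in> {{a, b} | a b. a < fst t \<and> b < fst t \<and> a \<noteq> b}"
      using t that unfolding nonempty_graph_def by blast
    then obtain a' b' where "{a, b} = {a', b'}" "a' \<noteq> b'" by blast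
    then show ?thesis unfolding doubleton_eq_iff by blast
  qed
  have sub: "{L \<in> ordered_lists n ?m. \<exists>a < ?m. \<exists>b < ?m. {a, b} \<in> snd t \<and> L ! a = i \<and> L ! b = j} \<subseteq> (\<Union>ab\<in>?P. ?F ab)"
  proof
    fix L assume "L \<in> {L \<in> ordered_lists n ?m. \<exists>a < ?m. \<exists>b < ?m. {a, b} \<in> snd t \<and> L ! a = i \<and> L ! b = j}"
    then obtain a b where ab: "a < ?m" "b < ?m" "{a, b} \<in> snd t" and L: "L \<in> ordered_lists n ?m" "L ! a = i" "L ! b = j"
      by blast
    have "(a, b) \<in> ?P" using ab ne[OF ab(3)] by simp
    moreover have "L \<in> ?F (a, b)" using L by simp
    ultimately show "L \<in> (\<Union>ab\<in>?P. ?F ab)" by (rule UN_I)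
  qed
  have finP: "finite ?P" by simp
  have "card {L \<in> ordered_lists n ?m. \<exists>a < ?m. \<exists>b < ?m. {a, b} \<in> snd t \<and> L ! a = i \<and> L ! b = j} \<le> card (\<Union>ab\<in>?P. ?F ab)"
    using finP ordered_lists_finite by (intro card_mono[OF _ sub]) auto
  also have "\<dots> \<le> (\<Sum>ab\<in>?P. card (?F ab))" by (rule card_UN_le[OF finP])
  also have "\<dots> \<le> (\<Sum>ab\<in>?P. n ^ (?m - 2))"
    by (intro sum_mono card_lists_two_fixed) auto
  also have "\<dots> \<le> (\<Sum>ab\<in>{..<?m} \<times> {..<?m}. n ^ (?m - 2))" by (intro sum_mono2) auto
  finally show ?thesis by (simp add: power2_eq_square)
qed

text \<open>Every nonzero entry comes from a pair of positions. This bounds the influence of a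
  single indicator in the Chernoff estimate.\<close>

lemma sum_subgraph_adj_le:
  assumes W: "\<And>i j. i < n \<Longrightarrow> j < n \<Longrightarrow> 0 \<le> W i j \<and> W i j \<le> 1"
  shows "(\<Sum>i<n. \<Sum>j<n. subgraph_adj n t L $$ (i, j) * W i j) \<le> (real (fst t))\<^sup>2"
proof -
  let ?E = "{ij \<in> {..<n} \<times> {..<n}. \<exists>a < fst t. \<exists>b < fst t. {a, b} \<in> snd t \<and> L ! a = fst ij \<and> L ! b = snd ij}"
  have "?E \<subseteq> (\<lambda>(a, b). (L ! a, L ! b)) ` ({..<fst t} \<times> {..<fst t})" by force
  then have "card ?E \<le> card ((\<lambda>(a, b). (L ! a, L ! b)) ` ({..<fst t} \<times> {..<fst t}))"
    by (intro card_mono) auto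
  also have "\<dots> \<le> card ({..<fst t} \<times> {..<fst t})" by (rule card_image_le) simp
  finally have cE: "card ?E \<le> (fst t)\<^sup>2" by (simp add: power2_eq_square)
  have "(\<Sum>i<n. \<Sum>j<n. subgraph_adj n t L $$ (i, j) * W i j) =
      (\<Sum>ij\<in>{..<n} \<times> {..<n}. subgraph_adj n t L $$ ij * W (fst ij) (snd ij))"
    by (simp add: sum.cartesian_product case_prod_unfold)
  also have "\<dots> \<le> (\<Sum>ij\<in>{..<n} \<times> {..<n}. if ij \<in> ?E then 1 else 0)"
  proof (rule sum_mono)
    fix ij assume "ij \<in> {..<n} \<times> {..<n}"
    then obtain i j where ij: "ij = (i, j)" "i < n" "j < n" by auto
    show "subgraph_adj n t L $$ ij * W (fst ij) (snd ij) \<le> (if ij \<in> ?E then 1 else 0)"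
    proof -
      have "subgraph_adj n t L $$ ij = of_bool (ij \<in> ?E)"
        unfolding ij(1) using ij(2,3) by (subst subgraph_adj_index) simp_all
      then show ?thesis using W[OF ij(2,3)] ij(1) by (cases "ij \<in> ?E") (simp_all only: of_bool_eq if_True if_False mult_1 mult_zero_left fst_conv snd_conv)
    qed
  qed
  also have "\<dots> = real (card ?E)" by (subst sum.inter_filter[symmetric]) simp_all
  also have "\<dots> \<le> real ((fst t)\<^sup>2)" using cE by (simp only: of_nat_le_iff)
  finally show ?thesis by simp
qed

text \<open>A type has an edge, so every generated subgraph adds to the total degree; this feeds the
  lower bound on expected degrees.\<close>

lemma sum_subgraph_adj_ge:
  assumes t: "nonempty_graph t" and L: "L \<in> ordered_lists n (fst t)"
  shows "1 \<le> (\<Sum>i<n. \<Sum>j<n. subgraph_adj n t L $$ (i, j))"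
proof -
  obtain a b where ab: "a < fst t" "b < fst t" "{a, b} \<in> snd t"
    using t unfolding nonempty_graph_def by blast
  have "L ! a \<in> set L" "L ! b \<in> set L" using ab L by (auto simp: ordered_lists_def)
  then have n: "L ! a < n" "L ! b < n" using L by (auto simp: ordered_lists_def)
  have nn: "0 \<le> subgraph_adj n t L $$ (i, j)" if "i < n" "j < n" for i j
    using that by (simp add: subgraph_adj_index)
  have "1 = subgraph_adj n t L $$ (L ! a, L ! b)" using ab n by (auto simp: subgraph_adj_index)
  also have "\<dots> \<le> (\<Sum>j<n. subgraph_adj n t L $$ (L ! a, j))"
    using n nn by (intro member_le_sum) auto
  also have "\<dots> \<le> (\<Sum>i<n. \<Sum>j<n. subgraph_adj n t L $$ (i, j))"
    using n nn by (intro member_le_sum[of _ _ "\<lambda>i. \<Sum>j<n. subgraph_adj n t L $$ (i, j)"] sum_nonneg) auto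
  finally show ?thesis .
qed

section \<open>The subgraph generated models\<close>

text \<open>\<open>\<phi>\<close> is the identity for the weighted and truncation at 1 for the unweighted model.\<close>

locale subgraph_model =
  fixes T :: "sg_type set" and p :: "nat \<Rightarrow> sg_type \<Rightarrow> nat list \<Rightarrow> real"
    and h l u \<xi> :: "sg_type \<Rightarrow> real" and \<phi> :: "real \<Rightarrow> real"
  assumes T: "finite T" "T \<noteq> {}" "\<And>t. t \<in> T \<Longrightarrow> nonempty_graph t"
    and p01: "\<And>n t L. t \<in> T \<Longrightarrow> L \<in> ordered_lists n (fst t) \<Longrightarrow> 0 \<le> p n t L \<and> p n t L \<le> 1"
    and h: "\<And>t. t \<in> T \<Longrightarrow> real (fst t) - 2 < h t \<and> h t < real (fst t) - 1"
    and lu: "\<And>t. t \<in> T \<Longrightarrow> 0 < l t \<and> l t < u t"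
    and p: "\<And>n t L. t \<in> T \<Longrightarrow> L \<in> ordered_lists n (fst t) \<Longrightarrow>
      p n t L = 0 \<or> (\<exists>b\<in>{l t..u t}. p n t L = b / real n powr h t)"
    and \<xi>: "\<And>t. t \<in> T \<Longrightarrow> 0 < \<xi> t"
    and many: "\<And>n t. t \<in> T \<Longrightarrow> \<xi> t * real (card (ordered_lists n (fst t)))
      \<le> real (card {L \<in> ordered_lists n (fst t). p n t L > 0})"
    and \<phi>: "\<phi> = (\<lambda>a. a) \<or> \<phi> = (\<lambda>a. min a 1)"
begin

definition I :: "nat \<Rightarrow> (sg_type \<times> nat list) set" where
  "I n = (SIGMA t:T. ordered_lists n (fst t))"

definition q :: "nat \<Rightarrow> sg_type \<times> nat list \<Rightarrow> real" where
  "q n k = p n (fst k) (snd k)"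

definition adj :: "nat \<Rightarrow> sg_type \<times> nat list \<Rightarrow> nat \<Rightarrow> nat \<Rightarrow> real" where
  "adj n k i j = subgraph_adj n (fst k) (snd k) $$ (i, j)"

definition mult :: "nat \<Rightarrow> (sg_type \<times> nat list \<Rightarrow> bool) \<Rightarrow> nat \<Rightarrow> nat \<Rightarrow> real" where
  "mult n x i j = (\<Sum>k\<in>I n. of_bool (x k) * adj n k i j)"

text \<open>The expectation in the weighted model even when \<open>\<phi>\<close> truncates;
  \<open>EG\<close> is the one of the model at hand.\<close>

definition mu :: "nat \<Rightarrow> nat \<Rightarrow> nat \<Rightarrow> real" where
  "mu n i j = (\<Sum>k\<in>I n. q n k * adj n k i j)"

definition G :: "nat \<Rightarrow> real mat pmf" where
  "G n = map_pmf (\<lambda>x. mat n n (\<lambda>(i, j). \<phi> (mult n x i j))) (bern (I n) (q n))"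

text \<open>\<open>d n\<close> is the order of magnitude of the expected degrees; a subgraph of type \<open>t\<close> is expected to
  meet a given node about \<open>n powr (m\<^sub>t - 1 - h\<^sub>t)\<close> times.\<close>

definition d :: "nat \<Rightarrow> real" where
  "d n = (\<Sum>t\<in>T. real n powr (real (fst t) - 1 - h t))"

definition U :: real where "U = (\<Sum>t\<in>T. u t * (real (fst t))\<^sup>2)"

definition EG :: "nat \<Rightarrow> nat \<Rightarrow> nat \<Rightarrow> real" where
  "EG n i j = measure_pmf.expectation (bern (I n) (q n)) (\<lambda>x. \<phi> (mult n x i j))"

section \<open>Expected multiplicities and expected degrees\<close>

lemma finite_I: "finite (I n)"
  unfolding I_def using T(1) ordered_lists_finite by (intro finite_SigmaI)

lemma q01: "k \<in> I n \<Longrightarrow> 0 \<le> q n k \<and> q n k \<le> 1"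
  using p01 by (auto simp: I_def q_def)

lemma integrable_bern: "integrable (measure_pmf (bern (I n) (q n))) (f :: _ \<Rightarrow> real)"
  by (rule integrable_measure_pmf_finite[OF finite_set_bern[OF finite_I]])

lemma sum_I: "(\<Sum>k\<in>I n. f k) = (\<Sum>t\<in>T. \<Sum>L\<in>ordered_lists n (fst t). f (t, L))"
  unfolding I_def using T(1) ordered_lists_finite by (subst sum.Sigma) (auto simp: case_prod_unfold)

lemma indicators_eq: "indicators n T (p n) = bern (I n) (q n)"
  unfolding indicators_def bern_def I_def q_def by (simp add: case_prod_unfold)

lemma wSUGM_eq: "wSUGM n T (p n) = map_pmf (\<lambda>x. mat n n (\<lambda>(i, j). mult n x i j)) (bern (I n) (q n))"
proof -
  have "(\<lambda>x. mat n n (\<lambda>ij. \<Sum>t\<in>T. \<Sum>L\<in>ordered_lists n (fst t). of_bool (x (t, L)) * subgraph_adj n t L $$ ij)) =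
      (\<lambda>x. mat n n (\<lambda>(i, j). mult n x i j))"
    by (intro ext cong_mat refl) (simp add: mult_def sum_I adj_def)
  then show ?thesis unfolding wSUGM_def indicators_eq by simp
qed

lemma adj01: "i < n \<Longrightarrow> j < n \<Longrightarrow> 0 \<le> adj n k i j \<and> adj n k i j \<le> 1"
  by (simp add: adj_def subgraph_adj_index)

lemma adj_commute: "i < n \<Longrightarrow> j < n \<Longrightarrow> adj n k i j = adj n k j i"
  unfolding adj_def by (rule subgraph_adj_commute)

lemma mult_nonneg: "i < n \<Longrightarrow> j < n \<Longrightarrow> 0 \<le> mult n x i j"
  unfolding mult_def using adj01 by (intro sum_nonneg mult_nonneg_nonneg) auto

lemma mu_nonneg: "i < n \<Longrightarrow> j < n \<Longrightarrow> 0 \<le> mu n i j"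
  unfolding mu_def using adj01 q01 by (intro sum_nonneg mult_nonneg_nonneg) auto

lemma phi: "0 \<le> a \<Longrightarrow> 0 \<le> \<phi> a" "\<phi> a \<le> a"
  using \<phi> by auto

lemma expectation_mult: "measure_pmf.expectation (bern (I n) (q n)) (\<lambda>x. mult n x i j) = mu n i j"
  unfolding mult_def mu_def
  by (subst Bochner_Integration.integral_sum)
    (simp_all add: integrable_bern expectation_bern[OF finite_I] q01)

lemma EG_nonneg: "i < n \<Longrightarrow> j < n \<Longrightarrow> 0 \<le> EG n i j"
  unfolding EG_def by (intro Bochner_Integration.integral_nonneg phi mult_nonneg)

lemma EG_le: "EG n i j \<le> mu n i j"
  unfolding EG_def expectation_mult[symmetric] by (intro integral_mono integrable_bern phi)

text \<open>For the truncated model this is \<open>bern_min_ge\<close>; the identity lies above the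
  truncation, so one bound serves both models.\<close>

lemma EG_ge:
  assumes ij: "i < n" "j < n"
  shows "mu n i j - (mu n i j)\<^sup>2 \<le> EG n i j"
proof -
  have "mu n i j - (mu n i j)\<^sup>2 \<le> measure_pmf.expectation (bern (I n) (q n)) (\<lambda>x. min (mult n x i j) 1)"
    unfolding mu_def mult_def using adj01[OF ij] q01 by (intro bern_min_ge finite_I) auto
  also have "\<dots> \<le> EG n i j"
    unfolding EG_def using \<phi> by (intro integral_mono integrable_bern) auto
  finally show ?thesis .
qed

lemma two_le: "t \<in> T \<Longrightarrow> 2 \<le> fst t"
proof -
  assume "t \<in> T"
  then obtain e where "e \<in> snd t" "snd t \<subseteq> {{a, b} | a b. a < fst t \<and> b < fst t \<and> a \<noteq> b}"
    using T(3)[of t] unfolding nonempty_graph_def by blast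
  then obtain a b where "a < fst t" "b < fst t" "a \<noteq> b" by blast
  then show "2 \<le> fst t" by linarith
qed

lemma d_ge: "t \<in> T \<Longrightarrow> real n powr (real (fst t) - 1 - h t) \<le> d n"
  unfolding d_def
  by (rule member_le_sum[of t T "\<lambda>t. real n powr (real (fst t) - 1 - h t)"]) (simp_all add: T(1))

text \<open>At most \<open>m\<^sup>2 * n ^ (m - 2)\<close> lists put an edge of a type on a given
  pair, each with probability at most \<open>u t / n powr h t\<close>. The product is a constant,
  collected in \<open>U\<close>, times \<open>n powr (m - 1 - h t) / n\<close>.\<close>

lemma mu_le:
  assumes n: "n > 0" and ij: "i < n" "j < n"
  shows "mu n i j \<le> U * d n / real n"
proof -
  have "mu n i j = (\<Sum>t\<in>T. \<Sum>L\<in>ordered_lists n (fst t). p n t L * subgraph_adj n t L $$ (i, j))"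
    unfolding mu_def sum_I by (simp add: q_def adj_def)
  also have "\<dots> \<le> (\<Sum>t\<in>T. u t * (real (fst t))\<^sup>2 * (d n / real n))"
  proof (rule sum_mono)
    fix t assume t: "t \<in> T"
    let ?m = "fst t"
    let ?S = "{L \<in> ordered_lists n ?m. \<exists>a < ?m. \<exists>b < ?m. {a, b} \<in> snd t \<and> L ! a = i \<and> L ! b = j}"
    have u0: "0 \<le> u t" using lu[OF t] by simp
    have pu: "p n t L \<le> u t / real n powr h t" if L: "L \<in> ordered_lists n ?m" for L
    proof -
      from p[OF t L] show ?thesis
      proof (elim disjE bexE)
        assume "p n t L = 0"
        then show ?thesis using u0 by simp
      next
        fix b assume "b \<in> {l t..u t}" "p n t L = b / real n powr h t"
        then show ?thesis by (simp add: divide_right_mono)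
      qed
    qed
    have "(\<Sum>L\<in>ordered_lists n ?m. p n t L * subgraph_adj n t L $$ (i, j)) \<le>
        (\<Sum>L\<in>ordered_lists n ?m. u t / real n powr h t * (if L \<in> ?S then 1 else 0))"
    proof (rule sum_mono)
      fix L assume L: "L \<in> ordered_lists n ?m"
      have "L \<in> ?S \<longleftrightarrow> (\<exists>a < ?m. \<exists>b < ?m. {a, b} \<in> snd t \<and> L ! a = i \<and> L ! b = j)"
        using L by blast
      then have "subgraph_adj n t L $$ (i, j) = of_bool (L \<in> ?S)"
        by (simp only: subgraph_adj_index[OF ij])
      then show "p n t L * subgraph_adj n t L $$ (i, j) \<le> u t / real n powr h t * (if L \<in> ?S then 1 else 0)"
        using pu[OF L] by (cases "L \<in> ?S")
          (simp_all only: of_bool_eq if_True if_False mult_1_right mult_zero_right order_refl)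
    qed
    also have "\<dots> = u t / real n powr h t * (\<Sum>L\<in>ordered_lists n ?m. if L \<in> ?S then 1 else 0)"
      by (rule sum_distrib_left[symmetric])
    also have "(\<Sum>L\<in>ordered_lists n ?m. if L \<in> ?S then 1 else (0::real)) = real (card ?S)"
      using ordered_lists_finite[of n ?m] by (subst sum.inter_filter[symmetric]) simp_all
    also have "u t / real n powr h t * real (card ?S) \<le> u t / real n powr h t * real (?m\<^sup>2 * n ^ (?m - 2))"
      using u0 card_subgraph_adj_le[OF T(3)[OF t], of n i j] by (intro mult_left_mono of_nat_mono) auto
    also have "real (?m\<^sup>2 * n ^ (?m - 2)) = (real ?m)\<^sup>2 * real n powr (real ?m - 2)"
    proof -
      have "real ?m - 2 = real (?m - 2)" using two_le[OF t] by (simp add: of_nat_diff)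
      then have "real n powr (real ?m - 2) = real n ^ (?m - 2)" using n by (simp only: powr_realpow of_nat_0_less_iff)
      then show ?thesis by simp
    qed
    also have "u t / real n powr h t * ((real ?m)\<^sup>2 * real n powr (real ?m - 2)) =
        u t * (real ?m)\<^sup>2 * (real n powr (real ?m - 2) / real n powr h t)" by simp
    also have "real n powr (real ?m - 2) / real n powr h t = real n powr (real ?m - 1 - h t) / real n"
    proof -
      have "real n powr (real ?m - 1 - h t) / real n = real n powr (real ?m - 1 - h t) / real n powr 1"
        using n by simp
      then show ?thesis by (simp only: powr_diff[symmetric]) (simp add: algebra_simps)
    qed
    also have "u t * (real ?m)\<^sup>2 * (real n powr (real ?m - 1 - h t) / real n) \<le> u t * (real ?m)\<^sup>2 * (d n / real n)"
      using u0 d_ge[OF t] by (intro mult_left_mono divide_right_mono) simp_all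
    finally show "(\<Sum>L\<in>ordered_lists n ?m. p n t L * subgraph_adj n t L $$ (i, j)) \<le>
      u t * (real ?m)\<^sup>2 * (d n / real n)" .
  qed
  also have "\<dots> = U * d n / real n" unfolding U_def times_divide_eq_right[symmetric] by (rule sum_distrib_right[symmetric])
  finally show ?thesis .
qed

text \<open>The constant of \<open>sum_mu_ge\<close>: a share \<open>\<xi> t\<close> of at least
  \<open>(n / 2) ^ m\<close> lists has probability at least \<open>l t / n powr h t\<close>. With
  the minimum over the types, the sum over types reproduces \<open>d n\<close>.\<close>

definition c0 :: real where "c0 = Min ((\<lambda>t. \<xi> t * l t / 2 ^ fst t) ` T)"

lemma c0_pos: "c0 > 0"
  unfolding c0_def using T(1,2) \<xi> lu by (subst Min_gr_iff) auto

lemma c0_le: "t \<in> T \<Longrightarrow> c0 \<le> \<xi> t * l t / 2 ^ fst t"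
  unfolding c0_def using T(1) by (intro Min_le) auto

lemma sum_mu_ge: "\<forall>\<^sub>F n in sequentially. c0 * real n * d n \<le> (\<Sum>i<n. \<Sum>j<n. mu n i j)"
proof -
  have "\<forall>\<^sub>F n in sequentially. \<forall>t\<in>T. 2 * fst t \<le> n"
    using T(1) by (intro eventually_ball_finite ballI eventually_ge_at_top)
  then show ?thesis using eventually_gt_at_top[of 0]
  proof eventually_elim
    case (elim n)
    have n: "n > 0" by fact
    have "c0 * real n * d n = (\<Sum>t\<in>T. c0 * real n * real n powr (real (fst t) - 1 - h t))"
      by (simp add: d_def sum_distrib_left)
    also have "\<dots> \<le> (\<Sum>t\<in>T. \<Sum>L\<in>ordered_lists n (fst t). p n t L)"
    proof (rule sum_mono)
      fix t assume t: "t \<in> T"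
      let ?m = "fst t"
      let ?N = "real n powr h t"
      let ?S = "{L \<in> ordered_lists n ?m. p n t L > 0}"
      have l0: "0 < l t" and x0: "0 < \<xi> t" using lu[OF t] \<xi>[OF t] by auto
      have "real n * real n powr (real ?m - 1 - h t) = real n powr (real ?m) / ?N"
      proof -
        have "real n * real n powr (real ?m - 1 - h t) = real n powr 1 * real n powr (real ?m - 1 - h t)"
          using n by simp
        also have "\<dots> = real n powr (real ?m - h t)" by (simp only: powr_add[symmetric]) (simp add: algebra_simps)
        finally show ?thesis by (simp only: powr_diff)
      qed
      then have "c0 * real n * real n powr (real ?m - 1 - h t) = c0 * (real n ^ ?m / ?N)"
        using n by (simp add: powr_realpow mult.assoc)
      also have "\<dots> \<le> \<xi> t * l t / 2 ^ ?m * (real n ^ ?m / ?N)"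
        using c0_le[OF t] by (intro mult_right_mono) simp_all
      also have "\<dots> = l t / ?N * (\<xi> t * (real n / 2) ^ ?m)"
        by (simp add: power_divide mult.commute mult.left_commute)
      also have "\<dots> \<le> l t / ?N * (\<xi> t * real (card (ordered_lists n ?m)))"
        using card_ordered_lists_ge[of ?m n] elim(1) t l0 x0 by (intro mult_left_mono) simp_all
      also have "\<dots> \<le> l t / ?N * real (card ?S)"
        using many[OF t] l0 by (intro mult_left_mono) simp_all
      also have "\<dots> = (\<Sum>L\<in>?S. l t / ?N)" by simp
      also have "\<dots> \<le> (\<Sum>L\<in>?S. p n t L)"
      proof (rule sum_mono)
        fix L assume L: "L \<in> ?S"
        then obtain b where "b \<in> {l t..u t}" "p n t L = b / ?N" using p[OF t, of L n] by auto
        then show "l t / ?N \<le> p n t L" by (simp add: divide_right_mono)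
      qed
      also have "\<dots> \<le> (\<Sum>L\<in>ordered_lists n ?m. p n t L)"
        using p01[OF t] ordered_lists_finite by (intro sum_mono2) auto
      finally show "c0 * real n * real n powr (real ?m - 1 - h t) \<le> (\<Sum>L\<in>ordered_lists n ?m. p n t L)" .
    qed
    also have "\<dots> = (\<Sum>k\<in>I n. q n k)" unfolding sum_I by (simp add: q_def)
    also have "\<dots> \<le> (\<Sum>k\<in>I n. q n k * (\<Sum>i<n. \<Sum>j<n. adj n k i j))"
    proof (rule sum_mono)
      fix k assume k: "k \<in> I n"
      then have "1 \<le> (\<Sum>i<n. \<Sum>j<n. adj n k i j)"
        unfolding adj_def using T(3) by (intro sum_subgraph_adj_ge) (auto simp: I_def)
      from mult_left_mono[OF this] show "q n k \<le> q n k * (\<Sum>i<n. \<Sum>j<n. adj n k i j)"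
        using q01[OF k] by simp
    qed
    also have "\<dots> = (\<Sum>k\<in>I n. \<Sum>i<n. \<Sum>j<n. q n k * adj n k i j)" by (simp add: sum_distrib_left)
    also have "\<dots> = (\<Sum>i<n. \<Sum>k\<in>I n. \<Sum>j<n. q n k * adj n k i j)" by (rule sum.swap)
    also have "\<dots> = (\<Sum>i<n. \<Sum>j<n. mu n i j)"
      unfolding mu_def by (intro sum.cong refl) (rule sum.swap)
    finally show ?case .
  qed
qed

lemma U_pos: "U > 0"
proof -
  have "0 < u t * (real (fst t))\<^sup>2" if "t \<in> T" for t
    using lu[OF that] two_le[OF that] by simp
  then show ?thesis unfolding U_def using T(1,2) by (intro sum_pos)
qed

text \<open>The lower bound on \<open>h t\<close> puts all exponents in \<open>d\<close> below
  1.\<close>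

lemma d_over_n: "(\<lambda>n. d n / real n) \<longlonglongrightarrow> 0"
proof -
  have "(\<lambda>n. real n powr (real (fst t) - 1 - h t) / real n) \<longlonglongrightarrow> 0" if t: "t \<in> T" for t
  proof -
    define e where "e = real (fst t) - 1 - h t"
    have "e < 1" using h[OF t] by (simp add: e_def)
    then have "(\<lambda>n. real n powr e / real n) \<longlonglongrightarrow> 0" by real_asymp
    then show ?thesis by (simp add: e_def)
  qed
  then have "(\<lambda>n. \<Sum>t\<in>T. real n powr (real (fst t) - 1 - h t) / real n) \<longlonglongrightarrow> (\<Sum>t\<in>T. 0)"
    by (intro tendsto_sum)
  then show ?thesis by (simp add: d_def sum_divide_distrib)
qed

text \<open>The upper bound on \<open>h t\<close> makes the exponents positive; one type already
  gives the polynomial growth behind the union bounds.\<close>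

lemma ex_exponent: obtains e where "e > 0" "\<And>n. real n powr e \<le> d n"
proof -
  obtain t where t: "t \<in> T" using T(2) by blast
  have "real (fst t) - 1 - h t > 0" using h[OF t] by simp
  then show ?thesis using d_ge[OF t] that by blast
qed

lemma d_at_top: "filterlim d at_top sequentially"
proof -
  obtain e where e: "e > 0" "\<And>n. real n powr e \<le> d n" using ex_exponent by blast
  have "filterlim (\<lambda>n::nat. real n powr e) at_top sequentially" using e(1) by real_asymp
  then show ?thesis by (rule filterlim_at_top_mono) (simp add: e(2))
qed

lemma d_exp_decay:
  assumes c: "c > 0"
  shows "(\<lambda>n. real n * exp (- c * d n)) \<longlonglongrightarrow> 0"
proof -
  obtain e where e: "e > 0" "\<And>n. real n powr e \<le> d n" using ex_exponent by blast
  have lim: "(\<lambda>n::nat. real n * exp (- c * real n powr e)) \<longlonglongrightarrow> 0" using e(1) c by real_asymp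
  show ?thesis
  proof (rule tendsto_sandwich[OF _ _ tendsto_const lim])
    show "\<forall>\<^sub>F n in sequentially. 0 \<le> real n * exp (- c * d n)" by simp
    show "\<forall>\<^sub>F n in sequentially. real n * exp (- c * d n) \<le> real n * exp (- c * real n powr e)"
      using e(2) c by (intro always_eventually allI mult_left_mono) simp_all
  qed
qed

section \<open>Normalization and exponential moments of the models\<close>

definition \<Delta> :: "nat \<Rightarrow> real" where "\<Delta> n = max_expected_degree n (G n)"

definition D :: "nat \<Rightarrow> real mat pmf" where "D n = normalized n (G n)"

text \<open>Bounds the influence of one indicator, of whatever type, on a functional with weights in
  [0, 1].\<close>

definition b :: real where "b = (\<Sum>t\<in>T. (real (fst t))\<^sup>2)"

text \<open>The other half of \<open>c0\<close> covers the truncation loss in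
  \<open>Delta_ge\<close>.\<close>

definition c1 :: real where "c1 = c0 / 2"

text \<open>The summands meet three demands: the admissible range of \<open>\<theta>\<close>, the
  quadratic term of the exponent, and the bound on the entries of the mean.\<close>

definition K :: real where "K = b / c1 + b * U / c1\<^sup>2 + U / c1"

text \<open>Truncation costs at most \<open>(U * d n / n)\<^sup>2\<close> per entry; division by
  \<open>c1 * d n\<close>, a lower bound for \<open>\<Delta> n\<close>, and extraction of one factor
  \<open>1 / n\<close> leave this.\<close>

definition g :: "nat \<Rightarrow> real" where "g n = U\<^sup>2 / c1 * (d n / real n)"

lemma G_eq_wSUGM: "\<phi> = (\<lambda>a. a) \<Longrightarrow> G n = wSUGM n T (p n)"
  unfolding G_def wSUGM_eq by (simp only:)

lemma G_eq_uSUGM: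
  assumes "\<phi> = (\<lambda>a. min a 1)"
  shows "G n = uSUGM n T (p n)"
proof -
  have "map_mat (\<lambda>a. min a 1) (mat n n (\<lambda>(i, j). mult n x i j)) = mat n n (\<lambda>(i, j). \<phi> (mult n x i j))" for x
    unfolding assms by (rule eq_matI) simp_all
  then show ?thesis unfolding uSUGM_def wSUGM_eq G_def by (simp add: pmf.map_comp o_def)
qed

lemma expected_mat_G:
  assumes "i < n" "j < n"
  shows "expected_mat n (G n) $$ (i, j) = EG n i j"
  using assms by (simp add: expected_mat_def G_def EG_def)

lemma D_eq: "D n = map_pmf (\<lambda>x. (1 / \<Delta> n) \<cdot>\<^sub>m mat n n (\<lambda>(i, j). \<phi> (mult n x i j))) (bern (I n) (q n))"
proof -
  have "D n = map_pmf (\<lambda>A. (1 / \<Delta> n) \<cdot>\<^sub>m A) (G n)" unfolding D_def normalized_def \<Delta>_def ..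
  then show ?thesis unfolding G_def by (simp only: pmf.map_comp o_def)
qed

lemma expected_mat_D:
  assumes "i < n" "j < n"
  shows "expected_mat n (D n) $$ (i, j) = EG n i j / \<Delta> n"
  using assms by (simp add: expected_mat_def D_eq EG_def)

lemma row_le_Delta:
  assumes i: "i < n"
  shows "(\<Sum>j<n. EG n i j) \<le> \<Delta> n"
proof -
  let ?E = "expected_mat n (G n)"
  have dims: "dim_row ?E = n" "dim_col ?E = n" by (simp_all add: expected_mat_def)
  have "(\<Sum>j<n. EG n i j) = (\<Sum>j<n. \<bar>?E $$ (i, j)\<bar>)"
    using EG_nonneg[OF i] by (intro sum.cong refl) (simp add: expected_mat_G[OF i])
  also have "\<dots> \<le> Max ((\<lambda>i. \<Sum>j<n. \<bar>?E $$ (i, j)\<bar>) ` {..<n})"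
    using i by (intro Max_ge) auto
  finally show ?thesis unfolding \<Delta>_def max_expected_degree_def inf_norm_mat_def dims .
qed

lemma c1_pos: "c1 > 0"
  using c0_pos by (simp add: c1_def)

lemma d_nonneg: "0 \<le> d n"
  unfolding d_def by (intro sum_nonneg) simp

text \<open>The maximal row sum is at least the average one. The total of \<open>mu\<close> is at
  least \<open>c0 * n * d n\<close>, while the total of its squares is at most of order
  \<open>(d n)\<^sup>2\<close>, which is smaller because \<open>d n / n\<close> tends to 0.\<close>

lemma Delta_ge: "\<forall>\<^sub>F n in sequentially. c1 * d n \<le> \<Delta> n"
proof -
  have "(\<lambda>n. U\<^sup>2 * (d n / real n)) \<longlonglongrightarrow> U\<^sup>2 * 0" by (intro tendsto_intros d_over_n)
  then have "\<forall>\<^sub>F n in sequentially. U\<^sup>2 * (d n / real n) < c1"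
    using order_tendstoD(2)[of _ "U\<^sup>2 * 0" sequentially c1] c1_pos by simp
  then show ?thesis using sum_mu_ge eventually_gt_at_top[of 0]
  proof eventually_elim
    case (elim n)
    have n: "real n > 0" using elim(3) by simp
    have "(\<Sum>i<n. \<Sum>j<n. (mu n i j)\<^sup>2) \<le> (\<Sum>i<n. \<Sum>j<n. (U * d n / real n)\<^sup>2)"
      using mu_le[OF elim(3)] mu_nonneg by (intro sum_mono power_mono) simp_all
    also have "\<dots> = real n * real n * (U * d n / real n)\<^sup>2" by simp
    also have "\<dots> = real n * d n * (U\<^sup>2 * (d n / real n))" using n by (simp add: power2_eq_square)
    also have "\<dots> \<le> real n * d n * c1"
      using elim(1) d_nonneg by (intro mult_left_mono) simp_all
    finally have sq: "(\<Sum>i<n. \<Sum>j<n. (mu n i j)\<^sup>2) \<le> real n * d n * c1" .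
    have "real n * (c1 * d n) = c0 * real n * d n - real n * d n * c1" by (simp add: c1_def)
    also have "\<dots> \<le> (\<Sum>i<n. \<Sum>j<n. mu n i j) - (\<Sum>i<n. \<Sum>j<n. (mu n i j)\<^sup>2)"
      using elim(2) sq by (rule diff_mono)
    also have "\<dots> = (\<Sum>i<n. \<Sum>j<n. mu n i j - (mu n i j)\<^sup>2)" by (simp add: sum_subtractf)
    also have "\<dots> \<le> (\<Sum>i<n. \<Sum>j<n. EG n i j)" by (intro sum_mono EG_ge) simp_all
    also have "\<dots> \<le> (\<Sum>i<n. \<Delta> n)" by (intro sum_mono row_le_Delta) simp
    also have "\<dots> = real n * \<Delta> n" by simp
    finally show ?case using n by (simp only: mult_le_cancel_left_pos)
  qed
qed

lemma D_support:
  assumes "A \<in> set_pmf (D n)" "0 \<le> \<Delta> n"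
  shows "A \<in> carrier_mat n n \<and> sym_on n (ent A) \<and> nonneg_on n (ent A)"
proof -
  obtain x where A: "A = (1 / \<Delta> n) \<cdot>\<^sub>m mat n n (\<lambda>(i, j). \<phi> (mult n x i j))"
    using assms(1) unfolding D_eq set_map_pmf by blast
  have e: "A $$ (i, j) = 1 / \<Delta> n * \<phi> (mult n x i j)" if "i < n" "j < n" for i j
    unfolding A using that by simp
  have "mult n x i j = mult n x j i" if "i < n" "j < n" for i j
    unfolding mult_def using adj_commute[OF that] by simp
  then have "sym_on n (ent A)" unfolding sym_on_def using e by simp
  moreover have "nonneg_on n (ent A)"
    unfolding nonneg_on_def using e phi(1)[OF mult_nonneg] assms(2) by simp
  ultimately show ?thesis unfolding A by simp
qed

lemma Delta_nonneg: "n > 0 \<Longrightarrow> 0 \<le> \<Delta> n"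
  using row_le_Delta[of 0 n] sum_nonneg[of "{..<n}" "EG n 0"] EG_nonneg[of 0 n] by force

lemma b_ge: "t \<in> T \<Longrightarrow> (real (fst t))\<^sup>2 \<le> b"
  unfolding b_def by (rule member_le_sum[of t T "\<lambda>t. (real (fst t))\<^sup>2"]) (simp_all add: T(1))

lemma b_nonneg: "0 \<le> b" unfolding b_def by (simp add: sum_nonneg)

lemma K_ge: "b / c1 \<le> K" "b * U / c1\<^sup>2 \<le> K" "U / c1 \<le> K" "K > 0"
proof -
  have "0 \<le> b / c1" "0 \<le> b * U / c1\<^sup>2" "0 < U / c1"
    using b_nonneg U_pos c1_pos by simp_all
  then show "b / c1 \<le> K" "b * U / c1\<^sup>2 \<le> K" "U / c1 \<le> K" "K > 0" unfolding K_def by linarith+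
qed

text \<open>The deviation lies below a sum of independent variables minus its mean plus a
  deterministic shift: the random part by dropping the truncation, the mean by \<open>EG_ge\<close>
  with total loss \<open>S\<close>. Then \<open>bern_mgf\<close> applies, and the bounds on
  \<open>\<mu>\<close> and \<open>S\<close> in terms of \<open>r\<close> give the two terms of the
  exponent.\<close>

lemma model_mgf:
  assumes n: "n > 0" and dn: "d n > 0" and ge: "c1 * d n \<le> \<Delta> n"
    and W: "\<And>i j. i < n \<Longrightarrow> j < n \<Longrightarrow> 0 \<le> W i j \<and> W i j \<le> 1" and \<theta>: "0 \<le> \<theta>" "K * \<theta> \<le> d n"
  shows "measure_pmf.expectation (D n) (\<lambda>A. exp (\<theta> * (wsum n W A - wsum n W (expected_mat n (D n)))))
    \<le> exp (\<theta>\<^sup>2 * K * (\<Sum>i<n. \<Sum>j<n. W i j) / (real n * d n) + \<theta> * g n * (\<Sum>i<n. \<Sum>j<n. W i j) / real n)"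
proof -
  let ?A = "\<lambda>x. (1 / \<Delta> n) \<cdot>\<^sub>m mat n n (\<lambda>(i, j). \<phi> (mult n x i j))" and ?M = "expected_mat n (D n)"
  let ?L = "\<Sum>i<n. \<Sum>j<n. W i j"
  let ?E = "measure_pmf.expectation (bern (I n) (q n))"
  have \<Delta>: "\<Delta> n > 0" using ge mult_pos_pos[OF c1_pos dn] by linarith
  have W0: "0 \<le> W i j" if "i < n" "j < n" for i j using W[OF that] by blast
  have L0: "0 \<le> ?L" using W0 by (intro sum_nonneg) simp_all
  define r where "r = U * d n / real n"
  have r0: "0 \<le> r" using U_pos dn by (simp add: r_def)
  \<comment> \<open>The normalization moves from the matrix into the parameter, which becomes of
    order at most \<open>\<theta> / d n\<close>.\<close>
  define \<theta>' where "\<theta>' = \<theta> / \<Delta> n"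
  have \<theta>'0: "0 \<le> \<theta>'" using \<theta>(1) \<Delta> by (simp add: \<theta>'_def)
  have \<theta>'_le: "\<theta>' \<le> \<theta> / (c1 * d n)"
    unfolding \<theta>'_def using ge \<theta>(1) c1_pos dn \<Delta> by (intro divide_left_mono) simp_all
  define a where "a k = (\<Sum>i<n. \<Sum>j<n. adj n k i j * W i j)" for k
  define \<mu> where "\<mu> = (\<Sum>k\<in>I n. q n k * a k)"
  define S where "S = (\<Sum>i<n. \<Sum>j<n. (mu n i j)\<^sup>2 * W i j)"
  have a: "0 \<le> a k \<and> a k \<le> b" if k: "k \<in> I n" for k
  proof
    show "0 \<le> a k" unfolding a_def using adj01 W0 by (intro sum_nonneg mult_nonneg_nonneg) simp_all
    have "a k \<le> (real (fst (fst k)))\<^sup>2"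
      unfolding a_def adj_def by (rule sum_subgraph_adj_le[OF W])
    also have "\<dots> \<le> b" using k by (intro b_ge) (auto simp: I_def)
    finally show "a k \<le> b" .
  qed
  \<comment> \<open>Summation by subgraphs instead of by entries: entries that share a subgraph are
    dependent, but each \<open>a k\<close> is multiplied by its own independent indicator.\<close>
  have Z: "(\<Sum>i<n. \<Sum>j<n. (\<Sum>k\<in>I n. f k * adj n k i j) * W i j) = (\<Sum>k\<in>I n. f k * a k)" for f
  proof -
    have "(\<Sum>i<n. \<Sum>j<n. (\<Sum>k\<in>I n. f k * adj n k i j) * W i j) =
        (\<Sum>i<n. \<Sum>j<n. \<Sum>k\<in>I n. f k * (adj n k i j * W i j))"
      by (simp add: sum_distrib_right mult.assoc)
    also have "\<dots> = (\<Sum>i<n. \<Sum>k\<in>I n. \<Sum>j<n. f k * (adj n k i j * W i j))"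
      by (intro sum.cong refl sum.swap)
    also have "\<dots> = (\<Sum>k\<in>I n. \<Sum>i<n. \<Sum>j<n. f k * (adj n k i j * W i j))" by (rule sum.swap)
    finally show ?thesis by (simp add: a_def sum_distrib_left)
  qed
  have \<mu>_le: "\<mu> \<le> r * ?L"
  proof -
    have "\<mu> = (\<Sum>i<n. \<Sum>j<n. mu n i j * W i j)" unfolding \<mu>_def mu_def by (rule Z[symmetric])
    also have "\<dots> \<le> (\<Sum>i<n. \<Sum>j<n. r * W i j)"
      unfolding r_def using mu_le[OF n] W0 by (intro sum_mono mult_right_mono) simp_all
    finally show ?thesis by (simp add: sum_distrib_left)
  qed
  have S_le: "S \<le> r\<^sup>2 * ?L"
  proof -
    have "S \<le> (\<Sum>i<n. \<Sum>j<n. r\<^sup>2 * W i j)"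
      unfolding S_def r_def using mu_le[OF n] mu_nonneg W0 by (intro sum_mono mult_right_mono power_mono) simp_all
    then show ?thesis by (simp add: sum_distrib_left)
  qed
  have wM: "wsum n W ?M = (1 / \<Delta> n) * (\<Sum>i<n. \<Sum>j<n. EG n i j * W i j)"
    unfolding wsum_def by (simp add: expected_mat_D sum_distrib_left)
  have "\<mu> - S = (\<Sum>i<n. \<Sum>j<n. (mu n i j - (mu n i j)\<^sup>2) * W i j)"
  proof -
    have "\<mu> = (\<Sum>i<n. \<Sum>j<n. mu n i j * W i j)" unfolding \<mu>_def mu_def by (rule Z[symmetric])
    then show ?thesis unfolding S_def by (simp only: left_diff_distrib sum_subtractf)
  qed
  also have "\<dots> \<le> (\<Sum>i<n. \<Sum>j<n. EG n i j * W i j)"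
    using EG_ge W0 by (intro sum_mono mult_right_mono) simp_all
  finally have EGW: "\<mu> - S \<le> (\<Sum>i<n. \<Sum>j<n. EG n i j * W i j)" .
  have le: "\<theta> * (wsum n W (?A x) - wsum n W ?M)
      \<le> (\<theta>' * S - \<theta>' * \<mu>) + \<theta>' * (\<Sum>k\<in>I n. of_bool (x k) * a k)" for x
  proof -
    have "wsum n W (?A x) =
        (1 / \<Delta> n) * (\<Sum>i<n. \<Sum>j<n. \<phi> (mult n x i j) * W i j)"
      unfolding wsum_def by (simp add: sum_distrib_left)
    then have "\<theta> * (wsum n W (?A x) - wsum n W ?M)
        = \<theta>' * ((\<Sum>i<n. \<Sum>j<n. \<phi> (mult n x i j) * W i j) - (\<Sum>i<n. \<Sum>j<n. EG n i j * W i j))"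
      unfolding wM \<theta>'_def by (simp add: right_diff_distrib)
    also have "\<dots> \<le> \<theta>' * ((\<Sum>i<n. \<Sum>j<n. mult n x i j * W i j) - (\<mu> - S))"
      using phi(2) W0 by (intro mult_left_mono[OF _ \<theta>'0] diff_mono EGW sum_mono mult_right_mono) simp_all
    also have "(\<Sum>i<n. \<Sum>j<n. mult n x i j * W i j) = (\<Sum>k\<in>I n. of_bool (x k) * a k)"
      unfolding mult_def by (rule Z)
    finally show ?thesis by (simp add: algebra_simps)
  qed
  have "measure_pmf.expectation (D n) (\<lambda>A. exp (\<theta> * (wsum n W A - wsum n W ?M))) =
      ?E (\<lambda>x. exp (\<theta> * (wsum n W (?A x) - wsum n W ?M)))"
    by (subst (1) D_eq) simp
  also have "\<dots> \<le> ?E (\<lambda>x. exp ((\<theta>' * S - \<theta>' * \<mu>) + \<theta>' * (\<Sum>k\<in>I n. of_bool (x k) * a k)))"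
    using le by (intro integral_mono integrable_bern) simp
  also have "\<dots> = exp (\<theta>' * S - \<theta>' * \<mu>) * ?E (\<lambda>x. exp (\<theta>' * (\<Sum>k\<in>I n. of_bool (x k) * a k)))"
    by (simp only: exp_add) simp
  also have "\<dots> \<le> exp (\<theta>' * S - \<theta>' * \<mu>) * exp (\<theta>' * \<mu> + \<theta>'\<^sup>2 * b * \<mu>)"
    unfolding \<mu>_def
  proof (intro mult_left_mono bern_mgf finite_I q01 a \<theta>'0)
    \<comment> \<open>The range \<open>K * \<theta> \<le> d n\<close> ensures that no single
      indicator contributes more than 1 to the exponent.\<close>
    have "\<theta>' * b \<le> \<theta> / (c1 * d n) * b" using \<theta>'_le b_nonneg by (rule mult_right_mono)
    also have "\<dots> = b / c1 * \<theta> / d n" by simp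
    also have "\<dots> \<le> K * \<theta> / d n"
      using K_ge(1) \<theta>(1) dn by (intro divide_right_mono mult_right_mono) simp_all
    also have "\<dots> \<le> 1" using \<theta>(2) dn by (simp add: pos_divide_le_eq)
    finally show "\<theta>' * b \<le> 1" .
  qed simp_all
  also have "\<dots> = exp (\<theta>'\<^sup>2 * b * \<mu> + \<theta>' * S)" by (simp add: exp_add[symmetric])
  also have "\<dots> \<le> exp (\<theta>\<^sup>2 * K * ?L / (real n * d n) + \<theta> * g n * ?L / real n)"
  proof (subst exp_le_cancel_iff, rule add_mono)
    have "\<theta>'\<^sup>2 * b * \<mu> \<le> \<theta>'\<^sup>2 * b * (r * ?L)" using b_nonneg \<mu>_le by (intro mult_left_mono) simp_all
    also have "\<dots> \<le> (\<theta> / (c1 * d n))\<^sup>2 * b * (r * ?L)"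
      using \<theta>'_le \<theta>'0 b_nonneg r0 L0 by (intro mult_right_mono power_mono) simp_all
    also have "\<dots> = \<theta>\<^sup>2 * (b * U / c1\<^sup>2) * ?L / (real n * d n)"
      using dn by (simp add: r_def power_divide power_mult_distrib) (simp add: power2_eq_square mult_ac)
    also have "\<dots> \<le> \<theta>\<^sup>2 * K * ?L / (real n * d n)"
      using K_ge(2) L0 dn by (intro divide_right_mono mult_right_mono mult_left_mono) simp_all
    finally show "\<theta>'\<^sup>2 * b * \<mu> \<le> \<theta>\<^sup>2 * K * ?L / (real n * d n)" .
    have "\<theta>' * S \<le> \<theta>' * (r\<^sup>2 * ?L)" using \<theta>'0 S_le by (intro mult_left_mono)
    also have "\<dots> \<le> \<theta> / (c1 * d n) * (r\<^sup>2 * ?L)"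
      using \<theta>'_le L0 by (intro mult_right_mono) simp_all
    also have "\<dots> = \<theta> * g n * ?L / real n"
      using dn by (simp add: r_def g_def power_divide power_mult_distrib) (simp add: power2_eq_square mult_ac)
    finally show "\<theta>' * S \<le> \<theta> * g n * ?L / real n" .
  qed
  finally show ?thesis .
qed

lemma concentrated_model: "concentrated D (\<lambda>n. expected_mat n (D n)) K d g"
proof
  fix n A
  show "finite (set_pmf (D n))" unfolding D_eq by (simp add: finite_set_bern finite_I)
  assume "A \<in> set_pmf (D n)"
  \<comment> \<open>For \<open>n = 0\<close> the norm is a maximum over the empty set, so the sign
    of \<open>\<Delta> 0\<close> is unknown; the claims about entries are then vacuous.\<close>
  moreover have "A \<in> carrier_mat n n \<and> sym_on n (ent A) \<and> nonneg_on n (ent A)"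
    if "A \<in> set_pmf (D n)" "n = 0"
    using that unfolding D_eq by (auto simp: sym_on_def nonneg_on_def)
  ultimately show "A \<in> carrier_mat n n \<and> sym_on n (ent A) \<and> nonneg_on n (ent A)"
    using D_support[of A n] Delta_nonneg[of n] by (cases "n = 0") simp_all
next
  show "expected_mat n (D n) = expected_mat n (D n)" for n by (rule refl)
  show "K > 0" by (rule K_ge)
  have dpos: "\<forall>\<^sub>F n in sequentially. d n > 0" using d_at_top by (simp add: filterlim_at_top_dense)
  show "\<forall>\<^sub>F n in sequentially. \<forall>i<n. \<forall>j<n. expected_mat n (D n) $$ (i, j) \<le> K / real n"
    using Delta_ge dpos eventually_gt_at_top[of 0]
  proof eventually_elim
    case (elim n)
    show ?case
    proof (intro allI impI)
      fix i j assume ij: "i < n" "j < n"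
      have pos: "0 < c1 * d n" using c1_pos elim(2) by simp
      then have \<Delta>: "0 < \<Delta> n" using elim(1) by linarith
      have "EG n i j \<le> U * d n / real n" using EG_le mu_le[OF elim(3) ij] by (rule order_trans)
      then have "EG n i j / \<Delta> n \<le> U * d n / real n / \<Delta> n"
        using elim(1) pos by (intro divide_right_mono) linarith+
      also have "\<dots> \<le> U * d n / real n / (c1 * d n)"
        using elim pos U_pos c1_pos \<Delta> by (intro divide_left_mono mult_pos_pos) simp_all
      also have "\<dots> = U / c1 / real n" using elim(2) by simp
      also have "\<dots> \<le> K / real n" using K_ge(3) by (intro divide_right_mono) simp_all
      finally show "expected_mat n (D n) $$ (i, j) \<le> K / real n" unfolding expected_mat_D[OF ij] .
    qed
  qed
  show "\<forall>\<^sub>F n in sequentially. \<forall>i<n. app n (ent (expected_mat n (D n))) (\<lambda>_. 1) i \<le> 1"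
    using Delta_ge dpos
  proof eventually_elim
    case (elim n)
    have "\<Delta> n > 0" using elim mult_pos_pos[OF c1_pos elim(2)] by linarith
    then show ?case
      using row_le_Delta by (simp add: app_def expected_mat_D sum_divide_distrib[symmetric])
  qed
  show "filterlim d at_top sequentially" by (rule d_at_top)
  show "(\<lambda>n. real n * exp (- c * d n)) \<longlonglongrightarrow> 0" if "c > 0" for c by (rule d_exp_decay[OF that])
  have "g \<longlonglongrightarrow> U\<^sup>2 / c1 * 0" unfolding g_def by (intro tendsto_mult tendsto_const d_over_n)
  then show "g \<longlonglongrightarrow> 0" by simp
  show "\<forall>\<^sub>F n in sequentially. \<forall>W \<theta>. (\<forall>i<n. \<forall>j<n. 0 \<le> W i j \<and> W i j \<le> 1) \<longrightarrow> 0 \<le> \<theta> \<longrightarrow> K * \<theta> \<le> d n \<longrightarrow>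
      measure_pmf.expectation (D n) (\<lambda>A. exp (\<theta> * (wsum n W A - wsum n W (expected_mat n (D n)))))
        \<le> exp (\<theta>\<^sup>2 * K * (\<Sum>i<n. \<Sum>j<n. W i j) / (real n * d n) + \<theta> * g n * (\<Sum>i<n. \<Sum>j<n. W i j) / real n)"
    using Delta_ge dpos eventually_gt_at_top[of 0]
  proof eventually_elim
    case (elim n)
    show ?case
    proof (intro allI impI)
      fix W :: "nat \<Rightarrow> nat \<Rightarrow> real" and \<theta> :: real
      assume "\<forall>i<n. \<forall>j<n. 0 \<le> W i j \<and> W i j \<le> 1" "0 \<le> \<theta>" "K * \<theta> \<le> d n"
      then show "measure_pmf.expectation (D n) (\<lambda>A. exp (\<theta> * (wsum n W A - wsum n W (expected_mat n (D n)))))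
        \<le> exp (\<theta>\<^sup>2 * K * (\<Sum>i<n. \<Sum>j<n. W i j) / (real n * d n) + \<theta> * g n * (\<Sum>i<n. \<Sum>j<n. W i j) / real n)"
        by (intro model_mgf elim) blast+
    qed
  qed
qed

end

section \<open>A diagonal null sequence and the assembly of the theorem\<close>

lemma diagonal_null_sequence:
  assumes "\<And>\<delta>::real. \<delta> > 0 \<Longrightarrow> \<forall>\<^sub>F n in sequentially. P n \<delta>"
  shows "\<exists>\<phi>. \<phi> \<longlonglongrightarrow> 0 \<and> (\<forall>\<^sub>F n in sequentially. P n (\<phi> n))"
proof -
  have "\<exists>N. \<forall>n\<ge>N. P n (1 / real (Suc k))" for k
    using assms[of "1 / real (Suc k)"] by (simp add: eventually_sequentially)
  then obtain N where N: "\<And>k n. N k \<le> n \<Longrightarrow> P n (1 / real (Suc k))" by metis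
  \<comment> \<open>The largest index whose threshold \<open>N k\<close> is already passed;
    \<open>k \<le> n\<close> keeps the set finite. Since \<open>\<kappa> n\<close> is itself a
    member, the property holds at the tolerance \<open>1 / real (Suc (\<kappa> n))\<close>.\<close>
  define \<kappa> where "\<kappa> n = Max {k. k \<le> n \<and> N k \<le> n}" for n
  have fin: "finite {k. k \<le> n \<and> N k \<le> n}" for n by simp
  have ge: "k \<le> \<kappa> n" if "k \<le> n" "N k \<le> n" for k n
    unfolding \<kappa>_def using that by (intro Max_ge fin) simp
  have P: "P n (1 / real (Suc (\<kappa> n)))" if "N 0 \<le> n" for n
  proof -
    have "0 \<in> {k. k \<le> n \<and> N k \<le> n}" using that by simp
    then have "\<kappa> n \<in> {k. k \<le> n \<and> N k \<le> n}" unfolding \<kappa>_def by (intro Max_in fin) blast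
    then show ?thesis using N by blast
  qed
  have "filterlim \<kappa> at_top sequentially"
    unfolding filterlim_at_top
  proof
    fix k
    show "\<forall>\<^sub>F n in sequentially. k \<le> \<kappa> n"
      using eventually_ge_at_top[of k] eventually_ge_at_top[of "N k"] by eventually_elim (rule ge)
  qed
  then have "(\<lambda>n. 1 / real (Suc (\<kappa> n))) \<longlonglongrightarrow> 0"
    using filterlim_compose[OF LIMSEQ_inverse_real_of_nat] by (simp only: inverse_eq_divide)
  moreover have "\<forall>\<^sub>F n in sequentially. P n (1 / real (Suc (\<kappa> n)))"
    using eventually_ge_at_top[of "N 0"] by eventually_elim (rule P)
  ultimately show ?thesis by blast
qed

text \<open>Without types the matrix is 0, hence not connected from two nodes on. A type is what
  makes the degree scale tend to infinity.\<close>

lemma connected_imp_types_nonempty: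
  assumes Gbar: "Gbar = (\<lambda>n. normalized n (G n))"
    and model: "G = (\<lambda>n. wSUGM n T (p n)) \<or> G = (\<lambda>n. uSUGM n T (p n))"
    and connected: "(\<lambda>n. measure_pmf.prob (Gbar n) {A. connected_graph A}) \<longlonglongrightarrow> 1"
  shows "T \<noteq> {}"
proof
  assume T: "T = {}"
  have "measure_pmf.prob (Gbar n) {A. connected_graph A} = 0" if n: "n \<ge> 2" for n
  proof -
    have "\<not> connected_graph A" if A: "A \<in> set_pmf (Gbar n)" for A
    proof
      assume conn: "connected_graph A"
      let ?R = "{(a, b). a < dim_row A \<and> b < dim_row A \<and> A $$ (a, b) > 0}"
      have A0: "dim_row A = n" "A $$ (i, j) = 0" if "i < n" "j < n" for i j
        using A model that unfolding Gbar T normalized_def by (auto simp: wSUGM_def uSUGM_def)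
      have n01: "0 < n" "1 < n" using n by simp_all
      have dim: "dim_row A = n" using A0(1)[OF n01] .
      have R: "?R = {}" using A0(2) unfolding dim by fastforce
      have "(0, 1) \<in> ?R\<^sup>*" using conn n01 dim unfolding connected_graph_def by blast
      then show False unfolding R by simp
    qed
    then have "set_pmf (Gbar n) \<inter> {A. connected_graph A} = {}" by blast
    then show ?thesis by (simp only: measure_pmf_zero_iff)
  qed
  then have "(\<lambda>n. measure_pmf.prob (Gbar n) {A. connected_graph A}) \<longlonglongrightarrow> 0"
    by (intro tendsto_eventually eventually_sequentiallyI[of 2])
  from LIMSEQ_unique[OF connected this] show False by simp
qed

theorem corollary4p1:
  fixes T :: "sg_type set"
    and p :: "nat \<Rightarrow> sg_type \<Rightarrow> nat list \<Rightarrow> real"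
    and G Gbar :: "nat \<Rightarrow> real mat pmf"
    and EAbar :: "nat \<Rightarrow> real mat"
    and lstar \<epsilon> :: real
    and c :: centrality_kind
  assumes T: "finite T" "\<forall>t\<in>T. nonempty_graph t"
    and p01: "\<forall>n. \<forall>t\<in>T. \<forall>L\<in>ordered_lists n (fst t). 0 \<le> p n t L \<and> p n t L \<le> 1"
    and model: "G = (\<lambda>n. wSUGM n T (p n)) \<or> G = (\<lambda>n. uSUGM n T (p n))"
    and Gbar: "Gbar = (\<lambda>n. normalized n (G n))"
    and EAbar: "EAbar = (\<lambda>n. expected_mat n (Gbar n))"
    and c: "c \<in> {Degree, Eigenvector} \<union> Katz ` {0 <..< 1 / lstar}"
    and eps: "\<epsilon> > 0"
    and i: "\<forall>t\<in>T. \<exists>h l u. real (fst t) - 2 < h \<and> h < real (fst t) - 1 \<and> 0 < l \<and> l < u \<and>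
              (\<forall>n. \<forall>L\<in>ordered_lists n (fst t).
                 p n t L = 0 \<or> (\<exists>b\<in>{l..u}. p n t L = b / real n powr h))"
    and ii: "\<forall>t\<in>T. \<exists>\<xi>. 0 < \<xi> \<and> \<xi> < 1 \<and>
              (\<forall>n. real (card {L \<in> ordered_lists n (fst t). p n t L > 0})
                     \<ge> \<xi> * real (card (ordered_lists n (fst t))) \<and>
                   (\<forall>i<n. \<forall>j<n. i \<noteq> j \<longrightarrow>
                      real (card {L \<in> ordered_lists n (fst t). i \<in> set L \<and> j \<in> set L \<and> p n t L > 0})
                        \<ge> \<xi> * real (card {L \<in> ordered_lists n (fst t). i \<in> set L \<and> j \<in> set L})))"
    and iii_connected:
      "(\<lambda>n. measure_pmf.prob (Gbar n) {A. connected_graph A}) \<longlonglongrightarrow> 1"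
    and iii_limit: "(\<lambda>n. nth_eigenvalue 1 (EAbar n)) \<longlonglongrightarrow> lstar"
    and iii_gap: "\<exists>\<kappa>1 \<kappa>2. 0 < \<kappa>1 \<and> 0 < \<kappa>2 \<and> (\<forall>\<^sub>F n in sequentially.
        \<bar>nth_eigenvalue 1 (EAbar n) - nth_eigenvalue 2 (EAbar n)\<bar> \<in> {\<kappa>1..\<kappa>2})"
  shows "\<exists>\<phi> :: nat \<Rightarrow> real. \<phi> \<longlonglongrightarrow> 0 \<and>
    (\<forall>\<^sub>F n in sequentially.
       centrality_defined c (EAbar n) \<and>
       measure_pmf.prob (Gbar n)
         {A. centrality_defined c A \<and>
             1 / real n * norm1_vec (centrality c A - centrality c (EAbar n)) \<le> \<phi> n} \<ge> 1 - \<epsilon>)"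
proof -
  have neT: "T \<noteq> {}" by (rule connected_imp_types_nonempty[OF Gbar model iii_connected])
  \<comment> \<open>Successive choices turn the constants of each type into functions of the type,
    as the locale expects.\<close>
  from bchoice[OF i] obtain h where "\<forall>t\<in>T. \<exists>l u. real (fst t) - 2 < h t \<and> h t < real (fst t) - 1 \<and> 0 < l \<and> l < u \<and>
      (\<forall>n. \<forall>L\<in>ordered_lists n (fst t). p n t L = 0 \<or> (\<exists>b\<in>{l..u}. p n t L = b / real n powr h t))"
    by (rule exE)
  from bchoice[OF this] obtain l where "\<forall>t\<in>T. \<exists>u. real (fst t) - 2 < h t \<and> h t < real (fst t) - 1 \<and> 0 < l t \<and> l t < u \<and>
      (\<forall>n. \<forall>L\<in>ordered_lists n (fst t). p n t L = 0 \<or> (\<exists>b\<in>{l t..u}. p n t L = b / real n powr h t))"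
    by (rule exE)
  from bchoice[OF this] obtain u where hlu: "\<forall>t\<in>T. real (fst t) - 2 < h t \<and> h t < real (fst t) - 1 \<and> 0 < l t \<and> l t < u t \<and>
      (\<forall>n. \<forall>L\<in>ordered_lists n (fst t). p n t L = 0 \<or> (\<exists>b\<in>{l t..u t}. p n t L = b / real n powr h t))"
    by (rule exE)
  have "\<forall>t\<in>T. \<exists>\<xi>. 0 < \<xi> \<and> (\<forall>n. \<xi> * real (card (ordered_lists n (fst t))) \<le> real (card {L \<in> ordered_lists n (fst t). p n t L > 0}))"
  proof
    fix t assume "t \<in> T"
    from bspec[OF ii this] show "\<exists>\<xi>. 0 < \<xi> \<and> (\<forall>n. \<xi> * real (card (ordered_lists n (fst t))) \<le>
        real (card {L \<in> ordered_lists n (fst t). p n t L > 0}))"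
    proof (elim exE conjE, intro exI conjI allI)
      fix \<xi> n
      assume all: "\<forall>n. \<xi> * real (card (ordered_lists n (fst t))) \<le> real (card {L \<in> ordered_lists n (fst t). p n t L > 0}) \<and>
        (\<forall>i<n. \<forall>j<n. i \<noteq> j \<longrightarrow>
          \<xi> * real (card {L \<in> ordered_lists n (fst t). i \<in> set L \<and> j \<in> set L})
            \<le> real (card {L \<in> ordered_lists n (fst t). i \<in> set L \<and> j \<in> set L \<and> p n t L > 0}))"
      from spec[OF all, of n]
      show "\<xi> * real (card (ordered_lists n (fst t))) \<le> real (card {L \<in> ordered_lists n (fst t). p n t L > 0})"
        by (rule conjunct1)
    qed
  qed
  from bchoice[OF this] obtain \<xi> where \<xi>: "\<forall>t\<in>T. 0 < \<xi> t \<and>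
      (\<forall>n. \<xi> t * real (card (ordered_lists n (fst t))) \<le> real (card {L \<in> ordered_lists n (fst t). p n t L > 0}))"
    by (rule exE)
  obtain f :: "real \<Rightarrow> real" where f: "f = (\<lambda>a. a) \<and> G = (\<lambda>n. wSUGM n T (p n)) \<or>
      f = (\<lambda>a. min a 1) \<and> G = (\<lambda>n. uSUGM n T (p n))"
    using model by blast
  interpret S: subgraph_model T p h l u \<xi> f
  proof
    show "f = (\<lambda>a. a) \<or> f = (\<lambda>a. min a 1)" using f by blast
    show "finite T" "T \<noteq> {}" by fact+
    fix t assume t: "t \<in> T"
    show "nonempty_graph t" using T(2) t by (rule bspec)
    note ht = bspec[OF hlu t]
    show "real (fst t) - 2 < h t \<and> h t < real (fst t) - 1" using ht by (elim conjE) (intro conjI)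
    show "0 < l t \<and> l t < u t" using ht by (elim conjE) (intro conjI)
    note xt = bspec[OF \<xi> t]
    show "0 < \<xi> t" by (rule conjunct1[OF xt])
    fix n
    show "\<xi> t * real (card (ordered_lists n (fst t))) \<le> real (card {L \<in> ordered_lists n (fst t). p n t L > 0})"
      by (rule spec[OF conjunct2[OF xt]])
    fix L assume L: "L \<in> ordered_lists n (fst t)"
    show "0 \<le> p n t L \<and> p n t L \<le> 1" by (rule bspec[OF bspec[OF spec[OF p01] t] L])
    show "p n t L = 0 \<or> (\<exists>b\<in>{l t..u t}. p n t L = b / real n powr h t)"
    proof (rule bspec[OF _ L])
      show "\<forall>L\<in>ordered_lists n (fst t). p n t L = 0 \<or> (\<exists>b\<in>{l t..u t}. p n t L = b / real n powr h t)"
        using ht by (elim conjE) (rule spec)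
    qed
  qed
  have "G n = S.G n" for n
    using f
  proof (elim disjE conjE)
    assume "f = (\<lambda>a. a)" and G: "G = (\<lambda>n. wSUGM n T (p n))"
    then show "G n = S.G n" unfolding G by (intro S.G_eq_wSUGM[symmetric])
  next
    assume "f = (\<lambda>a. min a 1)" and G: "G = (\<lambda>n. uSUGM n T (p n))"
    then show "G n = S.G n" unfolding G by (intro S.G_eq_uSUGM[symmetric])
  qed
  then have D: "Gbar = S.D" unfolding Gbar S.D_def by simp
  interpret C: concentrated S.D "\<lambda>n. expected_mat n (S.D n)" S.K S.d S.g
    by (rule S.concentrated_model)
  have M: "EAbar = (\<lambda>n. expected_mat n (S.D n))" unfolding EAbar D ..
  obtain \<kappa>1 \<kappa>2 where \<kappa>: "0 < \<kappa>1" "\<forall>\<^sub>F n in sequentially.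
      \<bar>nth_eigenvalue 1 (EAbar n) - nth_eigenvalue 2 (EAbar n)\<bar> \<in> {\<kappa>1..\<kappa>2}" using iii_gap by blast
  have gap: "\<forall>\<^sub>F n in sequentially. \<kappa>1 \<le> \<bar>nth_eigenvalue 1 (EAbar n) - nth_eigenvalue 2 (EAbar n)\<bar>"
    using \<kappa>(2) by eventually_elim simp
  have main: "(\<forall>\<^sub>F n in sequentially. centrality_defined c (EAbar n)) \<and> whp S.D (C.accurate c \<delta>)"
    if \<delta>: "\<delta> > 0" for \<delta>
  proof -
    consider "c = Degree" | "c = Eigenvector" | \<alpha> where "c = Katz \<alpha>" "0 < \<alpha>" "\<alpha> < 1 / lstar" using c by auto
    then show ?thesis
    proof cases
      case 1
      then show ?thesis using C.degree_accurate[OF \<delta>] by simp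
    next
      case 2
      show ?thesis unfolding 2 M
        by (intro conjI C.eigenvector_accurate[OF \<delta> \<kappa>(1) gap[unfolded M]])
    next
      case (3 \<alpha>)
      \<comment> \<open>A positive \<open>\<alpha>\<close> below \<open>1 / lstar\<close> excludes
        \<open>lstar \<le> 0\<close>, also with the convention that division by 0 gives 0; this
        justifies the product form of the condition.\<close>
      have "0 < 1 / lstar" using 3(2,3) by linarith
      then have "lstar > 0" by simp
      then have al: "\<alpha> * lstar < 1" using 3(3) by (simp add: pos_less_divide_eq)
      show ?thesis unfolding 3(1) M
        by (intro conjI C.katz_accurate[OF \<delta> 3(2) al iii_limit[unfolded M]])
    qed
  qed
  show ?thesis
  \<comment> \<open>\<open>\<epsilon>\<close> stays fixed; only the tolerance is made to depend on
    \<open>n\<close>.\<close>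
  proof (rule diagonal_null_sequence)
    fix \<delta> :: real assume \<delta>: "\<delta> > 0"
    have "\<forall>\<^sub>F n in sequentially. centrality_defined c (EAbar n)" using main[OF \<delta>] by blast
    moreover have "\<forall>\<^sub>F n in sequentially. measure_pmf.prob (S.D n) {A. \<not> C.accurate c \<delta> n A} \<le> \<epsilon>"
      using main[OF \<delta>] eps unfolding whp_def by blast
    ultimately show "\<forall>\<^sub>F n in sequentially. centrality_defined c (EAbar n) \<and>
       measure_pmf.prob (Gbar n) {A. centrality_defined c A \<and>
         1 / real n * norm1_vec (centrality c A - centrality c (EAbar n)) \<le> \<delta>} \<ge> 1 - \<epsilon>"
    proof eventually_elim
      case (elim n)
      have "measure_pmf.prob (S.D n) (UNIV - {A. \<not> C.accurate c \<delta> n A}) \<ge> 1 - \<epsilon>"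
        using measure_pmf.prob_compl[of "{A. \<not> C.accurate c \<delta> n A}" "S.D n"] elim(2) by simp
      moreover have "UNIV - {A. \<not> C.accurate c \<delta> n A} = {A. centrality_defined c A \<and>
         1 / real n * norm1_vec (centrality c A - centrality c (EAbar n)) \<le> \<delta>}"
        unfolding C.accurate_def M by blast
      ultimately show ?case using elim(1) unfolding D by simp
    qed
  qed
qed

end
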